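(* Let $K$ be a field, $S=K[x_1,\ldots,x_n]$ with graded maximal ideal $\mathfrak{m}=(x_1,\dots,x_n)$, let $I\subset S$ be a proper monomial ideal of size $t$, and let $I=\bigcap_{j=1}^sQ_j$ be its unique irredundant presentation as an intersection of irreducible monomial ideals. Assume that $\sum_{j=1}^sQ_j$ is $\mathfrak{m}$-primary. Let $\mathbb{G}$ be the complex attached to $\{Q_1,\ldots,Q_s\}$ in $S$. Let $\mathcal{V}=\{V\subset[s] : |V|=t+1,\ \dim S_V=0\}$ and let $W=\bigoplus_{V\in\mathcal{V}}S_V\subset G_{t+1}$. Assume that (a) $\operatorname{Im}(G_t\to G_{t+1})\cap W\neq (0)$; (b) for all $U\subset[s]$ with $|U|=t$ there exists $V\in\mathcal{V}$ with $U\subset V$. Then $I$ has minimal depth, that is, $\operatorname{depth} I=\operatorname{size} I+1$. In particular, conditions (a) and (b) are satisfied if $\operatorname{bigsize} I=\operatorname{size} I$.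
   Context: Irreducible monomial ideals are those generated by powers of a subset of the variables, $(x_{i_1}^{a_1},\ldots,x_{i_k}^{a_k})$; every monomial ideal is in a unique way an irredundant intersection of such ideals. Let $P_j=\sqrt{Q_j}$. Size and bigsize. Let $I=\bigcap_{j=1}^sQ_j$ be a primary decomposition with monomial $P_j$-primary ideals $Q_j$ and $\operatorname{Ass}(S/I)=\{P_1,\ldots,P_s\}$ (here: the irreducible decomposition above). Let $h=\operatorname{height}\sum_{j=1}^sQ_j$. Then $\operatorname{size} I=v+(n-h)-1$, where $v$ is the minimum number $t$ such that there exist $j_1<\cdots<j_t$ in $[s]$ with $\sqrt{\sum_{k=1}^tQ_{j_k}}=\sqrt{\sum_{j=1}^sQ_j}$ (equivalently $\sum_{k=1}^tP_{j_k}=\sum_{j=1}^sP_j$); this depends only on $\operatorname{Ass}(S/I)$. The number $\operatorname{bigsize} I$ is defined in the same way, replacing "there exist $j_1<\cdots<j_t$" by "for all $j_1<\cdots<j_t$", the indices ranging over the indices $1,\dots,s$ of $Q_1,\ldots,Q_s$. Complex. Write $[s]=\{1,\ldots,s\}$. For $U\subset[s]$ put $S_U=S/(\sum_{j\in U}Q_j)$ (so $S_\emptyset=S$). The complex $\mathbb{G}$ attached to $\{Q_1,\ldots,Q_s\}$ in $S$ is $0\to G_0\to G_1\to\cdots\to G_s\to0$ with $G_i=\bigoplus_{U\subset[s],|U|=i}S_U$, where the component $S_U\to S_V$ of $G_i\to G_{i+1}$ is zero if $U\not\subset V$, and, if $V=U\cup\{k\}$, is the canonical residue class map multiplied by $(-1)^\ell$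 with $\ell$ the number of $j\in U$ with $j<k$. Here $\dim$ is Krull dimension and $\operatorname{depth} I$ is the depth of $I$ as a graded $S$-module (with respect to $\mathfrak{m}$). *)

theory Defs
  imports
    "HOL-Library.Poly_Mapping"
    "HOL-Library.Extended_Real"
    "HOL-Algebra.QuotRing"
    "HOL-Algebra.Module"
    "HOL-Algebra.Algebraic_Closure_Type"
begin

section \<open>Ideals, dimension and height in a commutative ring\<close>

definition ideal_sum :: "('a, 'b) ring_scheme \<Rightarrow> ('i \<Rightarrow> 'a set) \<Rightarrow> 'i set \<Rightarrow> 'a set"
  where "ideal_sum R Q U = Idl\<^bsub>R\<^esub> (\<Union>j\<in>U. Q j)"

definition radical :: "('a, 'b) ring_scheme \<Rightarrow> 'a set \<Rightarrow> 'a set"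
  where "radical R J = {a \<in> carrier R. \<exists>k::nat. a [^]\<^bsub>R\<^esub> k \<in> J}"

definition primary_ideal :: "('a, 'b) ring_scheme \<Rightarrow> 'a set \<Rightarrow> bool"
  where "primary_ideal R J \<longleftrightarrow>
    ideal J R \<and> J \<noteq> carrier R \<and>
    (\<forall>a\<in>carrier R. \<forall>b\<in>carrier R. a \<otimes>\<^bsub>R\<^esub> b \<in> J \<longrightarrow> a \<in> J \<or> b \<in> radical R J)"

definition P_primary :: "('a, 'b) ring_scheme \<Rightarrow> 'a set \<Rightarrow> 'a set \<Rightarrow> bool"
  where "P_primary R P J \<longleftrightarrow> primary_ideal R J \<and> radical R J = P"

definition prime_chain :: "('a, 'b) ring_scheme \<Rightarrow> (nat \<Rightarrow> 'a set) \<Rightarrow> nat \<Rightarrow> bool"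
  where "prime_chain R C l \<longleftrightarrow> (\<forall>i\<le>l. primeideal (C i) R) \<and> (\<forall>i<l. C i \<subset> C (Suc i))"

text \<open>Extended reals make the zero ring have dimension \<open>-\<infinity>\<close> and the unit ideal
  have height \<open>\<infinity>\<close>.\<close>

definition krull_dim :: "('a, 'b) ring_scheme \<Rightarrow> ereal"
  where "krull_dim R = (SUP l \<in> {l. \<exists>C. prime_chain R C l}. ereal (real l))"

definition prime_height :: "('a, 'b) ring_scheme \<Rightarrow> 'a set \<Rightarrow> ereal"
  where "prime_height R P = (SUP l \<in> {l. \<exists>C. prime_chain R C l \<and> C l = P}. ereal (real l))"

definition height :: "('a, 'b) ring_scheme \<Rightarrow> 'a set \<Rightarrow> ereal"
  where "height R J = (INF P \<in> {P. primeideal P R \<and> J \<subseteq> P}. prime_height R P)"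


section \<open>Modules and depth\<close>

definition ideal_module :: "('a, 'b) ring_scheme \<Rightarrow> 'a set \<Rightarrow> ('a, 'a) module"
  where "ideal_module R J =
    \<lparr>carrier = J, monoid.mult = monoid.mult R, one = one R, zero = zero R, add = add R,
     module.smult = monoid.mult R\<rparr>"

definition quot_module :: "('a, 'b) ring_scheme \<Rightarrow> 'a set \<Rightarrow> ('a, 'a set) module"
  where "quot_module R J =
    \<lparr>carrier = carrier (R Quot J), monoid.mult = monoid.mult (R Quot J), one = one (R Quot J),
     zero = zero (R Quot J), add = add (R Quot J),
     module.smult = (\<lambda>a c. (J +>\<^bsub>R\<^esub> a) \<otimes>\<^bsub>R Quot J\<^esub> c)\<rparr>"

text \<open>The direct sum of a finite family of modules, as the module of (extensional) tuples.
  The fields \<open>mult\<close> and \<open>one\<close> are required by the record type but play no role for modules.\<close>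

definition direct_sum :: "'i set \<Rightarrow> ('i \<Rightarrow> ('a, 'm) module) \<Rightarrow> ('a, 'i \<Rightarrow> 'm) module"
  where "direct_sum A M =
    \<lparr>carrier = (\<Pi>\<^sub>E i\<in>A. carrier (M i)),
     monoid.mult = (\<lambda>x y. \<lambda>i\<in>A. x i \<otimes>\<^bsub>M i\<^esub> y i), one = (\<lambda>i\<in>A. \<one>\<^bsub>M i\<^esub>),
     zero = (\<lambda>i\<in>A. \<zero>\<^bsub>M i\<^esub>), add = (\<lambda>x y. \<lambda>i\<in>A. x i \<oplus>\<^bsub>M i\<^esub> y i),
     module.smult = (\<lambda>a x. \<lambda>i\<in>A. a \<odot>\<^bsub>M i\<^esub> x i)\<rparr>"

text \<open>\<open>seq_mult M [f\<^sub>1, \<dots>, f\<^sub>r]\<close> is the submodule \<open>(f\<^sub>1, \<dots>, f\<^sub>r) M\<close>.\<close>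

definition seq_mult :: "('a, 'm) module \<Rightarrow> 'a list \<Rightarrow> 'm set"
  where "seq_mult M fs =
    {\<Oplus>\<^bsub>M\<^esub>k\<in>{..<length fs}. fs ! k \<odot>\<^bsub>M\<^esub> m k | m. m \<in> {..<length fs} \<rightarrow> carrier M}"

definition regular_seq :: "('a, 'b) ring_scheme \<Rightarrow> ('a, 'm) module \<Rightarrow> 'a list \<Rightarrow> bool"
  where "regular_seq R M fs \<longleftrightarrow>
    set fs \<subseteq> carrier R \<and>
    (\<forall>k<length fs. \<forall>x\<in>carrier M.
       fs ! k \<odot>\<^bsub>M\<^esub> x \<in> seq_mult M (take k fs) \<longrightarrow> x \<in> seq_mult M (take k fs)) \<and>
    seq_mult M fs \<noteq> carrier M"

text \<open>The supremum of the lengths of the \<open>M\<close>-regular sequences in \<open>J\<close>.  For a finitely generated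
  graded module \<open>M \<noteq> 0\<close> and the graded maximal ideal this is the common length of the maximal
  ones, also if only homogeneous sequences are considered.  The value at \<open>M = 0\<close>, namely \<open>-\<infinity>\<close>,
  is an artefact.\<close>

definition depth :: "('a, 'b) ring_scheme \<Rightarrow> 'a set \<Rightarrow> ('a, 'm) module \<Rightarrow> ereal"
  where "depth R J M =
    (SUP fs \<in> {fs. regular_seq R M fs \<and> set fs \<subseteq> J}. ereal (real (length fs)))"


section \<open>Monomial ideals in a polynomial ring\<close>

text \<open>\<open>('n, 'k) mpoly\<close> with \<open>'n\<close> finite is the type of polynomials over \<open>'k\<close> in \<open>card (UNIV :: 'n set)\<close>
  variables, indexed by the elements of \<open>'n\<close>.\<close>

type_synonym ('n, 'k) mpoly = "('n \<Rightarrow>\<^sub>0 nat) \<Rightarrow>\<^sub>0 'k"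

abbreviation poly_ring :: "('n::finite, 'k::field) mpoly ring" (\<open>\<S>\<close>)
  where "\<S> \<equiv> ring_of_type_algebra"

definition monomial :: "('n::finite \<Rightarrow>\<^sub>0 nat) \<Rightarrow> ('n, 'k::field) mpoly"
  where "monomial e = Poly_Mapping.single e 1"

definition var :: "'n::finite \<Rightarrow> ('n, 'k::field) mpoly"
  where "var i = monomial (Poly_Mapping.single i 1)"

definition max_ideal :: "('n::finite, 'k::field) mpoly set" (\<open>\<mm>\<close>)
  where "\<mm> = Idl\<^bsub>\<S>\<^esub> (range var)"

definition monomial_ideal :: "('n::finite, 'k::field) mpoly set \<Rightarrow> bool"
  where "monomial_ideal I \<longleftrightarrow> (\<exists>E. I = Idl\<^bsub>\<S>\<^esub> (monomial ` E))"

definition irreducible_monomial_ideal :: "('n::finite, 'k::field) mpoly set \<Rightarrow> bool"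
  where "irreducible_monomial_ideal J \<longleftrightarrow>
    (\<exists>A a. (\<forall>i\<in>A. 0 < a i) \<and> J = Idl\<^bsub>\<S>\<^esub> ((\<lambda>i. var i ^ a i) ` A))"

text \<open>\<open>Q 1, \<dots>, Q s\<close> is an irredundant presentation of \<open>I\<close>; the values of \<open>Q\<close> elsewhere are
  irrelevant.  The empty intersection is \<open>UNIV = carrier \<S>\<close>.\<close>

definition irredundant_presentation ::
    "('n::finite, 'k::field) mpoly set \<Rightarrow> nat \<Rightarrow> (nat \<Rightarrow> ('n, 'k) mpoly set) \<Rightarrow> bool"
  where "irredundant_presentation I s Q \<longleftrightarrow>
    (\<forall>j\<in>{1..s}. irreducible_monomial_ideal (Q j)) \<and>
    I = (\<Inter>j\<in>{1..s}. Q j) \<and>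
    (\<forall>k\<in>{1..s}. (\<Inter>j\<in>{1..s} - {k}. Q j) \<noteq> I)"


section \<open>Size and bigsize\<close>

text \<open>The subsets \<open>U\<close> of \<open>{1..s}\<close> with \<open>t\<close> elements correspond to the sequences
  \<open>j\<^sub>1 < \<dots> < j\<^sub>t\<close>.\<close>

definition spans ::
    "nat \<Rightarrow> (nat \<Rightarrow> ('n::finite, 'k::field) mpoly set) \<Rightarrow> nat set \<Rightarrow> bool"
  where "spans s Q U \<longleftrightarrow>
    radical \<S> (ideal_sum \<S> Q U) = radical \<S> (ideal_sum \<S> Q {1..s})"

definition family_size ::
    "nat \<Rightarrow> (nat \<Rightarrow> ('n::finite, 'k::field) mpoly set) \<Rightarrow> ereal"
  where "family_size s Q =
    (let v = (LEAST t. \<exists>U\<subseteq>{1..s}. card U = t \<and> spans s Q U)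
     in ereal (real v) + (ereal (real (card (UNIV :: 'n set))) - height \<S> (ideal_sum \<S> Q {1..s})) - 1)"

definition family_bigsize ::
    "nat \<Rightarrow> (nat \<Rightarrow> ('n::finite, 'k::field) mpoly set) \<Rightarrow> ereal"
  where "family_bigsize s Q =
    (let v = (LEAST t. \<forall>U\<subseteq>{1..s}. card U = t \<longrightarrow> spans s Q U)
     in ereal (real v) + (ereal (real (card (UNIV :: 'n set))) - height \<S> (ideal_sum \<S> Q {1..s})) - 1)"

text \<open>The irredundant presentation is unique up to the numbering of its members, on which
  size and bigsize of the family do not depend.\<close>

definition ideal_size :: "('n::finite, 'k::field) mpoly set \<Rightarrow> ereal"
  where "ideal_size I =
    (THE z. \<exists>s Q. irredundant_presentation I s Q \<and> z = family_size s Q)"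

definition ideal_bigsize :: "('n::finite, 'k::field) mpoly set \<Rightarrow> ereal"
  where "ideal_bigsize I =
    (THE z. \<exists>s Q. irredundant_presentation I s Q \<and> z = family_bigsize s Q)"


section \<open>The complex attached to a family of ideals\<close>

definition index_sets :: "nat \<Rightarrow> nat \<Rightarrow> nat set set"
  where "index_sets s i = {U. U \<subseteq> {1..s} \<and> card U = i}"

definition quot_ring ::
    "(nat \<Rightarrow> ('n::finite, 'k::field) mpoly set) \<Rightarrow> nat set \<Rightarrow> ('n, 'k) mpoly set ring"
  where "quot_ring Q U = \<S> Quot (ideal_sum \<S> Q U)"

definition complex_module ::
    "nat \<Rightarrow> (nat \<Rightarrow> ('n::finite, 'k::field) mpoly set) \<Rightarrow> nat \<Rightarrow>
      (('n, 'k) mpoly, nat set \<Rightarrow> ('n, 'k) mpoly set) module"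
  where "complex_module s Q i =
    direct_sum (index_sets s i) (\<lambda>U. quot_module \<S> (ideal_sum \<S> Q U))"

text \<open>The component \<open>S\<^sub>U \<rightarrow> S\<^sub>V\<close> for \<open>|V| = |U| + 1\<close>.  If \<open>U \<subseteq> V\<close>, then \<open>V = U \<union> {k}\<close> with
  \<open>k = the_elem (V - U)\<close>.  Writing \<open>I\<^sub>U \<subseteq> I\<^sub>V\<close> for the two ideals, the canonical map takes a
  coset \<open>c = I\<^sub>U + a\<close> to \<open>I\<^sub>V + c = I\<^sub>V + a\<close>.\<close>

definition complex_component ::
    "(nat \<Rightarrow> ('n::finite, 'k::field) mpoly set) \<Rightarrow> nat set \<Rightarrow> nat set \<Rightarrow>
      ('n, 'k) mpoly set \<Rightarrow> ('n, 'k) mpoly set"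
  where "complex_component Q U V c =
    (let T = quot_ring Q V in
     if U \<subseteq> V
     then ((\<ominus>\<^bsub>T\<^esub> \<one>\<^bsub>T\<^esub>) [^]\<^bsub>T\<^esub> card {j \<in> U. j < the_elem (V - U)})
            \<otimes>\<^bsub>T\<^esub> (ideal_sum \<S> Q V <+>\<^bsub>\<S>\<^esub> c)
     else \<zero>\<^bsub>T\<^esub>)"

definition complex_diff ::
    "nat \<Rightarrow> (nat \<Rightarrow> ('n::finite, 'k::field) mpoly set) \<Rightarrow> nat \<Rightarrow>
      (nat set \<Rightarrow> ('n, 'k) mpoly set) \<Rightarrow> (nat set \<Rightarrow> ('n, 'k) mpoly set)"
  where "complex_diff s Q i g =
    (\<lambda>V\<in>index_sets s (i + 1).
       \<Oplus>\<^bsub>quot_ring Q V\<^esub>U\<in>index_sets s i. complex_component Q U V (g U))"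

text \<open>The submodule \<open>\<Oplus>\<^bsub>V \<in> A\<^esub> S\<^sub>V\<close> of \<open>G\<^sub>i\<close>, for a set \<open>A\<close> of index sets with \<open>i\<close> elements.\<close>

definition complex_summand ::
    "nat \<Rightarrow> (nat \<Rightarrow> ('n::finite, 'k::field) mpoly set) \<Rightarrow> nat \<Rightarrow> nat set set \<Rightarrow>
      (nat set \<Rightarrow> ('n, 'k) mpoly set) set"
  where "complex_summand s Q i A =
    {g \<in> carrier (complex_module s Q i).
       \<forall>V\<in>index_sets s i - A. g V = \<zero>\<^bsub>quot_ring Q V\<^esub>}"

end

theory Submission
  imports Defs "HOL-Library.Function_Algebras"
begin

text \<open>Write \<open>S\<^sub>U\<close> for the quotient of the polynomial ring by the sum of the \<open>Q\<^sub>j\<close> with \<open>j \<in> U\<close>.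
Since the sum of all \<open>Q\<^sub>j\<close> is primary to the maximal ideal, its height is the number of variables,
and size \<open>t\<close> means that \<open>t + 1\<close> is the least number of members whose variables exhaust all variables.
Hence at least \<open>t + 1 - |U|\<close> variables are missing from \<open>\<Sum>\<^sub>U Q\<^sub>j\<close> whenever \<open>|U| \<le> t\<close>, for one can
complete \<open>U\<close> to a spanning family by one further member for each missing variable.

In a fixed multidegree the complex is the cochain complex of a simplex (on the \<open>j\<close> for which
the monomial avoids \<open>Q\<^sub>j\<close>), so the complex is exact except at \<open>G\<^sub>0\<close>, where its kernel is \<open>I\<close>
(\<open>cocycle_is_coboundary\<close>, \<open>cocycles_0\<close>).  With \<open>Z\<^sub>i\<close> the kernel in \<open>G\<^sub>i\<close> there are short exact
sequences \<open>0 \<rightarrow> Z\<^sub>i \<rightarrow> G\<^sub>i \<rightarrow> Z\<^sub>i\<^sub>+\<^sub>1 \<rightarrow> 0\<close> (\<open>incidence_diff_iso\<close>), and \<open>Z\<^sub>0 = I\<close>.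

Lower bound.  The elementary symmetric polynomials in sufficiently high powers of the variables form
one sequence \<open>f\<^sub>1, f\<^sub>2, \<dots>\<close> whose first \<open>d\<close> members are regular on every \<open>S\<^sub>U\<close> with at least
\<open>d\<close> missing variables (\<open>elem_sym_weakly_regular\<close>).  Therefore \<open>f\<^sub>1, \<dots>, f\<^sub>t\<^sub>+\<^sub>1\<^sub>-\<^sub>i\<close> is regular on \<open>G\<^sub>i\<close>,
and descending along the short exact sequences (\<open>weakly_regular_kernel\<close>) makes
\<open>f\<^sub>1, \<dots>, f\<^sub>t\<^sub>+\<^sub>1\<close> regular on \<open>I\<close>.

Upper bound.  Koszul cohomology with respect to the variables vanishes below the length of any regular
sequence in the maximal ideal (\<open>weakly_regular_imp_koszul_vanishes\<close>).  If \<open>I\<close> had a regular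
sequence of length \<open>t + 2\<close>, then ascending along the same short exact sequences
(\<open>koszul_vanishes_quotient\<close>) would give vanishing in degree \<open>0\<close> for \<open>Z\<^sub>t\<^sub>+\<^sub>1\<close>, that is, \<open>Z\<^sub>t\<^sub>+\<^sub>1\<close>
would have no socle.  But condition (a) yields a nonzero element of \<open>Z\<^sub>t\<^sub>+\<^sub>1\<close> supported on components of
dimension zero, and a suitable monomial multiple of it is a socle element (\<open>socle_element\<close>).

If the bigsize equals the size, then all \<open>V\<close> with \<open>t + 1\<close> elements have \<open>dim S\<^sub>V = 0\<close>, so \<open>W\<close> is all of
\<open>G\<^sub>t\<^sub>+\<^sub>1\<close>, and the image of the element \<open>1\<close> of a component \<open>S\<^sub>U\<close> with \<open>|U| = t\<close> is not zero because it
has a component \<open>\<plusminus>1\<close>.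

Quotient modules are handled throughout as pairs \<open>(M, N)\<close> of submodules of an ambient module, which
avoids computing with residue classes: elements of \<open>G\<^sub>i\<close> are represented by families of polynomials.\<close>

section \<open>Regular sequences on subquotients\<close>

locale comm_module = Modules.module
begin

text \<open>For submodules \<open>N \<subseteq> M\<close> this is \<open>N + f M\<close>, so that \<open>(M, N + f M)\<close> represents the quotient of
  \<open>M / N\<close> by the multiples of \<open>f\<close>.\<close>

definition add_multiples :: "'b set \<Rightarrow> 'a \<Rightarrow> 'b set \<Rightarrow> 'b set"
  where "add_multiples N f M = {n + f *s m | n m. n \<in> N \<and> m \<in> M}"

text \<open>The members of the list are successively nonzerodivisors on \<open>M / N\<close>; the quotient by the whole
  sequence may vanish, which is what makes the notion stable along exact sequences.\<close>

primrec weakly_regular :: "'a list \<Rightarrow> 'b set \<Rightarrow> 'b set \<Rightarrow> bool"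
  where
    "weakly_regular [] M N \<longleftrightarrow> True"
  | "weakly_regular (f # fs) M N \<longleftrightarrow>
       (\<forall>x\<in>M. f *s x \<in> N \<longrightarrow> x \<in> N) \<and> weakly_regular fs M (add_multiples N f M)"

text \<open>The linear map \<open>\<phi>\<close> induces an isomorphism \<open>M / N \<rightarrow> M' / N'\<close>.\<close>

definition subquotient_iso :: "('b \<Rightarrow> 'b) \<Rightarrow> 'b set \<Rightarrow> 'b set \<Rightarrow> 'b set \<Rightarrow> 'b set \<Rightarrow> bool"
  where "subquotient_iso \<phi> M N M' N' \<longleftrightarrow>
    module_hom scale scale \<phi> \<and>
    (\<forall>x\<in>M. \<phi> x \<in> M' \<and> (\<phi> x \<in> N' \<longleftrightarrow> x \<in> N)) \<and> (\<forall>y\<in>M'. \<exists>x\<in>M. y - \<phi> x \<in> N')"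

lemma add_multiplesI: "n \<in> N \<Longrightarrow> m \<in> M \<Longrightarrow> n + f *s m \<in> add_multiples N f M"
  unfolding add_multiples_def by blast

lemma subspace_add_multiples:
  assumes "subspace N" "subspace M"
  shows "subspace (add_multiples N f M)"
proof (rule subspaceI)
  show "0 \<in> add_multiples N f M"
    using add_multiplesI[of 0 N 0 M f] assms by (simp add: subspace_0)
next
  fix x y assume "x \<in> add_multiples N f M" "y \<in> add_multiples N f M"
  then obtain n m n' m' where "x = n + f *s m" "y = n' + f *s m'" "n \<in> N" "n' \<in> N" "m \<in> M" "m' \<in> M"
    unfolding add_multiples_def by blast
  moreover from this have "x + y = (n + n') + f *s (m + m')"
    by (simp add: scale_right_distrib algebra_simps)
  ultimately show "x + y \<in> add_multiples N f M"
    using add_multiplesI[of "n + n'" N "m + m'" M f] assms by (simp only: subspace_add)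
next
  fix c x assume "x \<in> add_multiples N f M"
  then obtain n m where "x = n + f *s m" "n \<in> N" "m \<in> M"
    unfolding add_multiples_def by blast
  moreover from this have "c *s x = c *s n + f *s (c *s m)"
    by (simp only: scale_right_distrib scale_left_commute[of c f])
  ultimately show "c *s x \<in> add_multiples N f M"
    using add_multiplesI[of "c *s n" N "c *s m" M f] assms by (simp add: subspace_scale)
qed

lemma subset_add_multiples: "subspace M \<Longrightarrow> N \<subseteq> add_multiples N f M"
  using add_multiplesI[of _ N 0 M f] subspace_0[of M] by auto

lemma add_multiples_subset: "subspace M \<Longrightarrow> N \<subseteq> M \<Longrightarrow> add_multiples N f M \<subseteq> M"
  unfolding add_multiples_def by (auto intro: subspace_add subspace_scale)

lemma scale_in_add_multiples: "subspace N \<Longrightarrow> m \<in> M \<Longrightarrow> f *s m \<in> add_multiples N f M"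
  using add_multiplesI[of 0 N m M f] subspace_0[of N] by auto

lemma subquotient_iso_add_multiples:
  assumes iso: "subquotient_iso \<phi> M N M' N'"
    and sub: "subspace M" "subspace N" "subspace M'" "subspace N'" "N' \<subseteq> M'"
  shows "subquotient_iso \<phi> M (add_multiples N f M) M' (add_multiples N' f M')"
proof -
  interpret phi: module_hom scale scale \<phi>
    using iso unfolding subquotient_iso_def by blast
  have in_M': "\<phi> x \<in> M'" and mem_N': "\<phi> x \<in> N' \<longleftrightarrow> x \<in> N" if "x \<in> M" for x
    using iso that unfolding subquotient_iso_def by auto
  have lift: "\<exists>x\<in>M. y - \<phi> x \<in> N'" if "y \<in> M'" for y
    using iso that unfolding subquotient_iso_def by auto
  have "\<phi> x \<in> add_multiples N' f M' \<longleftrightarrow> x \<in> add_multiples N f M" if x: "x \<in> M" for x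
  proof
    assume "\<phi> x \<in> add_multiples N' f M'"
    then obtain n' m' where *: "\<phi> x = n' + f *s m'" "n' \<in> N'" "m' \<in> M'"
      unfolding add_multiples_def by blast
    obtain m where m: "m \<in> M" "m' - \<phi> m \<in> N'"
      using lift[OF *(3)] by blast
    have "\<phi> (x - f *s m) = n' + f *s (m' - \<phi> m)"
      by (simp add: phi.diff phi.scale *(1) scale_right_diff_distrib)
    also have "\<dots> \<in> N'"
      using * m sub by (intro subspace_add subspace_scale)
    finally have "x - f *s m \<in> N"
      using mem_N'[of "x - f *s m"] x m sub by (auto intro: subspace_diff subspace_scale)
    from add_multiplesI[OF this m(1), of f] show "x \<in> add_multiples N f M" by simp
  next
    assume "x \<in> add_multiples N f M"
    then obtain n m where *: "x = n + f *s m" "n \<in> N" "m \<in> M"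
      unfolding add_multiples_def by blast
    have "x - f *s m \<in> M" using x * sub by (intro subspace_diff subspace_scale)
    then have "n \<in> M" using * by simp
    then have "\<phi> n \<in> N'" using mem_N' * by blast
    moreover have "\<phi> x = \<phi> n + f *s \<phi> m"
      by (simp add: * phi.add phi.scale)
    ultimately show "\<phi> x \<in> add_multiples N' f M'"
      using in_M' * by (auto intro: add_multiplesI)
  qed
  moreover have "N' \<subseteq> add_multiples N' f M'"
    using sub by (intro subset_add_multiples)
  ultimately show ?thesis
    using iso unfolding subquotient_iso_def by blast
qed

lemma weakly_regular_iso:
  assumes "subquotient_iso \<phi> M N M' N'"
    and "subspace M" "subspace N" "subspace M'" "subspace N'" "N' \<subseteq> M'"
  shows "weakly_regular fs M N \<longleftrightarrow> weakly_regular fs M' N'"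
  using assms
proof (induction fs arbitrary: N N')
  case Nil
  then show ?case by simp
next
  case (Cons f fs)
  note iso = Cons.prems(1) and sub = Cons.prems(2-)
  interpret phi: module_hom scale scale \<phi>
    using iso unfolding subquotient_iso_def by blast
  have in_M': "\<phi> x \<in> M'" and mem_N': "\<phi> x \<in> N' \<longleftrightarrow> x \<in> N" if "x \<in> M" for x
    using iso that unfolding subquotient_iso_def by auto
  have lift: "\<exists>x\<in>M. y - \<phi> x \<in> N'" if "y \<in> M'" for y
    using iso that unfolding subquotient_iso_def by auto
  have tail: "weakly_regular fs M (add_multiples N f M) \<longleftrightarrow>
      weakly_regular fs M' (add_multiples N' f M')"
    using subquotient_iso_add_multiples[OF iso sub] sub
    by (intro Cons.IH) (auto intro: subspace_add_multiples add_multiples_subset[THEN subsetD])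
  have head: "(\<forall>x\<in>M. f *s x \<in> N \<longrightarrow> x \<in> N) \<longleftrightarrow> (\<forall>y\<in>M'. f *s y \<in> N' \<longrightarrow> y \<in> N')"
  proof (intro iffI ballI impI)
    fix y assume *: "\<forall>x\<in>M. f *s x \<in> N \<longrightarrow> x \<in> N" "y \<in> M'" "f *s y \<in> N'"
    obtain x where x: "x \<in> M" "y - \<phi> x \<in> N'" using lift *(2) by blast
    have "\<phi> (f *s x) = f *s y - f *s (y - \<phi> x)"
      by (simp add: phi.scale scale_right_diff_distrib)
    also have "\<dots> \<in> N'"
      by (rule subspace_diff[OF sub(4) *(3) subspace_scale[OF sub(4) x(2)]])
    finally have "x \<in> N" using mem_N'[of "f *s x"] * x sub by (auto intro: subspace_scale)
    then have "\<phi> x \<in> N'" using mem_N' x by blast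
    from subspace_add[OF sub(4) this x(2)] show "y \<in> N'" by simp
  next
    fix x assume *: "\<forall>y\<in>M'. f *s y \<in> N' \<longrightarrow> y \<in> N'" "x \<in> M" "f *s x \<in> N"
    have "f *s x \<in> M" using * sub by (auto intro: subspace_scale)
    then have "f *s \<phi> x \<in> N'" using mem_N' * by (simp flip: phi.scale)
    then show "x \<in> N" using * in_M' mem_N' by blast
  qed
  show ?case unfolding weakly_regular.simps using head tail by blast
qed

text \<open>The depth lemma for \<open>0 \<rightarrow> Z / N \<rightarrow> P / N \<rightarrow> P / Z \<rightarrow> 0\<close>.  The first member \<open>f\<close> of the sequence is a
  nonzerodivisor on the submodule \<open>Z / N\<close>.  If the sequence goes on, \<open>f\<close> is also a nonzerodivisor on
  \<open>P / Z\<close>, so the sequence stays exact modulo \<open>f\<close>, and induction applies to the remaining members.\<close>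

lemma weakly_regular_kernel:
  assumes "weakly_regular fs P N" "weakly_regular (butlast fs) P Z"
    and "subspace P" "subspace N" "subspace Z" "N \<subseteq> Z" "Z \<subseteq> P"
  shows "weakly_regular fs Z N"
  using assms
proof (induction fs arbitrary: N Z)
  case Nil
  then show ?case by simp
next
  case (Cons f fs)
  note sub = Cons.prems(3-)
  have head: "\<forall>x\<in>Z. f *s x \<in> N \<longrightarrow> x \<in> N" and tail_N: "weakly_regular fs P (add_multiples N f P)"
    using Cons.prems(1) sub(5) unfolding weakly_regular.simps by blast+
  show ?case
  proof (cases "fs = []")
    case True
    then show ?thesis using head by (simp only: weakly_regular.simps simp_thms)
  next
    case False
    let ?N = "add_multiples N f P" and ?Z = "add_multiples Z f P"
    have "weakly_regular (f # butlast fs) P Z"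
      using Cons.prems(2) False by (simp del: weakly_regular.simps)
    then have reg_Z: "x \<in> P \<Longrightarrow> f *s x \<in> Z \<Longrightarrow> x \<in> Z"
      and tail_Z: "weakly_regular (butlast fs) P ?Z" for x
      unfolding weakly_regular.simps by blast+
    have s: "subspace ?N" "subspace ?Z" "?Z \<subseteq> P" "?N \<subseteq> ?Z"
      "subspace (add_multiples N f Z)" "?N \<subseteq> P"
    proof -
      show "subspace ?N" "subspace ?Z" "subspace (add_multiples N f Z)"
        by (rule subspace_add_multiples, fact, fact)+
      have "N \<subseteq> P" using sub by blast
      then show "?N \<subseteq> P" by (rule add_multiples_subset[OF sub(1)])
      show "?Z \<subseteq> P" by (rule add_multiples_subset[OF sub(1) sub(5)])
      show "?N \<subseteq> ?Z" using sub(4) unfolding add_multiples_def by blast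
    qed
    have "weakly_regular fs ?Z ?N"
      by (rule Cons.IH[OF tail_N tail_Z sub(1) s(1,2,4,3)])
    moreover have "subquotient_iso id Z (add_multiples N f Z) ?Z ?N"
      unfolding subquotient_iso_def
    proof (intro conjI ballI)
      show "module_hom scale scale id" by (rule module_hom_id)
      fix x assume x: "x \<in> Z"
      then show "id x \<in> ?Z" using subset_add_multiples[OF sub(1), of Z f] by auto
      show "(id x \<in> ?N) = (x \<in> add_multiples N f Z)"
      proof
        assume "id x \<in> ?N"
        then obtain n p where *: "x = n + f *s p" "n \<in> N" "p \<in> P"
          unfolding add_multiples_def by auto
        have "f *s p = x - n" using * by simp
        also have "\<dots> \<in> Z" using x * sub by (intro subspace_diff) auto
        finally have "p \<in> Z" using reg_Z * by blast
        then show "x \<in> add_multiples N f Z" using * by (auto intro: add_multiplesI)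
      next
        assume "x \<in> add_multiples N f Z"
        then show "id x \<in> ?N" using sub(5) unfolding add_multiples_def by auto
      qed
    next
      fix y assume "y \<in> ?Z"
      then obtain z p where *: "y = z + f *s p" "z \<in> Z" "p \<in> P"
        unfolding add_multiples_def by auto
      have "f *s p \<in> ?N" using * sub by (intro scale_in_add_multiples)
      then show "\<exists>x\<in>Z. y - id x \<in> ?N" using * by (intro bexI[of _ z]) auto
    qed
    ultimately have "weakly_regular fs Z (add_multiples N f Z)"
      using weakly_regular_iso[of id Z "add_multiples N f Z" ?Z ?N fs] s sub by (simp only:)
    with head show ?thesis unfolding weakly_regular.simps by blast
  qed
qed

end

section \<open>Koszul cochains\<close>

definition koszul_sign :: "nat \<Rightarrow> nat set \<Rightarrow> 'a::comm_ring_1"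
  where "koszul_sign k V = (-1) ^ card {j \<in> V. j < k}"

lemma koszul_sign_sq [simp]: "koszul_sign k V * koszul_sign k V = (1::'a::comm_ring_1)"
  by (simp add: koszul_sign_def flip: power_add mult_2)

lemma koszul_sign_self: "koszul_sign k (V - {k}) = koszul_sign k V"
  unfolding koszul_sign_def by (rule arg_cong[where f = "\<lambda>A. (-1) ^ card A"]) auto

lemma koszul_sign_insert_self: "koszul_sign k (insert k V) = koszul_sign k V"
  unfolding koszul_sign_def by (rule arg_cong[where f = "\<lambda>A. (-1) ^ card A"]) auto

lemma koszul_sign_insert:
  assumes "finite V" "i \<notin> V"
  shows "koszul_sign k (insert i V) = (if i < k then - koszul_sign k V else koszul_sign k V)"
proof -
  have "{j \<in> insert i V. j < k} = (if i < k then insert i {j \<in> V. j < k} else {j \<in> V. j < k})"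
    by auto
  then show ?thesis using assms by (simp add: koszul_sign_def)
qed

text \<open>This single identity is behind both \<open>d d = 0\<close> and the contraction homotopy: exchanging the order in
  which two indices are inserted changes the sign.\<close>

lemma koszul_sign_swap:
  assumes "finite V" "i \<notin> V" "k \<notin> V" "i \<noteq> k"
  shows "koszul_sign k (insert i V) * koszul_sign i (insert k V) =
    - (koszul_sign k V * koszul_sign i V)"
  using assms by (cases i k rule: linorder_cases) (auto simp: koszul_sign_insert)

context comm_module
begin

text \<open>With \<open>u = 1\<close> this is the cochain differential of the full simplex on \<open>A\<close>; in general it is the
  differential of the Koszul complex of the family \<open>u\<close>.\<close>

definition koszul_diff ::
    "nat set \<Rightarrow> (nat \<Rightarrow> 'a) \<Rightarrow> (nat set \<Rightarrow> 'b) \<Rightarrow> nat set \<Rightarrow> 'b"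
  where "koszul_diff A u c V =
    (if V \<subseteq> A then (\<Sum>k\<in>V. (koszul_sign k V * u k) *s c (V - {k})) else 0)"

definition contraction :: "nat \<Rightarrow> (nat set \<Rightarrow> 'b) \<Rightarrow> nat set \<Rightarrow> 'b"
  where "contraction k c V = (if k \<in> V then 0 else koszul_sign k V *s c (insert k V))"

text \<open>Cochains of degree \<open>p\<close> with values in \<open>M\<close>.  The degree is an integer so that in degree \<open>-1\<close> only the
  zero cochain remains and degree \<open>0\<close> needs no separate treatment.\<close>

definition cochains :: "nat set \<Rightarrow> int \<Rightarrow> 'b set \<Rightarrow> (nat set \<Rightarrow> 'b) set"
  where "cochains A p M =
    {c. (\<forall>V. c V \<in> M) \<and> (\<forall>V. c V \<noteq> 0 \<longrightarrow> V \<subseteq> A \<and> int (card V) = p)}"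

text \<open>The Koszul cohomology of \<open>M / N\<close> vanishes in degrees below \<open>r\<close>.\<close>

definition koszul_vanishes ::
    "nat set \<Rightarrow> (nat \<Rightarrow> 'a) \<Rightarrow> nat \<Rightarrow> 'b set \<Rightarrow> 'b set \<Rightarrow> bool"
  where "koszul_vanishes A u r M N \<longleftrightarrow>
    (\<forall>p < int r. \<forall>c\<in>cochains A p M. (\<forall>V. koszul_diff A u c V \<in> N) \<longrightarrow>
       (\<exists>b\<in>cochains A (p - 1) M. \<forall>V. c V - koszul_diff A u b V \<in> N))"

lemma koszul_diff_diff:
  "koszul_diff A u (\<lambda>V. b V - c V) V = koszul_diff A u b V - koszul_diff A u c V"
  by (simp add: koszul_diff_def scale_right_diff_distrib sum_subtractf)

lemma koszul_diff_add:
  "koszul_diff A u (\<lambda>V. b V + c V) V = koszul_diff A u b V + koszul_diff A u c V"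
  by (simp add: koszul_diff_def scale_right_distrib sum.distrib)

lemma koszul_diff_scale:
  "koszul_diff A u (\<lambda>V. f *s c V) V = f *s koszul_diff A u c V"
  by (simp add: koszul_diff_def scale_sum_right mult_ac)

lemma koszul_diff_sum:
  "koszul_diff A u (\<lambda>V. \<Sum>a\<in>D. c a V) V = (\<Sum>a\<in>D. koszul_diff A u (c a) V)"
  by (simp add: koszul_diff_def scale_sum_right sum.swap[of _ D])

lemma koszul_diff_in_subspace:
  assumes "subspace N" "\<And>V. c V \<in> N"
  shows "koszul_diff A u c V \<in> N"
  unfolding koszul_diff_def using assms by (auto intro: subspace_sum subspace_scale subspace_0)

lemma hom_koszul_diff:
  assumes "module_hom scale scale \<phi>"
  shows "\<phi> (koszul_diff A u c V) = koszul_diff A u (\<lambda>V. \<phi> (c V)) V"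
proof -
  interpret phi: module_hom scale scale \<phi> by fact
  show ?thesis by (simp add: koszul_diff_def phi.zero phi.sum phi.scale)
qed

lemma koszul_diff_cochains:
  assumes "finite A" "subspace M" "c \<in> cochains A p M"
  shows "koszul_diff A u c \<in> cochains A (p + 1) M"
  unfolding cochains_def
proof (safe)
  fix V
  show "koszul_diff A u c V \<in> M"
    using assms by (intro koszul_diff_in_subspace) (auto simp: cochains_def)
  assume nz: "koszul_diff A u c V \<noteq> 0"
  then have V: "V \<subseteq> A" by (auto simp: koszul_diff_def split: if_splits)
  {
    fix x assume "x \<in> V" then show "x \<in> A" using V by blast
  }
  obtain k where k: "k \<in> V" "c (V - {k}) \<noteq> 0"
  proof -
    have "(\<Sum>k\<in>V. (koszul_sign k V * u k) *s c (V - {k})) \<noteq> 0"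
      using nz V by (simp add: koszul_diff_def)
    then obtain k where "k \<in> V" "(koszul_sign k V * u k) *s c (V - {k}) \<noteq> 0"
      by (rule sum.not_neutral_contains_not_neutral)
    then show ?thesis using that[of k] by force
  qed
  then have "int (card (V - {k})) = p" using assms by (auto simp: cochains_def)
  moreover have "card V = Suc (card (V - {k}))"
    using k V assms by (metis card.remove finite_subset)
  ultimately show "int (card V) = p + 1" by simp
qed

lemma contraction_cochains:
  assumes "finite A" "k \<in> A" "subspace M" "c \<in> cochains A p M"
  shows "contraction k c \<in> cochains A (p - 1) M"
  unfolding cochains_def
proof (safe)
  fix V
  show "contraction k c V \<in> M"
    using assms by (auto simp: contraction_def cochains_def intro: subspace_0 subspace_scale)
  assume "contraction k c V \<noteq> 0"
  then have k: "k \<notin> V" "c (insert k V) \<noteq> 0" by (auto simp: contraction_def split: if_splits)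
  then have *: "insert k V \<subseteq> A" "int (card (insert k V)) = p"
    using assms(4) unfolding cochains_def by blast+
  then have "finite V" using assms(1) finite_subset by auto
  then show "int (card V) = p - 1" using * k by simp
  fix x assume "x \<in> V" then show "x \<in> A" using * by blast
qed

text \<open>Contraction with \<open>k\<close> is a homotopy between multiplication by \<open>u k\<close> and zero.  If \<open>k \<in> V\<close>, only the
  term omitting \<open>k\<close> survives in the first summand.  Otherwise the term inserting \<open>k\<close> gives \<open>u k\<close>
  in the second summand and all other terms cancel in pairs by the sign rule.\<close>

lemma koszul_homotopy:
  fixes k :: "nat"
  assumes "finite A" "k \<in> A" "V \<subseteq> A"
  shows "koszul_diff A u (contraction k c) V + contraction k (koszul_diff A u c) V = u k *s c V"
proof -
  have fin: "finite V" using assms finite_subset by blast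
  show ?thesis
  proof (cases "k \<in> V")
    case True
    have "koszul_diff A u (contraction k c) V =
        (\<Sum>i\<in>V. (koszul_sign i V * u i) *s contraction k c (V - {i}))"
      using assms by (simp add: koszul_diff_def)
    also have "\<dots> = (\<Sum>i\<in>{k}. (koszul_sign i V * u i) *s contraction k c (V - {i}))"
      using True fin by (intro sum.mono_neutral_right) (auto simp: contraction_def)
    also have "\<dots> = (koszul_sign k V * koszul_sign k V * u k) *s c V"
      using True by (simp add: contraction_def insert_absorb koszul_sign_self mult_ac)
    finally show ?thesis using True by (simp add: contraction_def)
  next
    case False
    have "contraction k (koszul_diff A u c) V =
       koszul_sign k V *s (\<Sum>i\<in>insert k V. (koszul_sign i (insert k V) * u i) *s c (insert k V - {i}))"
      using assms False by (simp add: koszul_diff_def contraction_def)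
    also have "\<dots> = koszul_sign k V *s ((koszul_sign k V * u k) *s c V) +
       koszul_sign k V *s (\<Sum>i\<in>V. (koszul_sign i (insert k V) * u i) *s c (insert k V - {i}))"
      using False fin by (simp add: scale_right_distrib koszul_sign_insert_self)
    also have "koszul_sign k V *s ((koszul_sign k V * u k) *s c V) = u k *s c V"
      by (simp flip: mult.assoc)
    also have "koszul_sign k V *s (\<Sum>i\<in>V. (koszul_sign i (insert k V) * u i) *s c (insert k V - {i})) =
       (\<Sum>i\<in>V. (koszul_sign k V * koszul_sign i (insert k V) * u i) *s c (insert k V - {i}))"
      by (simp add: scale_sum_right mult.assoc)
    also have "(\<Sum>i\<in>V. (koszul_sign k V * koszul_sign i (insert k V) * u i) *s c (insert k V - {i}))
      = - koszul_diff A u (contraction k c) V"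
    proof -
      have "(koszul_sign k V * koszul_sign i (insert k V) * u i) *s c (insert k V - {i}) =
         - ((koszul_sign i V * u i) *s contraction k c (V - {i}))" if i: "i \<in> V" for i
      proof -
        define W where "W = V - {i}"
        have W: "V = insert i W" "i \<notin> W" "finite W" "k \<notin> W" "i \<noteq> k"
          using i False fin by (auto simp: W_def)
        have "insert k V - {i} = insert k W" using W by auto
        moreover have "koszul_sign k V * koszul_sign i (insert k V) =
            (- (koszul_sign i V * koszul_sign k W) :: 'a)"
        proof -
          have "insert k V = insert i (insert k W)" using W by blast
          then have "koszul_sign i (insert k V) = (koszul_sign i (insert k W) :: 'a)"
            by (simp only: koszul_sign_insert_self)
          moreover have "koszul_sign i V = (koszul_sign i W :: 'a)"
            by (simp only: W(1) koszul_sign_insert_self)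
          ultimately show ?thesis
            using koszul_sign_swap[of W i k, where 'a = 'a] W by (simp add: mult.commute)
        qed
        moreover have "contraction k c (V - {i}) = koszul_sign k W *s c (insert k W)"
          using W by (simp add: contraction_def flip: W_def)
        ultimately have "(koszul_sign k V * koszul_sign i (insert k V) * u i) *s c (insert k V - {i}) =
            (- (koszul_sign i V * koszul_sign k W) * u i) *s c (insert k W)"
          "contraction k c (V - {i}) = koszul_sign k W *s c (insert k W)"
          by (simp_all only:)
        then show ?thesis by (simp only: scale_scale) (simp add: mult_ac)
      qed
      then show ?thesis using assms by (simp add: koszul_diff_def sum_negf)
    qed
    finally show ?thesis by simp
  qed
qed

text \<open>The summands for removing \<open>k\<close> and then \<open>i\<close>, and \<open>i\<close> and then \<open>k\<close>, have opposite signs.  The sum is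
  split into the pairs with \<open>i < k\<close> and those with \<open>k < i\<close>, since \<open>T = - T\<close> would not give \<open>T = 0\<close> in
  characteristic two.\<close>

lemma koszul_diff_koszul_diff:
  assumes "finite A"
  shows "koszul_diff A u (koszul_diff A u c) V = 0"
proof (cases "V \<subseteq> A")
  case True
  then have fin: "finite V" using assms finite_subset by blast
  have swap: "koszul_sign k V * koszul_sign i (V - {k}) =
      (- (koszul_sign i V * koszul_sign k (V - {i})) :: 'a)" if ik: "i \<in> V" "k \<in> V" "i \<noteq> k" for i k
  proof -
    define W where "W = V - {i} - {k}"
    have W: "V = insert i (insert k W)" "V - {i} = insert k W" "V - {k} = insert i W" "i \<notin> W" "k \<notin> W" "finite W"
      using ik fin by (auto simp: W_def)
    show ?thesis
      using ik W by (cases i k rule: linorder_cases) (auto simp: koszul_sign_insert)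
  qed
  define T where "T k i = (koszul_sign k V * koszul_sign i (V - {k}) * u k * u i) *s c (V - {k} - {i})" for k i
  have T_swap: "T i k = - T k i" if "i \<in> V" "k \<in> V" "i \<noteq> k" for i k
  proof -
    have "V - {k} - {i} = V - {i} - {k}" by blast
    moreover have "koszul_sign i V * koszul_sign k (V - {i}) * u i * u k =
        - (koszul_sign k V * koszul_sign i (V - {k}) * u k * u i)"
      using swap[OF that] by (simp add: mult_ac)
    ultimately show ?thesis by (simp add: T_def)
  qed
  have "koszul_diff A u (koszul_diff A u c) V = (\<Sum>k\<in>V. \<Sum>i\<in>V - {k}. T k i)"
  proof -
    have "koszul_diff A u c (V - {k}) =
        (\<Sum>i\<in>V - {k}. (koszul_sign i (V - {k}) * u i) *s c (V - {k} - {i}))" for k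
      using True by (auto simp: koszul_diff_def)
    then show ?thesis
      using True by (simp add: koszul_diff_def[of A u "koszul_diff A u c"] T_def scale_sum_right mult.assoc
          mult.left_commute[of "u _"])
  qed
  also have "\<dots> = (\<Sum>k\<in>V. (\<Sum>i\<in>{i\<in>V. i < k}. T k i) + (\<Sum>i\<in>{i\<in>V. k < i}. T k i))"
    using fin by (intro sum.cong refl, subst sum.union_disjoint[symmetric]) (auto intro!: sum.cong)
  also have "\<dots> = (\<Sum>k\<in>V. \<Sum>i\<in>{i\<in>V. i < k}. T k i) + (\<Sum>k\<in>V. \<Sum>i\<in>{i\<in>V. k < i}. T k i)"
    by (rule sum.distrib)
  also have "(\<Sum>k\<in>V. \<Sum>i\<in>{i\<in>V. k < i}. T k i) = (\<Sum>i\<in>V. \<Sum>k\<in>{k\<in>V. k < i}. T k i)"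
    using sum.swap_restrict[OF fin fin, of T "\<lambda>k i. k < i"] .
  also have "\<dots> = (\<Sum>i\<in>V. \<Sum>k\<in>{k\<in>V. k < i}. - T i k)"
    by (intro sum.cong refl, rule T_swap) auto
  finally show ?thesis by (simp add: sum_negf)
qed (simp add: koszul_diff_def)

lemma koszul_vanishesE:
  assumes "koszul_vanishes A u r M N" "p < int r" "c \<in> cochains A p M"
    and "\<And>V. koszul_diff A u c V \<in> N"
  obtains b where "b \<in> cochains A (p - 1) M" "\<And>V. c V - koszul_diff A u b V \<in> N"
proof -
  have "\<exists>b\<in>cochains A (p - 1) M. \<forall>V. c V - koszul_diff A u b V \<in> N"
    using assms(1)[unfolded koszul_vanishes_def, rule_format, OF assms(2,3)] assms(4) by simp
  then show ?thesis using that by auto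
qed

lemma cochainsI:
  assumes "\<And>V. c V \<in> M" "\<And>V. c V \<noteq> 0 \<Longrightarrow> V \<subseteq> A \<and> int (card V) = p"
  shows "c \<in> cochains A p M"
  using assms by (simp add: cochains_def)

lemma cochains_mem: "c \<in> cochains A p M \<Longrightarrow> c V \<in> M"
  by (simp add: cochains_def)

lemma cochains_support: "c \<in> cochains A p M \<Longrightarrow> c V \<noteq> 0 \<Longrightarrow> V \<subseteq> A \<and> int (card V) = p"
  by (simp add: cochains_def)

lemma cochains_negative: "c \<in> cochains A p M \<Longrightarrow> p < 0 \<Longrightarrow> c V = 0"
  using cochains_support[of c A p M V] by linarith

text \<open>Cocycles with values in \<open>M' / N'\<close> are lifted pointwise to \<open>M\<close>; the lift of zero is chosen
  to be zero in order to keep the support.\<close>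

lemma koszul_vanishes_iso:
  assumes iso: "subquotient_iso \<phi> M N M' N'"
    and sub: "finite A" "subspace M" "subspace N" "subspace N'"
    and van: "koszul_vanishes A u r M N"
  shows "koszul_vanishes A u r M' N'"
  unfolding koszul_vanishes_def
proof (intro allI impI ballI)
  interpret phi: module_hom scale scale \<phi>
    using iso unfolding subquotient_iso_def by blast
  have in_M': "\<phi> x \<in> M'" and mem_N': "\<phi> x \<in> N' \<longleftrightarrow> x \<in> N" if "x \<in> M" for x
    using iso that unfolding subquotient_iso_def by auto
  have lift: "\<exists>x\<in>M. y - \<phi> x \<in> N'" if "y \<in> M'" for y
    using iso that unfolding subquotient_iso_def by auto
  fix p c assume p: "p < int r" and c: "c \<in> cochains A p M'"
    and dc: "\<forall>V. koszul_diff A u c V \<in> N'"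
  have "\<exists>x. x \<in> M \<and> c V - \<phi> x \<in> N' \<and> (c V = 0 \<longrightarrow> x = 0)" for V
    using lift[of "c V"] c sub by (cases "c V = 0") (auto simp: cochains_def phi.zero subspace_0)
  then obtain c' where c': "\<And>V. c' V \<in> M" "\<And>V. c V - \<phi> (c' V) \<in> N'" "\<And>V. c V = 0 \<Longrightarrow> c' V = 0"
    by metis
  have c'_co: "c' \<in> cochains A p M"
    using c c' unfolding cochains_def by blast
  have "koszul_diff A u c' V \<in> N" for V
  proof -
    have "\<phi> (koszul_diff A u c' V) = koszul_diff A u c V - koszul_diff A u (\<lambda>V. c V - \<phi> (c' V)) V"
      by (simp add: hom_koszul_diff[OF phi.module_hom_axioms] koszul_diff_diff)
    also have "\<dots> \<in> N'"
      using dc c'(2) subspace_diff[OF sub(4)] koszul_diff_in_subspace[OF sub(4), of "\<lambda>V. c V - \<phi> (c' V)"]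
      by blast
    finally show ?thesis
      using mem_N' koszul_diff_in_subspace[of M c' A u V] c'(1) sub by blast
  qed
  then obtain b where b: "b \<in> cochains A (p - 1) M"
    "\<And>V. c' V - koszul_diff A u b V \<in> N"
    using koszul_vanishesE[OF van p c'_co] by blast
  have "(\<lambda>V. \<phi> (b V)) \<in> cochains A (p - 1) M'"
    using in_M'[OF cochains_mem[OF b(1)]] cochains_support[OF b(1)]
    by (intro cochainsI) (metis phi.zero)+
  moreover have "c V - koszul_diff A u (\<lambda>V. \<phi> (b V)) V \<in> N'" for V
  proof -
    have "c' V - koszul_diff A u b V \<in> M"
      using b c' sub koszul_diff_in_subspace[of M b A u V]
      by (auto simp: cochains_def intro: subspace_diff)
    then have "\<phi> (c' V - koszul_diff A u b V) \<in> N'" using mem_N' b(2) by blast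
    then have "(c V - \<phi> (c' V)) + \<phi> (c' V - koszul_diff A u b V) \<in> N'"
      using c'(2) by (intro subspace_add sub) auto
    then show ?thesis
      by (simp add: phi.diff hom_koszul_diff[OF phi.module_hom_axioms])
  qed
  ultimately show "\<exists>b\<in>cochains A (p - 1) M'. \<forall>V. c V - koszul_diff A u b V \<in> N'" by blast
qed

text \<open>The part \<open>H\<^sup>p(P / N) \<rightarrow> H\<^sup>p(P / Z) \<rightarrow> H\<^sup>p\<^sup>+\<^sup>1(Z / N)\<close> of the long exact sequence.\<close>

lemma koszul_vanishes_quotient:
  assumes "koszul_vanishes A u (Suc r) Z N" "koszul_vanishes A u r P N"
    and sub: "finite A" "subspace P" "subspace Z" "subspace N" "N \<subseteq> Z" "Z \<subseteq> P"
  shows "koszul_vanishes A u r P Z"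
  unfolding koszul_vanishes_def
proof (intro allI impI ballI)
  fix p c assume p: "p < int r" and c: "c \<in> cochains A p P"
    and dc: "\<forall>V. koszul_diff A u c V \<in> Z"
  have "koszul_diff A u c \<in> cochains A (p + 1) Z"
    using koszul_diff_cochains[OF sub(1,2) c] dc unfolding cochains_def by blast
  moreover have "koszul_diff A u (koszul_diff A u c) V \<in> N" for V
    using sub by (simp add: koszul_diff_koszul_diff subspace_0)
  moreover have "p + 1 < int (Suc r)" using p by simp
  ultimately obtain b where "b \<in> cochains A (p + 1 - 1) Z"
    and b2: "\<And>V. koszul_diff A u c V - koszul_diff A u b V \<in> N"
    using koszul_vanishesE[OF assms(1), of "p + 1" "koszul_diff A u c"] by blast
  then have b: "b \<in> cochains A p Z" by simp
  have "(\<lambda>V. c V - b V) \<in> cochains A p P"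
  proof (rule cochainsI)
    fix V
    show "c V - b V \<in> P"
      using cochains_mem[OF b, of V] cochains_mem[OF c, of V] sub by (auto intro: subspace_diff)
    assume "c V - b V \<noteq> 0"
    then have "c V \<noteq> 0 \<or> b V \<noteq> 0" by auto
    then show "V \<subseteq> A \<and> int (card V) = p"
      using cochains_support[OF b, of V] cochains_support[OF c, of V] by blast
  qed
  moreover have "koszul_diff A u (\<lambda>V. c V - b V) V \<in> N" for V
    using b2 by (simp only: koszul_diff_diff)
  ultimately obtain e where e: "e \<in> cochains A (p - 1) P"
    "\<And>V. (c V - b V) - koszul_diff A u e V \<in> N"
    using koszul_vanishesE[OF assms(2) p, of "\<lambda>V. c V - b V"] by blast
  have "c V - koszul_diff A u e V \<in> Z" for V
  proof -
    have "b V + ((c V - b V) - koszul_diff A u e V) \<in> Z"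
      using cochains_mem[OF b] e(2)[of V] sub by (intro subspace_add) auto
    then show ?thesis by simp
  qed
  with e(1) show "\<exists>b\<in>cochains A (p - 1) P. \<forall>V. c V - koszul_diff A u b V \<in> Z" by blast
qed

text \<open>The zeroth Koszul cohomology is the set of elements killed by all \<open>u k\<close>.\<close>

lemma koszul_vanishes_socle:
  assumes van: "koszul_vanishes A u (Suc r) M N" and sub: "subspace M" "finite A"
    and z: "z \<in> M" "\<And>k. k \<in> A \<Longrightarrow> u k *s z \<in> N" "0 \<in> N"
  shows "z \<in> N"
proof -
  define c where "c V = (if V = {} then z else 0)" for V :: "nat set"
  have "c \<in> cochains A 0 M"
    using z(1) subspace_0[OF sub(1)] by (intro cochainsI) (auto simp: c_def split: if_splits)
  moreover have "koszul_diff A u c V \<in> N" for V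
  proof (cases "\<exists>k. V = {k} \<and> k \<in> A")
    case True
    then obtain k where k: "V = {k}" "k \<in> A" by blast
    have "{j \<in> {k}. j < k} = {}" by auto
    then have "koszul_sign k {k} = (1::'a)" by (simp only: koszul_sign_def card.empty power_0)
    then show ?thesis using k z by (simp add: koszul_diff_def c_def)
  next
    case False
    have "koszul_diff A u c V = 0"
    proof (cases "V \<subseteq> A")
      case True
      have "c (V - {k}) = 0" if "k \<in> V" for k
      proof -
        have "V - {k} \<noteq> {}" using that True False by blast
        then show ?thesis by (simp add: c_def)
      qed
      then show ?thesis by (simp add: koszul_diff_def)
    qed (simp add: koszul_diff_def)
    then show ?thesis using z by simp
  qed
  ultimately obtain b where b: "b \<in> cochains A (0 - 1) M" "\<And>V. c V - koszul_diff A u b V \<in> N"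
    using koszul_vanishesE[OF van, of 0 c] by auto
  have "koszul_diff A u b {} = 0" by (simp add: koszul_diff_def)
  then show ?thesis using b(2)[of "{}"] by (simp add: c_def)
qed

text \<open>The Koszul cohomology is annihilated by the ideal that the family generates: combine the contractions
  with the coefficients of \<open>f\<close>.\<close>

lemma koszul_cocycle_multiple:
  assumes f: "f = (\<Sum>k\<in>A. a k * u k)" and sub: "finite A" "subspace M" "subspace N"
    and c: "c \<in> cochains A p M" "\<And>V. koszul_diff A u c V \<in> N"
  shows "\<exists>b\<in>cochains A (p - 1) M. \<forall>V. f *s c V - koszul_diff A u b V \<in> N"
proof -
  define b where "b V = (\<Sum>k\<in>A. a k *s contraction k c V)" for V
  have contr: "contraction k c \<in> cochains A (p - 1) M" if "k \<in> A" for k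
    using contraction_cochains[OF sub(1) that sub(2) c(1)] .
  have "b \<in> cochains A (p - 1) M"
    unfolding cochains_def
  proof safe
    fix V
    show "b V \<in> M"
      unfolding b_def using contr sub by (intro subspace_sum subspace_scale) (auto simp: cochains_def)
    assume "b V \<noteq> 0"
    then obtain k where "k \<in> A" "a k *s contraction k c V \<noteq> 0"
      unfolding b_def by (rule sum.not_neutral_contains_not_neutral)
    then have "k \<in> A" "contraction k c V \<noteq> 0" by auto
    then have *: "V \<subseteq> A" "int (card V) = p - 1" using contr unfolding cochains_def by blast+
    show "int (card V) = p - 1" by fact
    fix x assume "x \<in> V" then show "x \<in> A" using * by blast
  qed
  moreover have "f *s c V - koszul_diff A u b V \<in> N" for V
  proof (cases "V \<subseteq> A")
    case True
    have "koszul_diff A u b V = (\<Sum>k\<in>A. koszul_diff A u (\<lambda>V. a k *s contraction k c V) V)"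
      unfolding b_def by (rule koszul_diff_sum)
    also have "\<dots> = (\<Sum>k\<in>A. a k *s koszul_diff A u (contraction k c) V)"
      by (simp add: koszul_diff_scale)
    also have "\<dots> = (\<Sum>k\<in>A. a k *s (u k *s c V - contraction k (koszul_diff A u c) V))"
      using koszul_homotopy[OF sub(1) _ True] by (intro sum.cong refl arg_cong[where f = "scale _"])
        (simp add: eq_diff_eq)
    also have "\<dots> = f *s c V - (\<Sum>k\<in>A. a k *s contraction k (koszul_diff A u c) V)"
      by (simp add: f scale_right_diff_distrib sum_subtractf scale_sum_left)
    finally have "f *s c V - koszul_diff A u b V = (\<Sum>k\<in>A. a k *s contraction k (koszul_diff A u c) V)"
      by simp
    also have "\<dots> \<in> N"
      using c(2) sub by (intro subspace_sum subspace_scale) (auto simp: contraction_def intro: subspace_0 subspace_scale)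
    finally show ?thesis .
  next
    case False
    then have "c V = 0" using c(1) by (auto simp: cochains_def)
    then show ?thesis using False sub by (simp add: koszul_diff_def subspace_0)
  qed
  ultimately show ?thesis by blast
qed

text \<open>Multiplication by \<open>f\<close> is zero on the cohomology of \<open>M / N\<close> because \<open>f\<close> lies in the ideal of the
  family, and it is injective in degree \<open>p\<close> when the cohomology of the quotient by \<open>f\<close> vanishes in degree
  \<open>p - 1\<close>.  On cochains: if \<open>f c = d b\<close>, then \<open>b\<close> is a cocycle modulo \<open>f\<close>, hence \<open>b = d e + f m\<close>
  and \<open>f (c - d m) = 0\<close>.\<close>

lemma koszul_vanishes_regular:
  assumes f: "f = (\<Sum>k\<in>A. a k * u k)" and sub: "finite A" "subspace M" "subspace N" "N \<subseteq> M"
    and reg: "\<And>x. x \<in> M \<Longrightarrow> f *s x \<in> N \<Longrightarrow> x \<in> N"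
    and van: "koszul_vanishes A u r M (add_multiples N f M)"
  shows "koszul_vanishes A u (Suc r) M N"
  unfolding koszul_vanishes_def
proof (intro allI impI ballI)
  fix p c assume p: "p < int (Suc r)" and c: "c \<in> cochains A p M"
    and dc: "\<forall>V. koszul_diff A u c V \<in> N"
  obtain b where b: "b \<in> cochains A (p - 1) M" "\<And>V. f *s c V - koszul_diff A u b V \<in> N"
    using koszul_cocycle_multiple[OF f sub(1-3) c] dc by blast
  have c_M: "c V \<in> M" for V using c by (simp add: cochains_def)
  have "koszul_diff A u b V \<in> add_multiples N f M" for V
  proof -
    have "- (f *s c V - koszul_diff A u b V) + f *s c V \<in> add_multiples N f M"
      using b(2) c_M sub by (intro add_multiplesI subspace_neg)
    then show ?thesis by simp
  qed
  moreover have "p - 1 < int r" using p by simp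
  ultimately obtain e where e: "e \<in> cochains A (p - 1 - 1) M"
    "\<And>V. b V - koszul_diff A u e V \<in> add_multiples N f M"
    using koszul_vanishesE[OF van _ b(1)] by blast
  have e_M: "koszul_diff A u e V \<in> M" for V
    using e(1) sub by (intro koszul_diff_in_subspace) (auto simp: cochains_def)
  have e_co: "koszul_diff A u e \<in> cochains A (p - 1) M"
    using koszul_diff_cochains[OF sub(1,2) e(1)] by simp
  have "\<exists>m. m \<in> M \<and> b V - koszul_diff A u e V - f *s m \<in> N \<and>
      (b V - koszul_diff A u e V = 0 \<longrightarrow> m = 0)" for V
  proof (cases "b V - koszul_diff A u e V = 0")
    case True
    then show ?thesis using sub by (auto simp: subspace_0 intro!: exI[of _ 0])
  next
    case False
    then show ?thesis using e(2)[of V] by (auto simp: add_multiples_def)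
  qed
  then obtain m where m: "\<And>V. m V \<in> M" "\<And>V. b V - koszul_diff A u e V - f *s m V \<in> N"
    "\<And>V. b V - koszul_diff A u e V = 0 \<Longrightarrow> m V = 0"
    by metis
  have "m \<in> cochains A (p - 1) M"
    unfolding cochains_def
  proof safe
    fix V
    show "m V \<in> M" by (rule m)
    assume "m V \<noteq> 0"
    then have "b V \<noteq> 0 \<or> koszul_diff A u e V \<noteq> 0" using m(3)[of V] by auto
    then have *: "V \<subseteq> A" "int (card V) = p - 1"
      using b(1) e_co unfolding cochains_def by blast+
    show "int (card V) = p - 1" by fact
    fix x assume "x \<in> V" then show "x \<in> A" using * by blast
  qed
  moreover have "c V - koszul_diff A u m V \<in> N" for V
  proof (rule reg)
    show "c V - koszul_diff A u m V \<in> M"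
      using c_M m(1) sub by (intro subspace_diff koszul_diff_in_subspace)
    have "f *s (c V - koszul_diff A u m V) = (f *s c V - koszul_diff A u b V) +
      koszul_diff A u (\<lambda>V. b V - koszul_diff A u e V - f *s m V) V"
      using sub by (simp add: koszul_diff_diff koszul_diff_scale koszul_diff_koszul_diff scale_right_diff_distrib)
    also have "\<dots> \<in> N"
      using b(2) m(2) sub by (intro subspace_add koszul_diff_in_subspace)
    finally show "f *s (c V - koszul_diff A u m V) \<in> N" .
  qed
  ultimately show "\<exists>b\<in>cochains A (p - 1) M. \<forall>V. c V - koszul_diff A u b V \<in> N" by blast
qed

lemma weakly_regular_imp_koszul_vanishes:
  assumes "weakly_regular fs M N" "\<And>f. f \<in> set fs \<Longrightarrow> \<exists>a. f = (\<Sum>k\<in>A. a k * u k)"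
    and "finite A" "subspace M" "subspace N" "N \<subseteq> M"
  shows "koszul_vanishes A u (length fs) M N"
  using assms
proof (induction fs arbitrary: N)
  case Nil
  show ?case
    unfolding koszul_vanishes_def
  proof (intro allI impI ballI)
    fix p c assume p: "p < int (length [])" and c: "c \<in> cochains A p M"
    then have "c V = 0" for V using cochains_negative by simp
    then show "\<exists>b\<in>cochains A (p - 1) M. \<forall>V. c V - koszul_diff A u b V \<in> N"
      using Nil by (intro bexI[of _ "\<lambda>V. 0"]) (auto simp: koszul_diff_def cochains_def subspace_0)
  qed
next
  case (Cons f fs)
  obtain a where a: "f = (\<Sum>k\<in>A. a k * u k)" using Cons.prems(2)[of f] by auto
  have head: "\<And>x. x \<in> M \<Longrightarrow> f *s x \<in> N \<Longrightarrow> x \<in> N"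
    and tail: "weakly_regular fs M (add_multiples N f M)"
    using Cons.prems(1) unfolding weakly_regular.simps by blast+
  note sub = Cons.prems(3-)
  have "koszul_vanishes A u (length fs) M (add_multiples N f M)"
    using Cons.prems(2)
    by (rule Cons.IH[OF tail _ sub(1,2) subspace_add_multiples[OF sub(3,2)] add_multiples_subset[OF sub(2,4)]]) simp
  then have "koszul_vanishes A u (Suc (length fs)) M N"
    using koszul_vanishes_regular[OF a sub] head by blast
  then show ?case by simp
qed

end

section \<open>Ideals of the polynomial ring and monomial supports\<close>

abbreviation lookup :: "('a \<Rightarrow>\<^sub>0 'b::zero) \<Rightarrow> 'a \<Rightarrow> 'b" where "lookup \<equiv> Poly_Mapping.lookup"
abbreviation keys :: "('a \<Rightarrow>\<^sub>0 'b::zero) \<Rightarrow> 'a set" where "keys \<equiv> Poly_Mapping.keys"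
abbreviation single :: "'a \<Rightarrow> 'b \<Rightarrow> 'a \<Rightarrow>\<^sub>0 'b::zero" where "single \<equiv> Poly_Mapping.single"

global_interpretation ring_mod: comm_module "(*) :: 'a::comm_ring_1 \<Rightarrow> 'a \<Rightarrow> 'a"
  by unfold_locales (auto simp: algebra_simps)

abbreviation type_ring :: "'a::comm_ring_1 ring" (\<open>\<R>\<close>)
  where "\<R> \<equiv> ring_of_type_algebra"

lemma type_ring_simps [simp]:
  "carrier \<R> = UNIV"
  "monoid.mult \<R> = (*)"
  "one \<R> = 1"
  "zero \<R> = 0"
  "add \<R> = (+)"
  by (auto simp: ring_of_type_algebra_def fun_eq_iff)

lemma cring_type_ring: "cring (\<R> :: 'a::comm_ring_1 ring)"
  by (rule cring_from_type_algebra)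

lemma ring_type_ring: "ring (\<R> :: 'a::comm_ring_1 ring)"
  by (rule ring_from_type_algebra)

lemma type_ring_minus [simp]: "\<ominus>\<^bsub>\<R>\<^esub> (x :: 'a::comm_ring_1) = - x"
proof -
  interpret cring "\<R> :: 'a ring" by (rule cring_type_ring)
  show ?thesis using minus_equality[of "- x" x] by simp
qed

lemma type_ring_pow [simp]: "(x :: 'a::comm_ring_1) [^]\<^bsub>\<R>\<^esub> (k::nat) = x ^ k"
proof -
  interpret cring "\<R> :: 'a ring" by (rule cring_type_ring)
  show ?thesis by (induction k) (auto simp: mult.commute)
qed

text \<open>The ideals of the ring are the submodules of the ring as a module over itself.\<close>

lemma ideal_iff_subspace:
  "ideal J (\<R> :: 'a::comm_ring_1 ring) \<longleftrightarrow> ring_mod.subspace J"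
proof
  assume "ideal J (\<R> :: 'a::comm_ring_1 ring)"
  then interpret ideal J "\<R> :: 'a ring" .
  show "ring_mod.subspace J"
    using additive_subgroup.zero_closed[OF additive_subgroup_axioms]
      additive_subgroup.a_closed[OF additive_subgroup_axioms] I_l_closed
    by (intro ring_mod.subspaceI) simp_all
next
  assume sub: "ring_mod.subspace J"
  interpret cring "\<R> :: 'a ring" by (rule cring_type_ring)
  show "ideal J (\<R> :: 'a::comm_ring_1 ring)"
  proof (rule idealI)
    show "ring (\<R> :: 'a ring)" by (rule ring_type_ring)
    show "subgroup J (add_monoid (\<R> :: 'a ring))"
      using sub ring_mod.subspace_neg[OF sub]
      by (intro add.subgroupI)
        (auto simp: ring_mod.subspace_add a_inv_def[symmetric] dest: ring_mod.subspace_0)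
  qed (use sub in \<open>auto dest: ring_mod.subspace_scale simp: mult.commute\<close>)
qed

lemma genideal_eq_span:
  "Idl\<^bsub>\<R>\<^esub> B = ring_mod.span (B :: 'a::comm_ring_1 set)"
proof -
  interpret cring "\<R> :: 'a ring" by (rule cring_type_ring)
  have "ideal (ring_mod.span B) (\<R> :: 'a ring)"
    by (simp add: ideal_iff_subspace)
  moreover have "ring_mod.subspace (Idl\<^bsub>\<R>\<^esub> B)"
    using genideal_ideal[of B] by (simp add: ideal_iff_subspace)
  moreover have "B \<subseteq> Idl\<^bsub>\<R>\<^esub> B" using genideal_self[of B] by simp
  ultimately show ?thesis
    using genideal_minimal[of "ring_mod.span B" B] ring_mod.span_minimal[of B]
      ring_mod.span_superset[of B] by blast
qed

lemma radical_eq: "radical \<R> J = {a :: 'a::comm_ring_1. \<exists>k. a ^ k \<in> J}"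
  by (simp add: radical_def)

lemma primeideal_iff:
  "primeideal P (\<R> :: 'a::comm_ring_1 ring) \<longleftrightarrow>
    ring_mod.subspace P \<and> 1 \<notin> P \<and> (\<forall>a b. a * b \<in> P \<longrightarrow> a \<in> P \<or> b \<in> P)"
proof
  assume "primeideal P (\<R> :: 'a ring)"
  then interpret primeideal P "\<R> :: 'a ring" .
  have "ring_mod.subspace P" using is_ideal by (simp add: ideal_iff_subspace)
  moreover have "1 \<notin> P" using one_imp_carrier I_notcarr by auto
  ultimately show "ring_mod.subspace P \<and> 1 \<notin> P \<and> (\<forall>a b. a * b \<in> P \<longrightarrow> a \<in> P \<or> b \<in> P)"
    using I_prime by auto
next
  assume *: "ring_mod.subspace P \<and> 1 \<notin> P \<and> (\<forall>a b. a * b \<in> P \<longrightarrow> a \<in> P \<or> b \<in> P)"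
  then show "primeideal P (\<R> :: 'a ring)"
    by (intro primeidealI cring_type_ring) (auto simp: ideal_iff_subspace)
qed

lemma subspace_radical:
  assumes J: "ring_mod.subspace (J :: 'a::comm_ring_1 set)"
  shows "ring_mod.subspace {a. \<exists>k. a ^ k \<in> J}"
proof (rule ring_mod.subspaceI)
  show "0 \<in> {a. \<exists>k. a ^ k \<in> J}" using ring_mod.subspace_0[OF J] by (auto intro: exI[of _ 1])
next
  fix c x assume "x \<in> {a. \<exists>k. a ^ k \<in> J}"
  then show "c * x \<in> {a. \<exists>k. a ^ k \<in> J}"
    using ring_mod.subspace_scale[OF J] by (auto simp: power_mult_distrib)
next
  fix x y assume "x \<in> {a. \<exists>k. a ^ k \<in> J}" "y \<in> {a. \<exists>k. a ^ k \<in> J}"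
  then obtain k l where k: "x ^ k \<in> J" and l: "y ^ l \<in> J" by blast
  have pow: "z ^ m \<in> J" if "z ^ k \<in> J" "k \<le> m" for z k m
  proof -
    have "z ^ m = z ^ (m - k) * z ^ k" by (simp only: power_add[symmetric] le_add_diff_inverse2[OF that(2)])
    then show ?thesis using ring_mod.subspace_scale[OF J that(1)] by (simp only:)
  qed
  have "(x + y) ^ (k + l) = (\<Sum>i\<le>k + l. of_nat ((k + l) choose i) * x ^ i * y ^ (k + l - i))"
    by (rule binomial_ring)
  also have "\<dots> \<in> J"
  proof (rule ring_mod.subspace_sum[OF J])
    fix i
    show "of_nat ((k + l) choose i) * x ^ i * y ^ (k + l - i) \<in> J"
    proof (cases "k \<le> i")
      case True
      have "(of_nat ((k + l) choose i) * y ^ (k + l - i)) * x ^ i \<in> J"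
        by (rule ring_mod.subspace_scale[OF J pow[OF k True]])
      then show ?thesis by (simp only: mult.assoc mult.commute[of "x ^ i"])
    next
      case False
      then have "l \<le> k + l - i" by simp
      from ring_mod.subspace_scale[OF J pow[OF l this]] show ?thesis .
    qed
  qed
  finally show "x + y \<in> {a. \<exists>k. a ^ k \<in> J}" by blast
qed

subsection \<open>Polynomials with prescribed support\<close>

lemma lookup_mult_finite_sum:
  "lookup (f * g) k = (\<Sum>a\<in>keys f. \<Sum>b\<in>keys g. if k = a + b then lookup f a * lookup g b else 0)"
  for f g :: "'e::monoid_add \<Rightarrow>\<^sub>0 'k::semiring_0"
proof -
  have "lookup (f * g) k = (\<Sum>(a, b). lookup f a * lookup g b when k = a + b)"
    by (simp add: times_poly_mapping.rep_eq prod_fun_unfold_prod)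
  also have "\<dots> = (\<Sum>(a, b)\<in>keys f \<times> keys g. lookup f a * lookup g b when k = a + b)"
  proof (rule Sum_any.expand_superset)
    show "{ab. (case ab of (a, b) \<Rightarrow> lookup f a * lookup g b when k = a + b) \<noteq> 0} \<subseteq> keys f \<times> keys g"
    proof (intro subrelI)
      fix a b assume "(a, b) \<in> {ab. (case ab of (a, b) \<Rightarrow> lookup f a * lookup g b when k = a + b) \<noteq> 0}"
      then have "lookup f a * lookup g b \<noteq> 0" by (auto simp: when_def split: if_splits)
      then show "(a, b) \<in> keys f \<times> keys g" using mult_not_zero by (auto simp: in_keys_iff)
    qed
  qed simp
  also have "\<dots> = (\<Sum>a\<in>keys f. \<Sum>b\<in>keys g. if k = a + b then lookup f a * lookup g b else 0)"
    by (simp add: sum.cartesian_product when_def)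
  finally show ?thesis .
qed

lemma lookup_single_mult:
  "lookup (single d c * p) (d + e) = c * lookup p e"
  for p :: "('e::cancel_comm_monoid_add) \<Rightarrow>\<^sub>0 ('k::comm_semiring_1)"
proof (cases "c = 0")
  case False
  have "lookup (single d c * p) (d + e) = (\<Sum>b\<in>keys p. if e = b then c * lookup p b else 0)"
    using False by (simp add: lookup_mult_finite_sum)
  also have "\<dots> = c * lookup p e" by (simp add: in_keys_iff)
  finally show ?thesis .
qed simp

lemma lookup_minus_one_power_mult:
  "lookup ((- 1) ^ m * p) e = (- 1) ^ m * lookup p e"
  for p :: "'e::comm_monoid_add \<Rightarrow>\<^sub>0 'k::comm_ring_1"
  by (cases "even m") simp_all

lemma poly_eq_sum_terms: "p = (\<Sum>e\<in>keys p. single e (lookup p e))"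
proof (rule poly_mapping_eqI)
  fix k
  have "lookup (\<Sum>e\<in>keys p. single e (lookup p e)) k = (\<Sum>e\<in>keys p. if e = k then lookup p e else 0)"
    by (simp add: lookup_sum lookup_single when_def)
  then show "lookup p k = lookup (\<Sum>e\<in>keys p. single e (lookup p e)) k"
    by (simp add: in_keys_iff)
qed

lemma term_eq_mult_monomial: "single e c = single 0 c * monomial e"
  by (simp add: monomial_def mult_single)

text \<open>Monomial ideals are exactly the sets of this form with \<open>E\<close> closed under adding exponents; membership
  can then be read off the exponents.\<close>

definition supported :: "('n::finite \<Rightarrow>\<^sub>0 nat) set \<Rightarrow> ('n, 'k::field) mpoly set"
  where "supported E = {p. keys p \<subseteq> E}"

lemma monomial_in_supported [simp]: "monomial e \<in> supported E \<longleftrightarrow> e \<in> E"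
  by (simp add: supported_def monomial_def)

lemma subspace_supported:
  assumes "\<And>d e. e \<in> E \<Longrightarrow> d + e \<in> E"
  shows "ring_mod.subspace (supported E)"
proof (rule ring_mod.subspaceI)
  show "c * x \<in> supported E" if "x \<in> supported E" for c x
    using that assms keys_mult[of c x] unfolding supported_def by blast
  show "x + y \<in> supported E" if "x \<in> supported E" "y \<in> supported E" for x y
    using that keys_add[of x y] unfolding supported_def by blast
qed (simp add: supported_def)

text \<open>A polynomial is the sum of its terms, each a multiple of a monomial.\<close>

lemma supported_subset_subspace:
  assumes "ring_mod.subspace J" "\<And>e. e \<in> E \<Longrightarrow> monomial e \<in> J"
  shows "supported E \<subseteq> J"
proof
  fix p :: "('a, 'b) mpoly" assume p: "p \<in> supported E"
  have "(\<Sum>e\<in>keys p. single e (lookup p e)) \<in> J"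
    using p assms
    by (intro ring_mod.subspace_sum[OF assms(1)], subst term_eq_mult_monomial)
      (auto simp: supported_def intro!: ring_mod.subspace_scale)
  then show "p \<in> J" by (simp flip: poly_eq_sum_terms)
qed

lemma var_power: "var i ^ a = monomial (single i a)"
proof (induction a)
  case 0
  then show ?case by (simp add: monomial_def)
next
  case (Suc a)
  then show ?case by (simp add: var_def monomial_def mult_single single_add[symmetric])
qed

subsection \<open>Ideals generated by powers of the variables\<close>

definition power_exponents :: "('n::finite \<times> nat) set \<Rightarrow> ('n \<Rightarrow>\<^sub>0 nat) set"
  where "power_exponents G = {e. \<exists>i a. (i, a) \<in> G \<and> a \<le> lookup e i}"

text \<open>The ideal generated by the \<open>x\<^sub>i\<^sup>a\<close> with \<open>(i, a) \<in> G\<close>.  Sums of such ideals correspond to unions of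
  the sets \<open>G\<close>, which need not be graphs of functions.\<close>

definition power_ideal :: "('n::finite \<times> nat) set \<Rightarrow> ('n, 'k::field) mpoly set"
  where "power_ideal G = supported (power_exponents G)"

lemma power_exponents_add: "e \<in> power_exponents G \<Longrightarrow> d + e \<in> power_exponents G"
  unfolding power_exponents_def by (auto simp: lookup_add intro: trans_le_add2)

lemma subspace_power_ideal: "ring_mod.subspace (power_ideal G)"
  unfolding power_ideal_def by (intro subspace_supported power_exponents_add)

lemma power_ideal_mono: "G \<subseteq> H \<Longrightarrow> power_ideal G \<subseteq> power_ideal H"
  unfolding power_ideal_def supported_def power_exponents_def by blast

lemma var_power_in_power_ideal: "(i, a) \<in> G \<Longrightarrow> a \<le> b \<Longrightarrow> var i ^ b \<in> power_ideal G"
  unfolding power_ideal_def var_power by (auto simp: power_exponents_def intro!: exI[of _ i] exI[of _ a])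

lemma power_ideal_subset:
  assumes "ring_mod.subspace J" "\<And>i a. (i, a) \<in> G \<Longrightarrow> var i ^ a \<in> J"
  shows "power_ideal G \<subseteq> J"
  unfolding power_ideal_def
proof (rule supported_subset_subspace[OF assms(1)])
  fix e assume "e \<in> power_exponents G"
  then obtain i a where ia: "(i, a) \<in> G" "a \<le> lookup e i" by (auto simp: power_exponents_def)
  have "e = (e - single i a) + single i a"
    using ia by (intro poly_mapping_eqI) (auto simp: lookup_add lookup_minus lookup_single when_def)
  then have "monomial e = monomial (e - single i a) * (var i ^ a :: ('a, 'b) mpoly)"
    by (simp add: monomial_def mult_single var_power)
  then show "monomial e \<in> J"
    by (simp only: ring_mod.subspace_scale[OF assms(1) assms(2)[OF ia(1)]])
qed

lemma span_var_powers:
  "(ring_mod.span ((\<lambda>(i, a). var i ^ a) ` G) :: ('n::finite, 'k::field) mpoly set) = power_ideal G"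
proof
  show "(ring_mod.span ((\<lambda>(i, a). var i ^ a) ` G) :: ('n, 'k) mpoly set) \<subseteq> power_ideal G"
    by (intro ring_mod.span_minimal subspace_power_ideal) (auto intro: var_power_in_power_ideal)
  show "power_ideal G \<subseteq> (ring_mod.span ((\<lambda>(i, a). var i ^ a) ` G) :: ('n, 'k) mpoly set)"
    by (intro power_ideal_subset) (auto intro!: ring_mod.span_base rev_image_eqI)
qed

lemma irreducible_eq_power_ideal:
  fixes J :: "('n::finite, 'k::field) mpoly set"
  assumes "irreducible_monomial_ideal J"
  shows "\<exists>G. J = power_ideal G \<and> (\<forall>i a. (i, a) \<in> G \<longrightarrow> 0 < a) \<and> finite G"
proof -
  obtain A a where "\<forall>i\<in>A. 0 < a i" "J = Idl\<^bsub>\<S>\<^esub> ((\<lambda>i. var i ^ a i) ` A)"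
    using assms unfolding irreducible_monomial_ideal_def by blast
  moreover have "(\<lambda>(i, a). var i ^ a) ` ((\<lambda>i. (i, a i)) ` A) =
      ((\<lambda>i. var i ^ a i) ` A :: ('n, 'k) mpoly set)"
    by (auto simp: image_image)
  ultimately have "J = power_ideal ((\<lambda>i. (i, a i)) ` A)"
    using span_var_powers[of "(\<lambda>i. (i, a i)) ` A", where 'k = 'k] by (simp only: genideal_eq_span)
  then show ?thesis
    using \<open>\<forall>i\<in>A. 0 < a i\<close> by (intro exI[of _ "(\<lambda>i. (i, a i)) ` A"]) auto
qed

lemma ideal_sum_power_ideals:
  assumes "\<And>j. j \<in> U \<Longrightarrow> Q j = power_ideal (G j)"
  shows "ideal_sum \<S> Q U = power_ideal (\<Union>j\<in>U. G j)"
proof -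
  have "ring_mod.span (\<Union>j\<in>U. Q j) = power_ideal (\<Union>j\<in>U. G j)"
  proof
    show "ring_mod.span (\<Union>j\<in>U. Q j) \<subseteq> power_ideal (\<Union>j\<in>U. G j)"
      using assms power_ideal_mono[of "G _" "\<Union>j\<in>U. G j"]
      by (intro ring_mod.span_minimal subspace_power_ideal) blast
    show "power_ideal (\<Union>j\<in>U. G j) \<subseteq> ring_mod.span (\<Union>j\<in>U. Q j)"
      using assms by (intro power_ideal_subset ring_mod.subspace_span ring_mod.span_base)
        (auto intro: var_power_in_power_ideal)
  qed
  then show ?thesis by (simp add: ideal_sum_def genideal_eq_span)
qed

lemma max_ideal_eq_power_ideal: "(\<mm> :: ('n::finite, 'k::field) mpoly set) = power_ideal (UNIV \<times> {Suc 0})"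
proof -
  have "(\<lambda>(i, a). var i ^ a) ` (UNIV \<times> {Suc 0}) = (range var :: ('n, 'k) mpoly set)"
    by (force simp: image_iff)
  then show ?thesis
    using span_var_powers[of "UNIV \<times> {Suc 0} :: ('n \<times> nat) set", where 'k = 'k]
    by (simp only: max_ideal_def genideal_eq_span)
qed

lemma max_ideal_eq: "(\<mm> :: ('n::finite, 'k::field) mpoly set) = {p. lookup p 0 = 0}"
proof -
  have "power_exponents (UNIV \<times> {Suc 0}) = - {0 :: 'n \<Rightarrow>\<^sub>0 nat}"
    by (auto simp: power_exponents_def poly_mapping_eq_iff fun_eq_iff Suc_le_eq)
  then show ?thesis
    by (auto simp: max_ideal_eq_power_ideal power_ideal_def supported_def in_keys_iff)
qed

lemma in_max_ideal_iff: "f \<in> \<mm> \<longleftrightarrow> (\<exists>a. f = (\<Sum>i\<in>UNIV. a i * var i))"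
proof
  assume "f \<in> \<mm>"
  then have "f \<in> ring_mod.span (range var)" by (simp add: max_ideal_def genideal_eq_span)
  then show "\<exists>a. f = (\<Sum>i\<in>UNIV. a i * var i)"
  proof (induction rule: ring_mod.span_induct_alt)
    case base
    show ?case by (intro exI[of _ "\<lambda>_. 0"]) simp
  next
    case (step c x y)
    then obtain i a where "x = var i" "y = (\<Sum>i\<in>UNIV. a i * var i)" by blast
    moreover have "(\<Sum>j\<in>UNIV. (if j = i then c else 0) * var j) = c * (var i :: ('a, 'b) mpoly)"
      by (simp add: if_distrib[of "\<lambda>z. z * _"] cong: if_cong)
    ultimately have "c * x + y = (\<Sum>j\<in>UNIV. ((if j = i then c else 0) + a j) * var j)"
      by (simp add: distrib_right sum.distrib)
    then show ?case by (rule exI[of _ "\<lambda>j. (if j = i then c else 0) + a j"])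
  qed
next
  assume "\<exists>a. f = (\<Sum>i\<in>UNIV. a i * var i)"
  then show "f \<in> \<mm>"
    unfolding max_ideal_def genideal_eq_span
    by (elim exE) (simp add: ring_mod.span_sum ring_mod.span_scale ring_mod.span_base)
qed

section \<open>Elementary symmetric polynomials as regular sequences\<close>

definition total_degree :: "('n::finite \<Rightarrow>\<^sub>0 nat) \<Rightarrow> nat"
  where "total_degree e = (\<Sum>i\<in>UNIV. lookup e i)"

lemma total_degree_add: "total_degree (d + e) = total_degree d + total_degree e"
  by (simp add: total_degree_def lookup_add sum.distrib)

lemma total_degree_single [simp]: "total_degree (single i a) = a"
  by (simp add: total_degree_def lookup_single when_def)

text \<open>Keeps the terms of degree strictly less than \<open>d\<close>.  With the strict bound, truncation commutes with
  multiplication by homogeneous elements even where the subtraction of degrees is cut off at zero.\<close>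

definition truncate :: "nat \<Rightarrow> ('n::finite, 'k::field) mpoly \<Rightarrow> ('n, 'k) mpoly"
  where "truncate d p = Poly_Mapping.mapp (\<lambda>e c. if total_degree e < d then c else 0) p"

lemma lookup_truncate:
  "lookup (truncate d p) e = (if total_degree e < d then lookup p e else 0)"
  by (simp add: truncate_def lookup_mapp in_keys_iff when_def)

lemma truncate_add: "truncate d (p + q) = truncate d p + truncate d q"
  by (rule poly_mapping_eqI) (simp add: lookup_truncate lookup_add)

lemma truncate_homogeneous_mult:
  assumes "\<And>e. e \<in> keys f \<Longrightarrow> total_degree e = m"
  shows "truncate d (f * p) = f * truncate (d - m) p"
proof (rule poly_mapping_eqI)
  fix e
  have "lookup (f * truncate (d - m) p) e =
    (\<Sum>a\<in>keys f. \<Sum>b\<in>keys p. if e = a + b then lookup f a * lookup (truncate (d - m) p) b else 0)"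
    unfolding lookup_mult_finite_sum
    by (intro sum.cong refl sum.mono_neutral_left) (auto simp: in_keys_iff lookup_truncate split: if_splits)
  also have "\<dots> = (\<Sum>a\<in>keys f. \<Sum>b\<in>keys p.
      if total_degree e < d then if e = a + b then lookup f a * lookup p b else 0 else 0)"
    using assms by (intro sum.cong refl) (auto simp: lookup_truncate total_degree_add)
  also have "\<dots> = lookup (truncate d (f * p)) e"
    by (simp add: lookup_truncate lookup_mult_finite_sum)
  finally show "lookup (truncate d (f * p)) e = lookup (f * truncate (d - m) p) e" by simp
qed

definition truncation_closed :: "('n::finite, 'k::field) mpoly set \<Rightarrow> bool"
  where "truncation_closed J \<longleftrightarrow> (\<forall>d. \<forall>p\<in>J. truncate d p \<in> J)"

lemma truncation_closed_supported: "truncation_closed (supported E)"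
  by (auto simp: truncation_closed_def supported_def in_keys_iff lookup_truncate subset_iff)

lemma truncation_closed_add_multiples:
  assumes "truncation_closed J" "\<And>e. e \<in> keys f \<Longrightarrow> total_degree e = m"
  shows "truncation_closed (ring_mod.add_multiples J f UNIV)"
  unfolding truncation_closed_def
proof (intro allI ballI)
  fix d p assume "p \<in> ring_mod.add_multiples J f UNIV"
  then obtain j q where "p = j + f * q" "j \<in> J" unfolding ring_mod.add_multiples_def by blast
  then have "truncate d p = truncate d j + f * truncate (d - m) q" "truncate d j \<in> J"
    using assms by (auto simp: truncate_add truncate_homogeneous_mult truncation_closed_def)
  then show "truncate d p \<in> ring_mod.add_multiples J f UNIV"
    by (simp add: ring_mod.add_multiplesI)
qed

text \<open>If a variable \<open>y\<close> is a nonzerodivisor modulo a graded ideal \<open>J\<close> and \<open>f\<close> is a nonzerodivisor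
  modulo \<open>J + (y)\<close>, then \<open>f\<close> is a nonzerodivisor modulo \<open>J\<close>.  From \<open>f x \<in> J\<close> one gets \<open>x = j + y q\<close>
  with \<open>f y q \<in> J\<close>, hence \<open>f q \<in> J\<close>, and \<open>q\<close> can be taken of smaller degree since \<open>J\<close> is closed
  under truncation.\<close>

lemma regular_lift:
  fixes J :: "('n::finite, 'k::field) mpoly set"
  assumes J: "ring_mod.subspace J" "truncation_closed J"
    and y: "\<And>x. var y * x \<in> J \<Longrightarrow> x \<in> J"
    and f: "\<And>x. f * x \<in> ring_mod.add_multiples J (var y) UNIV \<Longrightarrow> x \<in> ring_mod.add_multiples J (var y) UNIV"
    and x: "f * x \<in> J"
  shows "x \<in> J"
proof -
  have claim: "(\<forall>e\<in>keys x. total_degree e < d) \<Longrightarrow> f * x \<in> J \<Longrightarrow> x \<in> J" for d x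
  proof (induction d arbitrary: x)
    case 0
    then have "x = 0" by (intro poly_mapping_eqI) (auto simp: in_keys_iff)
    then show ?case using ring_mod.subspace_0[OF J(1)] by simp
  next
    case (Suc d)
    have "J \<subseteq> ring_mod.add_multiples J (var y) UNIV"
      by (rule ring_mod.subset_add_multiples) simp
    then have "x \<in> ring_mod.add_multiples J (var y) UNIV" using Suc.prems(2) f by blast
    then obtain j q where jq: "x = j + var y * q" "j \<in> J"
      unfolding ring_mod.add_multiples_def by blast
    define q' where "q' = truncate d q"
    define j' where "j' = truncate (Suc d) j"
    have "x = truncate (Suc d) x"
      using Suc.prems(1) by (intro poly_mapping_eqI) (auto simp: lookup_truncate in_keys_iff)
    also have "\<dots> = j' + truncate (Suc d) (var y * q)"
      unfolding j'_def jq(1) by (rule truncate_add)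
    also have "truncate (Suc d) (var y * q) = var y * q'"
    proof -
      have "total_degree e = 1" if "e \<in> keys (var y :: ('n, 'k) mpoly)" for e
        using that by (auto simp: var_def monomial_def)
      from truncate_homogeneous_mult[OF this, where d = "Suc d" and p = q] show ?thesis by (simp add: q'_def)
    qed
    finally have x_eq: "x = j' + var y * q'" .
    have j': "j' \<in> J" using J(2) jq(2) by (simp add: j'_def truncation_closed_def)
    have "var y * (f * q') = f * x - f * j'"
      by (simp only: x_eq distrib_left mult.left_commute[of "var y" f q'] add_diff_cancel_left')
    also have "\<dots> \<in> J"
      by (rule ring_mod.subspace_diff[OF J(1) Suc.prems(2) ring_mod.subspace_scale[OF J(1) j']])
    finally have "f * q' \<in> J" by (rule y)
    moreover have "\<forall>e\<in>keys q'. total_degree e < d"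
      by (auto simp: q'_def in_keys_iff lookup_truncate split: if_splits)
    ultimately have "q' \<in> J" using Suc.IH by blast
    then show "x \<in> J"
      unfolding x_eq using J(1) j' by (intro ring_mod.subspace_add ring_mod.subspace_scale)
  qed
  have "\<forall>e\<in>keys x. total_degree e < Suc (\<Sum>e\<in>keys x. total_degree e)"
    by (auto simp: less_Suc_eq_le intro: member_le_sum)
  then show ?thesis using claim x by blast
qed

definition power_product :: "nat \<Rightarrow> 'n::finite set \<Rightarrow> ('n \<Rightarrow>\<^sub>0 nat)"
  where "power_product N F = (\<Sum>i\<in>F. single i N)"

text \<open>The \<open>k\<close>-th elementary symmetric polynomial in the \<open>N\<close>-th powers of the variables.  Modulo an ideal
  generated by powers with exponents up to \<open>N\<close>, only the free variables remain in it, so that no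
  nilpotent terms interfere.\<close>

definition elem_sym :: "nat \<Rightarrow> nat \<Rightarrow> ('n::finite, 'k::field) mpoly"
  where "elem_sym N k = (\<Sum>F\<in>{F. card F = k}. monomial (power_product N F))"

lemma lookup_power_product: "lookup (power_product N F) i = (if i \<in> F then N else 0)"
proof -
  have "lookup (power_product N F) i = (\<Sum>j\<in>F. if j = i then N else 0)"
    by (simp add: power_product_def lookup_sum lookup_single when_def)
  then show ?thesis by (simp add: sum.delta)
qed

lemma total_degree_power_product: "total_degree (power_product N F) = N * card F"
  by (simp add: total_degree_def lookup_power_product mult.commute flip: sum.inter_filter)

lemma elem_sym_homogeneous:
  assumes "e \<in> keys (elem_sym N k :: ('n::finite, 'k::field) mpoly)"
  shows "total_degree e = N * k"
proof -
  have "(\<Sum>F\<in>{F. card F = k}. lookup (monomial (power_product N F) :: ('n, 'k) mpoly) e) \<noteq> 0"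
    using assms by (simp add: in_keys_iff elem_sym_def lookup_sum)
  then obtain F :: "'n set" where "F \<in> {F. card F = k}"
    "lookup (monomial (power_product N F) :: ('n, 'k) mpoly) e \<noteq> 0"
    by (rule sum.not_neutral_contains_not_neutral)
  then show ?thesis
    by (auto simp: monomial_def lookup_single when_def total_degree_power_product split: if_splits)
qed

text \<open>The quotients by these ideals are the successive stages of \<open>weakly_regular\<close> for the elementary
  symmetric polynomials.\<close>

primrec elem_ideal :: "nat \<Rightarrow> ('n::finite \<times> nat) set \<Rightarrow> nat \<Rightarrow> ('n, 'k::field) mpoly set"
  where
    "elem_ideal N G 0 = power_ideal G"
  | "elem_ideal N G (Suc k) = ring_mod.add_multiples (elem_ideal N G k) (elem_sym N (Suc k)) UNIV"

lemma subspace_elem_ideal: "ring_mod.subspace (elem_ideal N G k)"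
  by (induction k) (auto intro: subspace_power_ideal ring_mod.subspace_add_multiples)

lemma truncation_closed_elem_ideal: "truncation_closed (elem_ideal N G k)"
  by (induction k)
    (auto simp: power_ideal_def intro!: truncation_closed_supported truncation_closed_add_multiples
      dest: elem_sym_homogeneous)

lemma power_ideal_subset_elem_ideal:
  "(power_ideal G :: ('n::finite, 'k::field) mpoly set) \<subseteq> elem_ideal N G k"
proof (induction k)
  case (Suc k)
  then show ?case
    using ring_mod.subset_add_multiples[OF ring_mod.subspace_UNIV, of "elem_ideal N G k" "elem_sym N (Suc k)"]
    by (simp only: elem_ideal.simps) (rule order_trans)
qed simp

lemma add_multiples_commute:
  "ring_mod.add_multiples (ring_mod.add_multiples J f UNIV) g UNIV =
   ring_mod.add_multiples (ring_mod.add_multiples J g UNIV) f UNIV"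
  unfolding ring_mod.add_multiples_def by (auto simp: add_ac) (metis add.commute add.left_commute)+

lemma elem_ideal_insert:
  "(elem_ideal N (insert (y, Suc 0) G) k :: ('n::finite, 'k::field) mpoly set) =
    ring_mod.add_multiples (elem_ideal N G k) (var y) UNIV"
proof (induction k)
  case 0
  have sub: "ring_mod.subspace (ring_mod.add_multiples (power_ideal G) (var y) UNIV :: ('n, 'k) mpoly set)"
    by (intro ring_mod.subspace_add_multiples subspace_power_ideal) simp
  have "(power_ideal (insert (y, Suc 0) G) :: ('n, 'k) mpoly set) = ring_mod.add_multiples (power_ideal G) (var y) UNIV"
  proof
    show "(power_ideal (insert (y, Suc 0) G) :: ('n, 'k) mpoly set) \<subseteq> ring_mod.add_multiples (power_ideal G) (var y) UNIV"
    proof (rule power_ideal_subset[OF sub])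
      fix i a assume "(i, a) \<in> insert (y, Suc 0) G"
      then consider "i = y" "a = Suc 0" | "(i, a) \<in> G" by auto
      then show "(var i :: ('n, 'k) mpoly) ^ a \<in> ring_mod.add_multiples (power_ideal G) (var y) UNIV"
      proof cases
        case 1
        have "(var y :: ('n, 'k) mpoly) * 1 \<in> ring_mod.add_multiples (power_ideal G) (var y) UNIV"
          by (intro ring_mod.scale_in_add_multiples subspace_power_ideal) simp
        then show ?thesis using 1 by simp
      next
        case 2
        then have "(var i :: ('n, 'k) mpoly) ^ a \<in> power_ideal G" by (rule var_power_in_power_ideal) simp
        then show ?thesis using ring_mod.subset_add_multiples[of UNIV "power_ideal G" "var y"] by auto
      qed
    qed
    have "n + var y * m \<in> power_ideal (insert (y, Suc 0) G)" if "n \<in> power_ideal G" for n m :: "('n, 'k) mpoly"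
    proof (intro ring_mod.subspace_add[OF subspace_power_ideal])
      show "n \<in> power_ideal (insert (y, Suc 0) G)" using that power_ideal_mono[of G "insert (y, Suc 0) G"] by blast
      have "(var y :: ('n, 'k) mpoly) ^ Suc 0 \<in> power_ideal (insert (y, Suc 0) G)" by (rule var_power_in_power_ideal[of y "Suc 0"]) auto
      then have "m * var y \<in> power_ideal (insert (y, Suc 0) G)"
        by (simp add: ring_mod.subspace_scale[OF subspace_power_ideal])
      then show "var y * m \<in> power_ideal (insert (y, Suc 0) G)" by (simp add: mult.commute)
    qed
    then show "(ring_mod.add_multiples (power_ideal G) (var y) UNIV :: ('n, 'k) mpoly set) \<subseteq> power_ideal (insert (y, Suc 0) G)"
      unfolding ring_mod.add_multiples_def by blast
  qed
  then show ?case by simp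
next
  case (Suc k)
  then show ?case using add_multiples_commute[of "elem_ideal N G k" "var y" "elem_sym N (Suc k)"] by simp
qed

definition free_vars :: "('n::finite \<times> nat) set \<Rightarrow> 'n set"
  where "free_vars G = {i. \<forall>a. (i, a) \<notin> G}"

lemma free_vars_insert: "free_vars (insert (y, Suc 0) G) = free_vars G - {y}"
  by (auto simp: free_vars_def)

lemma var_regular_mod_power_ideal:
  assumes "y \<in> free_vars G" "var y * x \<in> power_ideal G"
  shows "x \<in> power_ideal G"
  unfolding power_ideal_def supported_def
proof safe
  fix e assume "e \<in> keys x"
  then have "lookup (var y * x) (single y 1 + e) \<noteq> 0"
    by (simp add: var_def monomial_def lookup_single_mult in_keys_iff)
  then have "single y 1 + e \<in> power_exponents G"
    using assms(2) by (auto simp: power_ideal_def supported_def in_keys_iff)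
  then obtain i a where "(i, a) \<in> G" "a \<le> lookup (single y 1 + e) i"
    unfolding power_exponents_def by blast
  moreover from this have "i \<noteq> y" using assms(1) by (auto simp: free_vars_def)
  ultimately show "e \<in> power_exponents G"
    by (auto simp: power_exponents_def lookup_add lookup_single when_def)
qed

lemma power_product_regular:
  assumes J: "\<And>y x. y \<in> F \<Longrightarrow> var y * x \<in> J \<Longrightarrow> x \<in> J"
    and "monomial (power_product N F) * x \<in> J"
  shows "x \<in> J"
proof -
  have "finite F" by simp
  then show ?thesis using assms
  proof (induction F arbitrary: x rule: finite_induct)
    case empty
    then show ?case by (simp add: power_product_def monomial_def)
  next
    case (insert y F)
    have pow: "var y ^ m * z \<in> J \<Longrightarrow> z \<in> J" for m z
    proof (induction m)
      case (Suc m)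
      have "var y * (var y ^ m * z) \<in> J" using Suc.prems by (simp only: power_Suc mult.assoc)
      then show ?case using Suc.IH insert.prems(1) by blast
    qed simp
    have "monomial (power_product N (insert y F)) =
        var y ^ N * (monomial (power_product N F) :: ('a, 'b) mpoly)"
    proof -
      have "power_product N (insert y F) = single y N + power_product N F"
        using insert.hyps unfolding power_product_def by (rule sum.insert)
      then show ?thesis by (simp only: var_power) (simp add: monomial_def mult_single)
    qed
    then have "var y ^ N * (monomial (power_product N F) * x) \<in> J"
      using insert.prems(2) by (simp only: mult.assoc)
    then have "monomial (power_product N F) * x \<in> J" by (rule pow)
    then show ?case by (rule insert.IH[rotated]) (rule insert.prems(1), auto)
  qed
qed

text \<open>When exactly \<open>k\<close> variables are free, every other product of \<open>k\<close> of the \<open>N\<close>-th powers contains a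
  variable with a power in the ideal.\<close>

lemma elem_sym_eq_power_product:
  assumes "card (free_vars G) = k" "\<And>i a. (i, a) \<in> G \<Longrightarrow> a \<le> N"
  shows "elem_sym N k - monomial (power_product N (free_vars G)) \<in> power_ideal G"
proof -
  have "elem_sym N k - monomial (power_product N (free_vars G)) =
    (\<Sum>F\<in>{F. card F = k} - {free_vars G}. monomial (power_product N F))"
    using assms(1) by (simp add: elem_sym_def sum_diff1)
  also have "\<dots> \<in> power_ideal G"
  proof (rule ring_mod.subspace_sum[OF subspace_power_ideal])
    fix F assume F: "F \<in> {F. card F = k} - {free_vars G}"
    then have "\<not> F \<subseteq> free_vars G" using assms(1) card_subset_eq[of "free_vars G" F] by auto
    then obtain i a where "i \<in> F" "(i, a) \<in> G" by (auto simp: free_vars_def)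
    then show "monomial (power_product N F) \<in> power_ideal G"
      using assms(2) by (auto simp: power_ideal_def power_exponents_def lookup_power_product
          intro!: exI[of _ i] exI[of _ a])
  qed
  finally show ?thesis .
qed

text \<open>Induction on the number of free variables.  If there are exactly \<open>k + 1\<close> of them, the polynomial
  is congruent to the product of their \<open>N\<close>-th powers, and free variables are nonzerodivisors.  If there
  are more, killing one free variable \<open>y\<close> leaves enough of them, and the result is lifted from the
  ideal with \<open>y\<close> added.\<close>

lemma elem_sym_regular_step:
  fixes G :: "('n::finite \<times> nat) set" and x :: "('n, 'k::field) mpoly"
  assumes var_reg: "\<And>(G :: ('n \<times> nat) set) y (x :: ('n, 'k) mpoly). (\<And>i a. (i, a) \<in> G \<Longrightarrow> a \<le> N) \<Longrightarrow>
      k < card (free_vars G) \<Longrightarrow> y \<in> free_vars G \<Longrightarrow> var y * x \<in> elem_ideal N G k \<Longrightarrow> x \<in> elem_ideal N G k"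
    and "0 < N" "\<And>i a. (i, a) \<in> G \<Longrightarrow> a \<le> N" "k < card (free_vars G)"
    and "elem_sym N (Suc k) * x \<in> elem_ideal N G k"
  shows "x \<in> elem_ideal N G k"
  using assms(3-)
proof (induction "card (free_vars G)" arbitrary: G x rule: less_induct)
  case less
  show ?case
  proof (cases "card (free_vars G) = Suc k")
    case True
    let ?m = "monomial (power_product N (free_vars G)) :: ('n, 'k) mpoly"
    have "(elem_sym N (Suc k) - ?m) \<in> elem_ideal N G k"
      using elem_sym_eq_power_product[OF True] less.prems(1) power_ideal_subset_elem_ideal by blast
    then have "x * (elem_sym N (Suc k) - ?m) \<in> elem_ideal N G k"
      by (rule ring_mod.subspace_scale[OF subspace_elem_ideal])
    from ring_mod.subspace_diff[OF subspace_elem_ideal less.prems(3) this]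
    have "?m * x \<in> elem_ideal N G k" by (simp add: algebra_simps)
    then show ?thesis
      by (rule power_product_regular[rotated]) (use var_reg less.prems in blast)
  next
    case False
    obtain y where y: "y \<in> free_vars G" using less.prems(2) by fastforce
    have card: "card (free_vars (insert (y, Suc 0) G)) = card (free_vars G) - 1"
      using y by (simp add: free_vars_insert)
    have bound: "\<And>i a. (i, a) \<in> insert (y, Suc 0) G \<Longrightarrow> a \<le> N"
      using less.prems(1) assms(2) by auto
    have "elem_sym N (Suc k) * z \<in> elem_ideal N (insert (y, Suc 0) G) k \<Longrightarrow>
        z \<in> elem_ideal N (insert (y, Suc 0) G) k" for z :: "('n, 'k) mpoly"
      using less.hyps[of "insert (y, Suc 0) G" z] bound card False less.prems(2) by simp
    then show ?thesis
      using regular_lift[OF subspace_elem_ideal truncation_closed_elem_ideal, where N1 = N and G1 = G and k1 = k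
          and y = y and f = "elem_sym N (Suc k)" and x = x]
        var_reg[OF less.prems(1,2) y] less.prems(3)
      by (simp add: elem_ideal_insert)
  qed
qed

text \<open>A free variable \<open>y\<close> can be moved past the next polynomial \<open>f\<close> because \<open>f\<close> is a nonzerodivisor
  modulo the ideal enlarged by \<open>y\<close>: if \<open>y x = j + f g\<close>, then \<open>g = j' + y q\<close> and
  \<open>y (x - f q) \<in> J\<close>.\<close>

lemma var_regular_mod_elem_ideal:
  fixes G :: "('n::finite \<times> nat) set" and x :: "('n, 'k::field) mpoly"
  assumes "0 < N" "\<And>i a. (i, a) \<in> G \<Longrightarrow> a \<le> N" "k < card (free_vars G)" "y \<in> free_vars G"
    and "var y * x \<in> elem_ideal N G k"
  shows "x \<in> elem_ideal N G k"
  using assms(2-)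
proof (induction k arbitrary: G y x)
  case 0
  then show ?case using var_regular_mod_power_ideal by auto
next
  case (Suc k)
  let ?J = "elem_ideal N G k" and ?f = "elem_sym N (Suc k)" and ?G = "insert (y, Suc 0) G"
  have card: "card (free_vars ?G) = card (free_vars G) - 1"
    using Suc.prems by (simp add: free_vars_insert)
  have bound: "\<And>i a. (i, a) \<in> ?G \<Longrightarrow> a \<le> N"
    using Suc.prems(1) assms(1) by auto
  obtain j g where jg: "var y * x = j + ?f * g" "j \<in> ?J"
    using Suc.prems(4) by (auto simp: ring_mod.add_multiples_def)
  have "?f * g = - j + var y * x" by (simp add: jg)
  also have "\<dots> \<in> elem_ideal N ?G k"
    unfolding elem_ideal_insert
    using jg(2) by (intro ring_mod.add_multiplesI ring_mod.subspace_neg[OF subspace_elem_ideal]) auto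
  finally have "g \<in> elem_ideal N ?G k"
    using elem_sym_regular_step[of N k ?G g] Suc.IH assms(1) bound card Suc.prems(2) by simp
  then obtain j' q where g: "g = j' + var y * q" "j' \<in> ?J"
    by (auto simp: elem_ideal_insert ring_mod.add_multiples_def)
  have "var y * (x - ?f * q) = var y * x - ?f * (var y * q)"
    by (simp only: right_diff_distrib mult.left_commute[of "var y" ?f q])
  also have "\<dots> = j + ?f * j'"
    by (simp only: jg(1) g(1) distrib_left add.assoc[symmetric] add_diff_cancel_right')
  also have "\<dots> \<in> ?J"
    by (intro ring_mod.subspace_add[OF subspace_elem_ideal] jg(2)
        ring_mod.subspace_scale[OF subspace_elem_ideal] g(2))
  finally have "x - ?f * q \<in> ?J"
    using Suc.IH[of G y "x - ?f * q"] Suc.prems by simp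
  from ring_mod.add_multiplesI[OF this, of q UNIV ?f] show ?case by simp
qed

text \<open>One sequence that works for all ideals generated by powers at once, over any field; general linear
  forms would need an infinite field.\<close>

theorem elem_sym_weakly_regular:
  fixes G :: "('n::finite \<times> nat) set"
  assumes "0 < N" "\<And>i a. (i, a) \<in> G \<Longrightarrow> a \<le> N" "d \<le> card (free_vars G)"
  shows "ring_mod.weakly_regular (map (elem_sym N) [1..<Suc d]) UNIV (power_ideal G :: ('n, 'k::field) mpoly set)"
proof -
  have "ring_mod.weakly_regular (map (elem_sym N) [Suc k..<Suc d]) UNIV (elem_ideal N G k :: ('n, 'k) mpoly set)"
    if "k \<le> d" for k
    using that
  proof (induction k rule: inc_induct)
    case base
    then show ?case by simp
  next
    case (step k)
    have "x \<in> elem_ideal N G k" if "elem_sym N (Suc k) * x \<in> elem_ideal N G k" for x :: "('n, 'k) mpoly"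
    proof (rule elem_sym_regular_step[OF _ assms(1) _ _ that])
      show "k < card (free_vars G)" using step.hyps assms(3) by simp
    next
      fix H :: "('n \<times> nat) set" and y and z :: "('n, 'k) mpoly"
      assume "\<And>i a. (i, a) \<in> H \<Longrightarrow> a \<le> N" "k < card (free_vars H)" "y \<in> free_vars H"
        "var y * z \<in> elem_ideal N H k"
      then show "z \<in> elem_ideal N H k" by (rule var_regular_mod_elem_ideal[OF assms(1)])
    qed (rule assms(2))
    moreover have "map (elem_sym N) [Suc k..<Suc d] =
        elem_sym N (Suc k) # (map (elem_sym N) [Suc (Suc k)..<Suc d] :: ('n, 'k) mpoly list)"
      using step.hyps by (simp add: upt_rec)
    ultimately show ?case using step.IH by (simp del: upt_Suc)
  qed
  from this[of 0] show ?thesis by simp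
qed

lemma elem_sym_in_max_ideal:
  assumes "0 < N" "0 < k"
  shows "elem_sym N k \<in> \<mm>"
proof -
  have "0 \<notin> keys (elem_sym N k)"
    using elem_sym_homogeneous[of 0 N k] assms by (auto simp: total_degree_def)
  then show ?thesis by (simp add: max_ideal_eq in_keys_iff)
qed

section \<open>Prime ideals and height\<close>

text \<open>Renumbering the variables embeds the exponents into the linearly ordered monoid of exponents in
  variables indexed by numbers.\<close>

lemma exponents_additive_order:
  obtains w :: "('n::finite \<Rightarrow>\<^sub>0 nat) \<Rightarrow> (nat \<Rightarrow>\<^sub>0 nat)"
  where "inj w" "\<And>d e. w (d + e) = w d + w e"
proof -
  obtain f :: "'n \<Rightarrow> nat" where f: "inj f"
    using finite_imp_inj_to_nat_seg[of "UNIV :: 'n set"] by auto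
  define w where "w e = (\<Sum>i\<in>UNIV. single (f i) (lookup e i))" for e :: "'n \<Rightarrow>\<^sub>0 nat"
  have "lookup (w e) (f i) = lookup e i" for e i
  proof -
    have "lookup (w e) (f i) = (\<Sum>j\<in>UNIV. if j = i then lookup e i else 0)"
      unfolding w_def lookup_sum lookup_single when_def
      by (intro sum.cong refl) (auto simp: inj_eq[OF f])
    then show ?thesis by simp
  qed
  then have "inj w" by (intro injI poly_mapping_eqI) metis
  moreover have "w (d + e) = w d + w e" for d e
    by (simp add: w_def lookup_add single_add sum.distrib)
  ultimately show ?thesis using that by blast
qed

lemma power_exponents_variables: "power_exponents (A \<times> {Suc 0}) = {e. \<exists>i\<in>A. 0 < lookup e i}"
  by (auto simp: power_exponents_def Suc_le_eq)

text \<open>For two polynomials outside the ideal, take in each the largest exponent that avoids the given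
  variables; the coefficient of the product at the sum of these exponents is a product of two nonzero
  coefficients.\<close>

lemma primeideal_variables:
  fixes A :: "'n::finite set"
  shows "primeideal (power_ideal (A \<times> {Suc 0}) :: ('n, 'k::field) mpoly set) \<S>"
  unfolding primeideal_iff
proof (intro conjI allI impI)
  let ?E = "power_exponents (A \<times> {Suc 0})"
  show "ring_mod.subspace (power_ideal (A \<times> {Suc 0}) :: ('n, 'k) mpoly set)"
    by (rule subspace_power_ideal)
  show "(1 :: ('n, 'k) mpoly) \<notin> power_ideal (A \<times> {Suc 0})"
    by (simp add: power_ideal_def supported_def power_exponents_variables)
  fix p q :: "('n, 'k) mpoly"
  assume pq: "p * q \<in> power_ideal (A \<times> {Suc 0})"
  show "p \<in> power_ideal (A \<times> {Suc 0}) \<or> q \<in> power_ideal (A \<times> {Suc 0})"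
  proof (rule ccontr)
    assume neg: "\<not> ?thesis"
    obtain w :: "('n \<Rightarrow>\<^sub>0 nat) \<Rightarrow> (nat \<Rightarrow>\<^sub>0 nat)" where w: "inj w" "\<And>d e. w (d + e) = w d + w e"
      using exponents_additive_order by blast
    have extremal: "\<exists>e\<in>keys p - ?E. \<forall>d\<in>keys p - ?E. w d \<le> w e"
      if "p \<notin> power_ideal (A \<times> {Suc 0})" for p :: "('n, 'k) mpoly"
    proof -
      have "w ` (keys p - ?E) \<noteq> {}" using that by (auto simp: power_ideal_def supported_def)
      then have "Max (w ` (keys p - ?E)) \<in> w ` (keys p - ?E)" by (intro Max_in) auto
      then obtain e where "e \<in> keys p - ?E" "Max (w ` (keys p - ?E)) = w e" by blast
      moreover have "w d \<le> Max (w ` (keys p - ?E))" if "d \<in> keys p - ?E" for d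
        using that by (intro Max_ge) auto
      ultimately show ?thesis by metis
    qed
    obtain e0 where e0: "e0 \<in> keys p - ?E" "\<And>d. d \<in> keys p - ?E \<Longrightarrow> w d \<le> w e0"
      using extremal[of p] neg by blast
    obtain e1 where e1: "e1 \<in> keys q - ?E" "\<And>d. d \<in> keys q - ?E \<Longrightarrow> w d \<le> w e1"
      using extremal[of q] neg by blast
    have notin: "e0 + e1 \<notin> ?E"
      using e0(1) e1(1) by (auto simp: power_exponents_variables lookup_add)
    have unique: "a = e0 \<and> b = e1" if ab: "e0 + e1 = a + b" "a \<in> keys p" "b \<in> keys q" for a b
    proof -
      have "a \<notin> ?E" "b \<notin> ?E"
        using notin power_exponents_add[of b "A \<times> {Suc 0}" a] power_exponents_add[of a "A \<times> {Suc 0}" b]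
        by (auto simp: ab(1) add.commute)
      then have le: "w a \<le> w e0" "w b \<le> w e1" using e0 e1 ab by auto
      have eq: "w e0 + w e1 = w a + w b" using ab(1) w(2) by metis
      have "w a = w e0"
      proof (rule ccontr)
        assume "w a \<noteq> w e0"
        then have "w a + w b < w e0 + w e1" using le by (intro add_less_le_mono) auto
        then show False using eq by simp
      qed
      then have "w a = w e0" "w b = w e1" using eq by auto
      then show ?thesis using w(1) by (auto dest: injD)
    qed
    have "lookup (p * q) (e0 + e1) =
        (\<Sum>a\<in>keys p. \<Sum>b\<in>keys q. if a = e0 then if b = e1 then lookup p a * lookup q b else 0 else 0)"
      unfolding lookup_mult_finite_sum
      by (intro sum.cong refl) (use unique in auto)
    also have "\<dots> = (\<Sum>a\<in>keys p. if a = e0 then lookup p a * lookup q e1 else 0)"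
      using e1(1) by (intro sum.cong refl) (auto simp: sum.delta')
    also have "\<dots> = lookup p e0 * lookup q e1" using e0(1) by simp
    finally have "lookup (p * q) (e0 + e1) \<noteq> 0" using e0(1) e1(1) by (simp add: in_keys_iff)
    then show False using pq notin by (auto simp: power_ideal_def supported_def in_keys_iff)
  qed
qed

lemma primeideal_max_ideal: "primeideal (\<mm> :: ('n::finite, 'k::field) mpoly set) \<S>"
  using primeideal_variables[of UNIV] by (simp add: max_ideal_eq_power_ideal)

lemma var_in_max_ideal: "var i \<in> \<mm>"
  by (auto simp: max_ideal_def genideal_eq_span intro: ring_mod.span_base)

lemma power_ideal_subset_max_ideal:
  assumes pos: "\<And>i a. (i, a) \<in> G \<Longrightarrow> 0 < a"
  shows "(power_ideal G :: ('n::finite, 'k::field) mpoly set) \<subseteq> \<mm>"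
proof (rule power_ideal_subset)
  show sub: "ring_mod.subspace (\<mm> :: ('n, 'k) mpoly set)"
    using primeideal_max_ideal[where 'n = 'n and 'k = 'k] by (simp add: primeideal_iff)
  fix i a assume "(i, a) \<in> G"
  then obtain b where "a = Suc b" using pos gr0_conv_Suc by blast
  then have "(var i :: ('n, 'k) mpoly) ^ a = var i ^ b * var i" by (simp only: power_Suc2)
  also have "\<dots> \<in> \<mm>" by (rule ring_mod.subspace_scale[OF sub var_in_max_ideal])
  finally show "(var i :: ('n, 'k) mpoly) ^ a \<in> \<mm>" .
qed

lemma proper_prime_max_ideal:
  fixes P :: "('n::finite, 'k::field) mpoly set"
  assumes P: "primeideal P \<S>" and "\<And>i. var i \<in> P"
  shows "P = \<mm>"
proof
  have sub: "ring_mod.subspace P" and one: "1 \<notin> P" using P by (auto simp: primeideal_iff)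
  show m: "\<mm> \<subseteq> P"
    unfolding max_ideal_eq_power_ideal using assms(2) by (intro power_ideal_subset[OF sub]) auto
  show "P \<subseteq> \<mm>"
  proof
    fix p assume p: "p \<in> P"
    define c where "c = lookup p 0"
    show "p \<in> \<mm>"
    proof (rule ccontr)
      assume "p \<notin> \<mm>"
      then have c: "c \<noteq> 0" by (simp add: max_ideal_eq c_def)
      have "p - single 0 c \<in> \<mm>" by (simp add: max_ideal_eq c_def lookup_minus)
      then have "p - (p - single 0 c) \<in> P"
        by (rule ring_mod.subspace_diff[OF sub p subsetD[OF m]])
      then have "single 0 c \<in> P" by (simp only: diff_diff_eq2 add_diff_cancel_left')
      then have "single 0 (inverse c) * single 0 c \<in> P"
        by (rule ring_mod.subspace_scale[OF sub])
      then have "(1 :: ('n, 'k) mpoly) \<in> P" using c by (simp add: mult_single)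
      with one show False by simp
    qed
  qed
qed

lemma prime_power_mem:
  fixes P :: "'a::comm_ring_1 set"
  assumes "primeideal P \<R>" "x ^ k * y \<in> P" "x \<notin> P"
  shows "y \<in> P"
  using assms(2)
proof (induction k)
  case (Suc k)
  have "x * (x ^ k * y) \<in> P" using Suc.prems by (simp only: power_Suc mult.assoc)
  then have "x \<in> P \<or> x ^ k * y \<in> P" using assms(1) unfolding primeideal_iff by blast
  then show ?case using Suc.IH assms(3) by blast
qed simp

lemma prime_root_mem:
  fixes P :: "'a::comm_ring_1 set"
  assumes "primeideal P \<R>" "x ^ k \<in> P"
  shows "x \<in> P"
proof (rule ccontr)
  assume "x \<notin> P"
  moreover have "x ^ k * 1 \<in> P" using assms(2) by simp
  ultimately have "1 \<in> P" using prime_power_mem[OF assms(1)] by blast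
  then show False using assms(1) unfolding primeideal_iff by blast
qed

lemma max_ideal_chain:
  "\<exists>C. prime_chain \<S> C (card (UNIV :: 'n set)) \<and> C (card (UNIV :: 'n set)) = (\<mm> :: ('n::finite, 'k::field) mpoly set)"
proof -
  obtain f :: "nat \<Rightarrow> 'n" where f: "bij_betw f {0..<card (UNIV :: 'n set)} UNIV"
    using ex_bij_betw_nat_finite[of "UNIV :: 'n set"] by auto
  define C :: "nat \<Rightarrow> ('n, 'k) mpoly set" where "C i = power_ideal ((f ` {0..<i}) \<times> {Suc 0})" for i
  have "C i \<subset> C (Suc i)" if i: "i < card (UNIV :: 'n set)" for i
  proof
    show "C i \<subseteq> C (Suc i)" unfolding C_def by (intro power_ideal_mono) auto
    have "f i \<notin> f ` {0..<i}"
    proof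
      assume "f i \<in> f ` {0..<i}"
      then obtain x where "x < i" "f i = f x" by auto
      with inj_onD[OF bij_betw_imp_inj_on[OF f], of i x] i show False by simp
    qed
    then have "(var (f i) :: ('n, 'k) mpoly) \<notin> C i"
      by (auto simp: C_def power_ideal_def var_def power_exponents_variables lookup_single when_def split: if_splits)
    moreover have "(var (f i) :: ('n, 'k) mpoly) ^ Suc 0 \<in> C (Suc i)"
      unfolding C_def by (rule var_power_in_power_ideal) auto
    ultimately show "C i \<noteq> C (Suc i)" by auto
  qed
  moreover have "C (card (UNIV :: 'n set)) = \<mm>"
    using f by (simp add: C_def max_ideal_eq_power_ideal bij_betw_def)
  moreover have "primeideal (C i) \<S>" for i
    unfolding C_def by (rule primeideal_variables)
  ultimately show ?thesis unfolding prime_chain_def by blast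
qed

subsection \<open>Elements of a chain of primes are algebraically independent\<close>

text \<open>Choosing \<open>f\<^sub>i \<in> C\<^sub>i\<^sub>+\<^sub>1 - C\<^sub>i\<close>, the polynomials \<open>f\<^sub>j, \<dots>, f\<^sub>l\<^sub>-\<^sub>1\<close> are algebraically independent
  modulo \<open>C\<^sub>j\<close>.  In a relation modulo \<open>C\<^sub>j\<close> one may cancel the largest common power of \<open>f\<^sub>j\<close>, as
  \<open>C\<^sub>j\<close> is prime; modulo \<open>C\<^sub>j\<^sub>+\<^sub>1\<close> the terms free of \<open>f\<^sub>j\<close> then form a shorter nontrivial relation.
  The index set \<open>\<Omega>\<close> consists of functions on all numbers, hence the injectivity of restriction.\<close>

lemma prime_chain_independent:
  fixes f :: "nat \<Rightarrow> ('n::finite, 'k::field) mpoly"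
  assumes chain: "prime_chain \<S> C l" and f: "\<And>i. i < l \<Longrightarrow> f i \<in> C (Suc i) - C i"
    and "j \<le> l" "finite \<Omega>" "inj_on (\<lambda>\<alpha>. restrict \<alpha> {j..<l}) \<Omega>"
    and "(\<Sum>\<alpha>\<in>\<Omega>. single 0 (c \<alpha>) * (\<Prod>i\<in>{j..<l}. f i ^ \<alpha> i)) \<in> C j" "\<alpha> \<in> \<Omega>"
  shows "c \<alpha> = 0"
  using assms(3-)
proof (induction j arbitrary: \<Omega> \<alpha> rule: inc_induct)
  case base
  have P: "ring_mod.subspace (C l)" "1 \<notin> C l" using chain by (auto simp: prime_chain_def primeideal_iff)
  have "\<Omega> = {\<alpha>}" using base.prems(2,4) by (auto simp: inj_on_def)
  then have mem: "single 0 (c \<alpha>) \<in> C l" using base.prems(3) by simp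
  show ?case
  proof (rule ccontr)
    assume "c \<alpha> \<noteq> 0"
    then have "single 0 (inverse (c \<alpha>)) * single 0 (c \<alpha>) = (1 :: ('n, 'k) mpoly)" by (simp add: mult_single)
    then show False using ring_mod.subspace_scale[OF P(1) mem] P(2) by metis
  qed
next
  case (step j)
  have Pj: "primeideal (C j) \<S>" and sub: "ring_mod.subspace (C (Suc j))" and incl: "C j \<subseteq> C (Suc j)"
    using chain step.hyps by (auto simp: prime_chain_def primeideal_iff)
  show ?case
  proof (rule ccontr)
    assume nz: "c \<alpha> \<noteq> 0"
    define \<Omega>0 where "\<Omega>0 = {\<beta> \<in> \<Omega>. c \<beta> \<noteq> 0}"
    define m where "m = Min ((\<lambda>\<beta>. \<beta> j) ` \<Omega>0)"
    define \<Omega>1 where "\<Omega>1 = {\<beta> \<in> \<Omega>0. \<beta> j = m}"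
    define T where "T \<beta> = (\<Prod>i\<in>{Suc j..<l}. f i ^ \<beta> i)" for \<beta> :: "nat \<Rightarrow> nat"
    have fin: "finite \<Omega>0" "finite \<Omega>1" using step.prems(1) by (auto simp: \<Omega>0_def \<Omega>1_def)
    have ne: "(\<lambda>\<beta>. \<beta> j) ` \<Omega>0 \<noteq> {}" using step.prems(4) nz by (auto simp: \<Omega>0_def)
    have "m \<in> (\<lambda>\<beta>. \<beta> j) ` \<Omega>0" unfolding m_def using fin ne by (intro Min_in) auto
    then obtain \<beta>1 where \<beta>1: "\<beta>1 \<in> \<Omega>1" by (auto simp: \<Omega>1_def)
    have m_le: "m \<le> \<beta> j" if "\<beta> \<in> \<Omega>0" for \<beta>
      unfolding m_def using fin that by (intro Min_le) auto
    define S' where "S' = (\<Sum>\<beta>\<in>\<Omega>0. single 0 (c \<beta>) * (f j ^ (\<beta> j - m) * T \<beta>))"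
    have "(\<Sum>\<beta>\<in>\<Omega>. single 0 (c \<beta>) * (\<Prod>i\<in>{j..<l}. f i ^ \<beta> i)) =
        (\<Sum>\<beta>\<in>\<Omega>0. single 0 (c \<beta>) * (\<Prod>i\<in>{j..<l}. f i ^ \<beta> i))"
      using step.prems(1) by (intro sum.mono_neutral_right) (auto simp: \<Omega>0_def)
    also have "\<dots> = f j ^ m * S'"
      unfolding S'_def sum_distrib_left
    proof (intro sum.cong refl)
      fix \<beta> assume "\<beta> \<in> \<Omega>0"
      then have "f j ^ \<beta> j = f j ^ m * f j ^ (\<beta> j - m)" using m_le by (simp flip: power_add)
      moreover have "(\<Prod>i\<in>{j..<l}. f i ^ \<beta> i) = f j ^ \<beta> j * T \<beta>"
        unfolding T_def using step.hyps by (simp add: prod.atLeast_Suc_lessThan)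
      ultimately show "single 0 (c \<beta>) * (\<Prod>i\<in>{j..<l}. f i ^ \<beta> i) =
          f j ^ m * (single 0 (c \<beta>) * (f j ^ (\<beta> j - m) * T \<beta>))"
        by (simp only: mult.assoc mult.left_commute[of "single 0 (c \<beta>)"])
    qed
    finally have "f j ^ m * S' \<in> C j" using step.prems(3) by simp
    then have S': "S' \<in> C (Suc j)" using prime_power_mem[OF Pj] f step.hyps incl by blast
    define R where "R = (\<Sum>\<beta>\<in>\<Omega>0 - \<Omega>1. single 0 (c \<beta>) * (f j ^ (\<beta> j - m) * T \<beta>))"
    have "R \<in> C (Suc j)"
      unfolding R_def
    proof (rule ring_mod.subspace_sum[OF sub])
      fix \<beta> assume "\<beta> \<in> \<Omega>0 - \<Omega>1"
      then have "\<beta> j - m = Suc (\<beta> j - m - 1)" using m_le[of \<beta>] by (auto simp: \<Omega>1_def)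
      then have "f j ^ (\<beta> j - m) = f j ^ (\<beta> j - m - 1) * f j" by (metis power_Suc2)
      then have "single 0 (c \<beta>) * (f j ^ (\<beta> j - m) * T \<beta>) =
          (single 0 (c \<beta>) * f j ^ (\<beta> j - m - 1) * T \<beta>) * f j"
        by (simp only: mult.assoc mult.commute[of "f j"])
      also have "\<dots> \<in> C (Suc j)"
        using f step.hyps by (intro ring_mod.subspace_scale[OF sub]) auto
      finally show "single 0 (c \<beta>) * (f j ^ (\<beta> j - m) * T \<beta>) \<in> C (Suc j)" .
    qed
    moreover have "S' = (\<Sum>\<beta>\<in>\<Omega>1. single 0 (c \<beta>) * T \<beta>) + R"
    proof -
      have "S' = R + (\<Sum>\<beta>\<in>\<Omega>1. single 0 (c \<beta>) * (f j ^ (\<beta> j - m) * T \<beta>))"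
        unfolding S'_def R_def using fin by (intro sum.subset_diff) (auto simp: \<Omega>1_def)
      moreover have "(\<Sum>\<beta>\<in>\<Omega>1. single 0 (c \<beta>) * (f j ^ (\<beta> j - m) * T \<beta>)) =
          (\<Sum>\<beta>\<in>\<Omega>1. single 0 (c \<beta>) * T \<beta>)"
        by (intro sum.cong refl) (auto simp: \<Omega>1_def)
      ultimately show ?thesis by (simp add: add.commute)
    qed
    ultimately have "(\<Sum>\<beta>\<in>\<Omega>1. single 0 (c \<beta>) * T \<beta>) + R - R \<in> C (Suc j)"
      using ring_mod.subspace_diff[OF sub S'] by (simp only:)
    then have "(\<Sum>\<beta>\<in>\<Omega>1. single 0 (c \<beta>) * T \<beta>) \<in> C (Suc j)"
      by (simp only: add_diff_cancel_right')
    moreover have "inj_on (\<lambda>\<alpha>. restrict \<alpha> {Suc j..<l}) \<Omega>1"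
    proof (rule inj_onI)
      fix \<beta> \<gamma> assume *: "\<beta> \<in> \<Omega>1" "\<gamma> \<in> \<Omega>1" "restrict \<beta> {Suc j..<l} = restrict \<gamma> {Suc j..<l}"
      have "\<beta> i = \<gamma> i" if "i \<in> {j..<l}" for i
      proof (cases "i = j")
        case True then show ?thesis using * by (simp add: \<Omega>1_def)
      next
        case False
        then have "i \<in> {Suc j..<l}" using that by simp
        then show ?thesis using *(3) by (metis restrict_apply')
      qed
      then have "restrict \<beta> {j..<l} = restrict \<gamma> {j..<l}" by (intro restrict_ext) auto
      then show "\<beta> = \<gamma>"
        by (rule inj_onD[OF step.prems(2)]) (use * in \<open>auto simp: \<Omega>1_def \<Omega>0_def\<close>)
    qed
    ultimately have "c \<beta>1 = 0"
      using step.IH[OF fin(2) _ _ \<beta>1] unfolding T_def by blast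
    then show False using \<beta>1 by (simp add: \<Omega>1_def \<Omega>0_def)
  qed
qed

definition exponent_box :: "nat \<Rightarrow> ('n::finite \<Rightarrow>\<^sub>0 nat) set"
  where "exponent_box B = {e. \<forall>x. lookup e x \<le> B}"

lemma finite_exponent_box: "finite (exponent_box B :: ('n::finite \<Rightarrow>\<^sub>0 nat) set)"
  and card_exponent_box: "card (exponent_box B :: ('n::finite \<Rightarrow>\<^sub>0 nat) set) \<le> (B + 1) ^ card (UNIV :: 'n set)"
proof -
  let ?F = "(\<Pi>\<^sub>E x\<in>(UNIV :: 'n set). {..B})"
  have inj: "inj_on lookup (exponent_box B :: ('n \<Rightarrow>\<^sub>0 nat) set)"
    by (rule inj_onI, rule poly_mapping_eqI) (simp only:)
  have sub: "lookup ` (exponent_box B :: ('n \<Rightarrow>\<^sub>0 nat) set) \<subseteq> ?F"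
    by (auto simp: exponent_box_def PiE_def extensional_def)
  have fin: "finite ?F" by (intro finite_PiE) auto
  show "finite (exponent_box B :: ('n \<Rightarrow>\<^sub>0 nat) set)" by (rule inj_on_finite[OF inj sub fin])
  have "card (exponent_box B :: ('n \<Rightarrow>\<^sub>0 nat) set) \<le> card ?F" by (rule card_inj_on_le[OF inj sub fin])
  also have "\<dots> = (B + 1) ^ card (UNIV :: 'n set)" by (subst card_PiE) auto
  finally show "card (exponent_box B :: ('n \<Rightarrow>\<^sub>0 nat) set) \<le> (B + 1) ^ card (UNIV :: 'n set)" .
qed

lemma exponent_box_mult:
  assumes "keys p \<subseteq> exponent_box a" "keys q \<subseteq> exponent_box b"
  shows "keys (p * q) \<subseteq> exponent_box (a + b)"
proof
  fix e assume "e \<in> keys (p * q)"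
  then obtain d d' where "e = d + d'" "d \<in> keys p" "d' \<in> keys q" using keys_mult by blast
  then show "e \<in> exponent_box (a + b)"
    using assms by (auto simp: exponent_box_def lookup_add intro!: add_mono)
qed

lemma exponent_box_power:
  assumes "keys (p :: ('n::finite, 'k::field) mpoly) \<subseteq> exponent_box a"
  shows "keys (p ^ k) \<subseteq> exponent_box (k * a)"
proof (induction k)
  case 0
  then show ?case by (simp add: exponent_box_def)
next
  case (Suc k)
  then show ?case using exponent_box_mult[OF assms Suc] by simp
qed

lemma exponent_box_prod:
  fixes g :: "'i \<Rightarrow> ('n::finite, 'k::field) mpoly"
  assumes "finite A" "\<And>i. i \<in> A \<Longrightarrow> keys (g i) \<subseteq> exponent_box a"
  shows "keys (\<Prod>i\<in>A. g i) \<subseteq> exponent_box (card A * a)"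
  using assms
proof (induction A rule: finite_induct)
  case empty
  then show ?case by (simp add: exponent_box_def)
next
  case (insert i A)
  then show ?case using exponent_box_mult[of "g i" a "\<Prod>i\<in>A. g i" "card A * a"] by simp
qed

lemma exponent_box_mono: "a \<le> b \<Longrightarrow> exponent_box a \<subseteq> exponent_box b"
  by (auto simp: exponent_box_def intro: order_trans)

lemma power_growth_bound:
  fixes E l n :: nat
  assumes "\<And>D. (D + 1) ^ l \<le> (l * (D * E) + 1) ^ n"
  shows "l \<le> n"
proof (rule ccontr)
  assume "\<not> l \<le> n"
  then have l: "Suc n \<le> l" by simp
  \<comment> \<open>for this \<open>D\<close> the bound is at most \<open>(D + 1) ^ n * D\<close>\<close>
  define D where "D = (l * E + 1) ^ n"
  have "(D + 1) ^ n * (D + 1) = (D + 1) ^ Suc n" by simp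
  also have "\<dots> \<le> (D + 1) ^ l" using l by (intro power_increasing) auto
  also have "\<dots> \<le> (l * (D * E) + 1) ^ n" by (rule assms)
  also have "\<dots> \<le> ((l * E + 1) * (D + 1)) ^ n"
    by (intro power_mono) (auto simp: algebra_simps)
  also have "\<dots> = (D + 1) ^ n * D"
    unfolding power_mult_distrib D_def[symmetric] by (rule mult.commute)
  finally have "(D + 1) ^ n * (D + 1) \<le> (D + 1) ^ n * D" .
  then show False by simp
qed

text \<open>The \<open>(D + 1)\<^sup>l\<close> products of powers up to \<open>D\<close> of \<open>l\<close> algebraically independent polynomials lie in
  a space of dimension at most \<open>(l D E + 1)\<^sup>n\<close>, where \<open>E\<close> bounds their exponents.  Letting \<open>D\<close> grow
  gives \<open>l \<le> n\<close>.\<close>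

lemma prime_chain_length:
  assumes chain: "prime_chain \<S> (C :: nat \<Rightarrow> ('n::finite, 'k::field) mpoly set) l"
  shows "l \<le> card (UNIV :: 'n set)"
proof -
  have "\<exists>x. x \<in> C (Suc i) - C i" if "i < l" for i
    using chain that unfolding prime_chain_def by blast
  then obtain f where f: "\<And>i. i < l \<Longrightarrow> f i \<in> C (Suc i) - C i" by metis
  define E where "E = (\<Sum>i\<in>{0..<l}. \<Sum>e\<in>keys (f i). total_degree e)"
  have f_box: "keys (f i) \<subseteq> exponent_box E" if i: "i < l" for i
  proof
    fix e assume e: "e \<in> keys (f i)"
    have "lookup e x \<le> E" for x
    proof -
      have "lookup e x \<le> total_degree e" unfolding total_degree_def by (intro member_le_sum) auto
      also have "\<dots> \<le> (\<Sum>e\<in>keys (f i). total_degree e)" using e by (intro member_le_sum) auto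
      also have "\<dots> \<le> E" unfolding E_def
        using i by (intro member_le_sum[of i "{0..<l}" "\<lambda>i. \<Sum>e\<in>keys (f i). total_degree e"]) auto
      finally show ?thesis .
    qed
    then show "e \<in> exponent_box E" by (simp add: exponent_box_def)
  qed
  interpret vs: vector_space "\<lambda>(c::'k) (p::('n, 'k) mpoly). single 0 c * p"
  proof unfold_locales
    fix a b :: 'k and x y :: "('n, 'k) mpoly"
    show "single 0 a * (x + y) = single 0 a * x + single 0 a * y" by (rule distrib_left)
    show "single 0 (a + b) * x = single 0 a * x + single 0 b * x"
      by (simp only: single_add distrib_right)
    show "single 0 a * (single 0 b * x) = single 0 (a * b) * x"
      by (simp only: mult.assoc[symmetric] mult_single add_0)
    show "single 0 1 * x = x" by simp
  qed
  have "(D + 1) ^ l \<le> (l * (D * E) + 1) ^ card (UNIV :: 'n set)" for D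
  proof -
    define \<Omega> where "\<Omega> = (\<Pi>\<^sub>E i\<in>{0..<l}. {..D})"
    define b where "b \<alpha> = (\<Prod>i\<in>{0..<l}. f i ^ \<alpha> i)" for \<alpha> :: "nat \<Rightarrow> nat"
    have fin: "finite \<Omega>" unfolding \<Omega>_def by (intro finite_PiE) auto
    have inj: "inj_on (\<lambda>\<alpha>. restrict \<alpha> {0..<l}) \<Omega>"
      by (rule inj_onI) (simp add: \<Omega>_def PiE_restrict)
    have zero: "0 \<in> C 0" using chain by (auto simp: prime_chain_def primeideal_iff dest: ring_mod.subspace_0)
    have indep: "c \<alpha> = 0" if "\<Omega>' \<subseteq> \<Omega>" "(\<Sum>\<alpha>\<in>\<Omega>'. single 0 (c \<alpha>) * b \<alpha>) = 0" "\<alpha> \<in> \<Omega>'" for c \<Omega>' \<alpha>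
    proof -
      have mem: "(\<Sum>\<alpha>\<in>\<Omega>'. single 0 (c \<alpha>) * (\<Prod>i\<in>{0..<l}. f i ^ \<alpha> i)) \<in> C 0"
        using that(2) zero by (simp only: b_def)
      show ?thesis
      proof (rule prime_chain_independent[OF chain _ le0 finite_subset[OF that(1) fin]
              inj_on_subset[OF inj that(1)] mem that(3)])
        show "f i \<in> C (Suc i) - C i" if "i < l" for i using that by (rule f)
      qed
    qed
    have inj_b: "inj_on b \<Omega>"
    proof (rule inj_onI, rule ccontr)
      fix \<alpha> \<beta> assume *: "\<alpha> \<in> \<Omega>" "\<beta> \<in> \<Omega>" "b \<alpha> = b \<beta>" "\<alpha> \<noteq> \<beta>"
      define c where "c \<gamma> = (if \<gamma> = \<alpha> then 1 else - 1 :: 'k)" for \<gamma>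
      have "(\<Sum>\<gamma>\<in>{\<alpha>, \<beta>}. single 0 (c \<gamma>) * b \<gamma>) = 0"
        using * by (simp add: c_def single_uminus)
      from indep[OF _ this, of \<alpha>] * show False by (simp add: c_def)
    qed
    have ind: "vs.independent (b ` \<Omega>)"
    proof
      assume "vs.dependent (b ` \<Omega>)"
      then obtain u where u: "\<exists>v\<in>b ` \<Omega>. u v \<noteq> 0" "(\<Sum>v\<in>b ` \<Omega>. single 0 (u v) * v) = 0"
        using fin by (subst (asm) vs.dependent_finite) auto
      have "(\<Sum>\<alpha>\<in>\<Omega>. single 0 (u (b \<alpha>)) * b \<alpha>) = 0"
        using u(2) by (simp add: sum.reindex[OF inj_b])
      from indep[OF order_refl this] u(1) show False by blast
    qed
    let ?B = "(monomial :: _ \<Rightarrow> ('n, 'k) mpoly) ` exponent_box (l * (D * E))"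
    have "b ` \<Omega> \<subseteq> vs.span ?B"
    proof safe
      fix \<alpha> assume \<alpha>: "\<alpha> \<in> \<Omega>"
      have "keys (f i ^ \<alpha> i) \<subseteq> exponent_box (D * E)" if "i \<in> {0..<l}" for i
      proof -
        have "\<alpha> i \<le> D" using \<alpha> that by (auto simp: \<Omega>_def PiE_def)
        then show ?thesis
          using exponent_box_power[OF f_box, of i "\<alpha> i"] exponent_box_mono[of "\<alpha> i * E" "D * E"] that
          by auto
      qed
      then have keys: "keys (b \<alpha>) \<subseteq> exponent_box (l * (D * E))"
        using exponent_box_prod[of "{0..<l}" "\<lambda>i. f i ^ \<alpha> i" "D * E"] by (simp add: b_def)
      have "(\<Sum>e\<in>keys (b \<alpha>). single 0 (lookup (b \<alpha>) e) * monomial e) \<in> vs.span ?B"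
        using keys by (intro vs.span_sum vs.span_scale vs.span_base) auto
      then show "b \<alpha> \<in> vs.span ?B"
        by (simp flip: term_eq_mult_monomial poly_eq_sum_terms)
    qed
    then have "card (b ` \<Omega>) \<le> card ?B"
      using vs.independent_span_bound[OF _ ind] finite_exponent_box by blast
    also have "\<dots> \<le> card (exponent_box (l * (D * E)) :: ('n \<Rightarrow>\<^sub>0 nat) set)"
      by (intro card_image_le finite_exponent_box)
    also have "\<dots> \<le> (l * (D * E) + 1) ^ card (UNIV :: 'n set)" by (rule card_exponent_box)
    also have "card (b ` \<Omega>) = (D + 1) ^ l"
      using inj_b by (simp add: card_image \<Omega>_def card_PiE)
    finally show ?thesis .
  qed
  then show ?thesis by (rule power_growth_bound)
qed

text \<open>The maximal ideal is the only prime containing \<open>J\<close>, and the chain of ideals generated by initial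
  segments of the variables has the greatest possible length.\<close>

lemma height_primary_max_ideal:
  fixes J :: "('n::finite, 'k::field) mpoly set"
  assumes "P_primary \<S> \<mm> J"
  shows "height \<S> J = ereal (real (card (UNIV :: 'n set)))"
proof -
  have rad: "{a. \<exists>k. a ^ k \<in> J} = \<mm>" using assms by (simp add: P_primary_def radical_eq)
  have J_m: "J \<subseteq> \<mm>"
  proof
    fix x assume "x \<in> J"
    then have "x ^ 1 \<in> J" by simp
    then show "x \<in> \<mm>" using rad by blast
  qed
  note prime_m = primeideal_max_ideal[where 'n = 'n and 'k = 'k]
  have "P = \<mm>" if P: "primeideal P \<S>" "J \<subseteq> P" for P
  proof (rule proper_prime_max_ideal[OF P(1)])
    fix i
    have "(var i :: ('n, 'k) mpoly) \<in> \<mm>" by (rule var_in_max_ideal)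
    then obtain k where "(var i :: ('n, 'k) mpoly) ^ k \<in> J" using rad by blast
    then show "var i \<in> P" using prime_root_mem[OF P(1)] P(2) by blast
  qed
  then have "{P. primeideal P \<S> \<and> J \<subseteq> P} = {\<mm>}" using J_m prime_m by blast
  then have "height \<S> J = prime_height \<S> (\<mm> :: ('n, 'k) mpoly set)" by (simp add: height_def)
  also have "\<dots> = ereal (real (card (UNIV :: 'n set)))"
    unfolding prime_height_def
  proof (rule antisym)
    show "(SUP l\<in>{l. \<exists>C. prime_chain \<S> C l \<and> C l = (\<mm> :: ('n, 'k) mpoly set)}. ereal (real l)) \<le>
        ereal (real (card (UNIV :: 'n set)))"
      by (rule SUP_least) (auto dest: prime_chain_length)
    show "ereal (real (card (UNIV :: 'n set))) \<le>
        (SUP l\<in>{l. \<exists>C. prime_chain \<S> C l \<and> C l = (\<mm> :: ('n, 'k) mpoly set)}. ereal (real l))"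
      by (rule SUP_upper) (use max_ideal_chain in blast)
  qed
  finally show ?thesis .
qed

section \<open>Quotient rings and their dimension\<close>

lemma coset_eq: "J +>\<^bsub>\<R>\<^esub> (a :: 'a::comm_ring_1) = {j + a | j. j \<in> J}"
  by (auto simp: a_r_coset_def')

lemma coset_mem: "b \<in> J +>\<^bsub>\<R>\<^esub> (a :: 'a::comm_ring_1) \<longleftrightarrow> b - a \<in> J"
  by (auto simp: coset_eq intro: exI[of _ "b - a"])

lemma coset_eq_iff:
  assumes J: "ring_mod.subspace (J :: 'a::comm_ring_1 set)"
  shows "J +>\<^bsub>\<R>\<^esub> a = J +>\<^bsub>\<R>\<^esub> b \<longleftrightarrow> a - b \<in> J"
proof
  assume "J +>\<^bsub>\<R>\<^esub> a = J +>\<^bsub>\<R>\<^esub> b"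
  moreover have "a \<in> J +>\<^bsub>\<R>\<^esub> a" using ring_mod.subspace_0[OF J] by (simp add: coset_mem)
  ultimately show "a - b \<in> J" by (simp add: coset_mem)
next
  assume ab: "a - b \<in> J"
  have "x - a \<in> J \<longleftrightarrow> x - b \<in> J" for x
    using ring_mod.subspace_add[OF J _ ab, of "x - a"] ring_mod.subspace_diff[OF J _ ab, of "x - b"] by auto
  then show "J +>\<^bsub>\<R>\<^esub> a = J +>\<^bsub>\<R>\<^esub> b" by (auto simp: coset_mem)
qed

lemma quot_simps:
  assumes J: "ring_mod.subspace (J :: 'a::comm_ring_1 set)"
  shows "carrier (\<R> Quot J) = range (\<lambda>a. J +>\<^bsub>\<R>\<^esub> a)"
    and "(J +>\<^bsub>\<R>\<^esub> a) \<otimes>\<^bsub>\<R> Quot J\<^esub> (J +>\<^bsub>\<R>\<^esub> b) =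
      J +>\<^bsub>\<R>\<^esub> (a * b)"
    and "(J +>\<^bsub>\<R>\<^esub> a) \<oplus>\<^bsub>\<R> Quot J\<^esub> (J +>\<^bsub>\<R>\<^esub> b) =
      J +>\<^bsub>\<R>\<^esub> (a + b)"
    and "\<one>\<^bsub>\<R> Quot J\<^esub> = J +>\<^bsub>\<R>\<^esub> 1"
    and "\<zero>\<^bsub>\<R> Quot J\<^esub> = J +>\<^bsub>\<R>\<^esub> 0"
proof -
  interpret ideal J "\<R> :: 'a ring" using J by (simp add: ideal_iff_subspace)
  show "carrier (\<R> Quot J) = range (\<lambda>a. J +>\<^bsub>\<R>\<^esub> a)"
    by (auto simp: FactRing_def A_RCOSETS_def')
  show "(J +>\<^bsub>\<R>\<^esub> a) \<otimes>\<^bsub>\<R> Quot J\<^esub> (J +>\<^bsub>\<R>\<^esub> b) =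
      J +>\<^bsub>\<R>\<^esub> (a * b)"
    using rcoset_mult_add[of a b] by (simp add: FactRing_def)
  show "(J +>\<^bsub>\<R>\<^esub> a) \<oplus>\<^bsub>\<R> Quot J\<^esub> (J +>\<^bsub>\<R>\<^esub> b) =
      J +>\<^bsub>\<R>\<^esub> (a + b)"
    using a_rcos_sum[of a b] by (simp add: FactRing_def)
  show "\<one>\<^bsub>\<R> Quot J\<^esub> = J +>\<^bsub>\<R>\<^esub> 1"
    by (simp add: FactRing_def)
  show "\<zero>\<^bsub>\<R> Quot J\<^esub> = J +>\<^bsub>\<R>\<^esub> 0"
    by (auto simp: FactRing_def coset_mem)
qed

lemma quot_prime_image:
  assumes J: "ring_mod.subspace (J :: 'a::comm_ring_1 set)" and P: "primeideal P \<R>" "J \<subseteq> P"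
  shows "primeideal ((+>\<^bsub>\<R>\<^esub>) J ` P) (\<R> Quot J)"
proof -
  interpret R: cring "\<R> :: 'a ring" by (rule cring_type_ring)
  have iJ: "ideal J (\<R> :: 'a ring)" using J by (simp add: ideal_iff_subspace)
  have sub: "ring_mod.subspace P" and one: "1 \<notin> P" and prime: "\<And>a b. a * b \<in> P \<Longrightarrow> a \<in> P \<or> b \<in> P"
    using P(1) by (auto simp: primeideal_iff)
  have mem: "J +>\<^bsub>\<R>\<^esub> a \<in> (+>\<^bsub>\<R>\<^esub>) J ` P \<longleftrightarrow> a \<in> P" for a
  proof
    assume "J +>\<^bsub>\<R>\<^esub> a \<in> (+>\<^bsub>\<R>\<^esub>) J ` P"
    then obtain p where p: "p \<in> P" "J +>\<^bsub>\<R>\<^esub> a = J +>\<^bsub>\<R>\<^esub> p" by blast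
    then have "a - p \<in> P" using P(2) by (auto simp: coset_eq_iff[OF J])
    from ring_mod.subspace_add[OF sub this p(1)] show "a \<in> P" by simp
  qed blast
  show ?thesis
  proof (rule primeidealI)
    show "ideal ((+>\<^bsub>\<R>\<^esub>) J ` P) (\<R> Quot J)"
      using P(1) by (intro R.ring_ideal_imp_quot_ideal[OF iJ]) (simp add: primeideal_def)
    show "cring (\<R> Quot J)"
      by (rule ideal.quotient_is_cring[OF iJ cring_type_ring])
    have "J +>\<^bsub>\<R>\<^esub> 1 \<in> carrier (\<R> Quot J)"
      by (simp add: quot_simps(1)[OF J])
    then show "carrier (\<R> Quot J) \<noteq> (+>\<^bsub>\<R>\<^esub>) J ` P"
      using mem[of 1] one by auto
    show "x \<in> (+>\<^bsub>\<R>\<^esub>) J ` P \<or> y \<in> (+>\<^bsub>\<R>\<^esub>) J ` P"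
      if xy: "x \<in> carrier (\<R> Quot J)" "y \<in> carrier (\<R> Quot J)"
        "x \<otimes>\<^bsub>\<R> Quot J\<^esub> y \<in> (+>\<^bsub>\<R>\<^esub>) J ` P" for x y
    proof -
      obtain a b where ab: "x = J +>\<^bsub>\<R>\<^esub> a" "y = J +>\<^bsub>\<R>\<^esub> b"
        using xy(1,2) unfolding quot_simps(1)[OF J] by blast
      have "a * b \<in> P" using xy(3) unfolding ab quot_simps(2)[OF J] mem .
      then show ?thesis unfolding ab mem by (rule prime)
    qed
  qed
qed

lemma quot_prime_preimage:
  assumes J: "ring_mod.subspace (J :: 'a::comm_ring_1 set)" and P: "primeideal P (\<R> Quot J)"
  shows "primeideal {a. J +>\<^bsub>\<R>\<^esub> a \<in> P} \<R>"
    and "J \<subseteq> {a. J +>\<^bsub>\<R>\<^esub> a \<in> P}"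
    and "P = (+>\<^bsub>\<R>\<^esub>) J ` {a. J +>\<^bsub>\<R>\<^esub> a \<in> P}"
proof -
  have iJ: "ideal J (\<R> :: 'a ring)" using J by (simp add: ideal_iff_subspace)
  interpret P: primeideal P "\<R> Quot J" by (rule P)
  show "primeideal {a. J +>\<^bsub>\<R>\<^esub> a \<in> P} \<R>"
    using ring_hom_ring.primeideal_vimage[OF ideal.rcos_ring_hom_ring[OF iJ] cring_type_ring P] by simp
  have "\<zero>\<^bsub>\<R> Quot J\<^esub> \<in> P"
    by (rule additive_subgroup.zero_closed[OF P.additive_subgroup_axioms])
  then have zero: "J +>\<^bsub>\<R>\<^esub> 0 \<in> P" by (simp add: quot_simps(5)[OF J])
  have "J +>\<^bsub>\<R>\<^esub> a = J +>\<^bsub>\<R>\<^esub> 0" if "a \<in> J" for a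
    using that by (simp add: coset_eq_iff[OF J])
  then show "J \<subseteq> {a. J +>\<^bsub>\<R>\<^esub> a \<in> P}" using zero by auto
  have "P \<subseteq> range (\<lambda>a. J +>\<^bsub>\<R>\<^esub> a)"
    using additive_subgroup.a_subset[OF P.additive_subgroup_axioms] by (simp add: quot_simps(1)[OF J])
  then show "P = (+>\<^bsub>\<R>\<^esub>) J ` {a. J +>\<^bsub>\<R>\<^esub> a \<in> P}" by blast
qed

text \<open>If a variable is free, the ideal generated by the variables that are not free is a prime strictly
  below the maximal one.  If none is free, every prime contains all variables.\<close>

lemma krull_dim_quot_eq_0_iff:
  fixes G :: "('n::finite \<times> nat) set"
  assumes pos: "\<And>i a. (i, a) \<in> G \<Longrightarrow> 0 < a"
  shows "krull_dim (\<S> Quot (power_ideal G :: ('n, 'k::field) mpoly set)) = 0 \<longleftrightarrow> free_vars G = {}"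
proof -
  let ?J = "power_ideal G :: ('n, 'k) mpoly set"
  let ?q = "\<lambda>P. (+>\<^bsub>\<S>\<^esub>) ?J ` P"
  note J = subspace_power_ideal[of G, where 'b = 'k]
  note prime_m = primeideal_max_ideal[where 'n = 'n and 'k = 'k]
  note var_m = var_in_max_ideal[where 'a = 'n and 'b = 'k]
  have J_m: "?J \<subseteq> \<mm>" using pos by (rule power_ideal_subset_max_ideal)
  show ?thesis
  proof
    assume dim: "krull_dim (\<S> Quot ?J) = 0"
    show "free_vars G = {}"
    proof (rule ccontr)
      assume "free_vars G \<noteq> {}"
      then obtain y where y: "y \<in> free_vars G" by blast
      define P :: "('n, 'k) mpoly set" where "P = power_ideal ((- free_vars G) \<times> {Suc 0})"
      have P: "primeideal P \<S>" unfolding P_def by (rule primeideal_variables)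
      have "power_exponents G \<subseteq> power_exponents ((- free_vars G) \<times> {Suc 0})"
        using pos unfolding power_exponents_variables
        by (auto simp: power_exponents_def free_vars_def intro: less_le_trans)
      then have J_P: "?J \<subseteq> P" by (auto simp: P_def power_ideal_def supported_def)
      have "P \<subseteq> \<mm>" unfolding P_def max_ideal_eq_power_ideal by (rule power_ideal_mono) auto
      have yP: "(var y :: ('n, 'k) mpoly) \<notin> P"
        using y by (auto simp: P_def power_ideal_def var_def power_exponents_variables lookup_single when_def split: if_splits)
      have "?q P \<noteq> ?q \<mm>"
      proof
        assume "?q P = ?q \<mm>"
        then have "?J +>\<^bsub>\<S>\<^esub> var y \<in> ?q P" using var_m by blast
        then obtain p where p: "p \<in> P" "?J +>\<^bsub>\<S>\<^esub> var y = ?J +>\<^bsub>\<S>\<^esub> p" by blast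
        then have "var y - p \<in> P" using J_P by (auto simp: coset_eq_iff[OF J])
        moreover have "ring_mod.subspace P" using P by (simp add: primeideal_iff)
        ultimately have "var y - p + p \<in> P" using p(1) ring_mod.subspace_add by blast
        then show False using yP by simp
      qed
      then have "?q P \<subset> ?q \<mm>" using \<open>P \<subseteq> \<mm>\<close> by blast
      then have "prime_chain (\<S> Quot ?J) (\<lambda>i. if i = 0 then ?q P else ?q \<mm>) 1"
        using quot_prime_image[OF J P J_P] quot_prime_image[OF J prime_m J_m]
        by (simp add: prime_chain_def)
      then have "ereal (real 1) \<le> krull_dim (\<S> Quot ?J)"
        unfolding krull_dim_def by (intro SUP_upper) blast
      then show False using dim by simp
    qed
  next
    assume free: "free_vars G = {}"
    have unique: "P = ?q \<mm>" if P: "primeideal P (\<S> Quot ?J)" for P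
    proof -
      let ?P = "{a. ?J +>\<^bsub>\<S>\<^esub> a \<in> P}"
      note pre = quot_prime_preimage[OF J P]
      have "?P = \<mm>"
      proof (rule proper_prime_max_ideal[OF pre(1)])
        fix i
        obtain a where "(i, a) \<in> G" using free by (auto simp: free_vars_def)
        then have "(var i :: ('n, 'k) mpoly) ^ a \<in> ?J" by (rule var_power_in_power_ideal) simp
        then show "var i \<in> ?P" using prime_root_mem[OF pre(1)] pre(2) by blast
      qed
      then show ?thesis using pre(3) by simp
    qed
    have "{l. \<exists>C. prime_chain (\<S> Quot ?J) C l} = {0}"
    proof safe
      fix l C assume chain: "prime_chain (\<S> Quot ?J) C l"
      show "l = 0"
      proof (rule ccontr)
        assume "l \<noteq> 0"
        then have less: "C 0 \<subset> C (Suc 0)" and le: "Suc 0 \<le> l"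
          using chain unfolding prime_chain_def by auto
        have "C 0 = ?q \<mm>" "C (Suc 0) = ?q \<mm>"
          using chain le unfolding prime_chain_def by (intro unique; simp)+
        then show False using less by simp
      qed
    next
      have "prime_chain (\<S> Quot ?J) (\<lambda>_. ?q \<mm>) 0"
        using quot_prime_image[OF J prime_m J_m] by (simp add: prime_chain_def)
      then show "\<exists>C. prime_chain (\<S> Quot ?J) C 0" by blast
    qed
    then show "krull_dim (\<S> Quot ?J) = 0" by (simp add: krull_dim_def)
  qed
qed

section \<open>Uniqueness of the irredundant presentation\<close>

text \<open>Otherwise each member of the intersection has a generator \<open>x\<^sub>i\<^sup>a\<close> outside the irreducible ideal on the
  right, and the least common multiple of these generators is in the intersection but not in that ideal,
  since each of its exponents is zero or occurs in one of the generators.\<close>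

lemma power_ideal_contains_Inter:
  fixes G :: "'j \<Rightarrow> ('n::finite \<times> nat) set"
  assumes "finite K" and sub: "(\<Inter>j\<in>K. power_ideal (G j)) \<subseteq> (power_ideal H :: ('n, 'k::field) mpoly set)"
    and pos: "\<And>i a. (i, a) \<in> H \<Longrightarrow> 0 < a"
  shows "\<exists>j\<in>K. power_ideal (G j) \<subseteq> (power_ideal H :: ('n, 'k) mpoly set)"
proof (rule ccontr)
  assume neg: "\<not> ?thesis"
  have "\<exists>i a. (i, a) \<in> G j \<and> (var i :: ('n, 'k) mpoly) ^ a \<notin> power_ideal H" if "j \<in> K" for j
  proof (rule ccontr)
    assume "\<not> ?thesis"
    then have "power_ideal (G j) \<subseteq> (power_ideal H :: ('n, 'k) mpoly set)"
      by (intro power_ideal_subset[OF subspace_power_ideal]) blast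
    then show False using neg that by blast
  qed
  then obtain i a where ia: "\<And>j. j \<in> K \<Longrightarrow> (i j, a j) \<in> G j"
    "\<And>j. j \<in> K \<Longrightarrow> (var (i j) :: ('n, 'k) mpoly) ^ a j \<notin> power_ideal H"
    by metis
  define m where "m x = Max (insert 0 (a ` {j \<in> K. i j = x}))" for x
  define e where "e = (\<Sum>x\<in>UNIV. single x (m x))"
  have e: "lookup e x = m x" for x
    by (simp add: e_def lookup_sum lookup_single when_def)
  have fin: "finite (insert 0 (a ` {j \<in> K. i j = x}))" for x using \<open>finite K\<close> by simp
  have "(monomial e :: ('n, 'k) mpoly) \<in> power_ideal (G j)" if j: "j \<in> K" for j
  proof -
    have "a j \<le> m (i j)" unfolding m_def using j by (intro Max_ge fin) auto
    then show ?thesis using ia(1)[OF j] e by (auto simp: power_ideal_def power_exponents_def)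
  qed
  then have "(monomial e :: ('n, 'k) mpoly) \<in> power_ideal H" using sub by blast
  then obtain x b where xb: "(x, b) \<in> H" "b \<le> m x"
    by (auto simp: power_ideal_def power_exponents_def e)
  have "m x \<in> insert 0 (a ` {j \<in> K. i j = x})" unfolding m_def by (intro Max_in fin) simp
  moreover have "m x \<noteq> 0" using pos[OF xb(1)] xb(2) by simp
  ultimately obtain j where j: "j \<in> K" "i j = x" "a j = m x" by auto
  then have "(var (i j) :: ('n, 'k) mpoly) ^ a j \<in> power_ideal H"
    using xb by (intro var_power_in_power_ideal[of "i j" b]) auto
  then show False using ia(2) j by blast
qed

lemma irredundant_contains_member:
  fixes I :: "('n::finite, 'k::field) mpoly set"
  assumes Q: "irredundant_presentation I s Q" and Q': "irredundant_presentation I s' Q'" and k: "k \<in> {1..s}"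
  shows "\<exists>j\<in>{1..s'}. Q' j \<subseteq> Q k"
proof -
  have "\<exists>G. Q' j = power_ideal G" if "j \<in> {1..s'}" for j
  proof -
    have "irreducible_monomial_ideal (Q' j)"
      using Q' that unfolding irredundant_presentation_def by blast
    from irreducible_eq_power_ideal[OF this] show ?thesis by blast
  qed
  then obtain G where G: "\<And>j. j \<in> {1..s'} \<Longrightarrow> Q' j = power_ideal (G j)" by metis
  have "irreducible_monomial_ideal (Q k)" using Q k unfolding irredundant_presentation_def by blast
  from irreducible_eq_power_ideal[OF this]
  obtain H where H: "Q k = power_ideal H" "\<And>i a. (i, a) \<in> H \<Longrightarrow> 0 < a"
    by blast
  have "(\<Inter>j\<in>{1..s'}. Q' j) = (\<Inter>j\<in>{1..s}. Q j)"
    using Q Q' unfolding irredundant_presentation_def by simp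
  then have "(\<Inter>j\<in>{1..s'}. Q' j) \<subseteq> Q k" using k by blast
  then have "(\<Inter>j\<in>{1..s'}. power_ideal (G j)) \<subseteq> (power_ideal H :: ('n, 'k) mpoly set)"
    using G H by simp
  from power_ideal_contains_Inter[OF _ this H(2)] show ?thesis using G H by auto
qed

lemma irredundant_minimal:
  assumes Q: "irredundant_presentation I s Q" and jk: "j \<in> {1..s}" "k \<in> {1..s}" "Q j \<subseteq> Q k"
  shows "j = k"
proof (rule ccontr)
  assume "j \<noteq> k"
  have "(\<Inter>i\<in>{1..s} - {k}. Q i) = (\<Inter>i\<in>{1..s}. Q i)"
  proof
    have "(\<Inter>i\<in>{1..s} - {k}. Q i) \<subseteq> Q k" using jk \<open>j \<noteq> k\<close> by blast
    then show "(\<Inter>i\<in>{1..s} - {k}. Q i) \<subseteq> (\<Inter>i\<in>{1..s}. Q i)" by blast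
  qed blast
  then show False using Q jk(2) unfolding irredundant_presentation_def by metis
qed

lemma irredundant_inj: "irredundant_presentation I s Q \<Longrightarrow> inj_on Q {1..s}"
  by (rule inj_onI, rule irredundant_minimal) auto

lemma irredundant_presentation_unique:
  assumes Q: "irredundant_presentation I s Q" and Q': "irredundant_presentation I s' Q'"
  shows "Q ` {1..s} = Q' ` {1..s'}"
proof -
  have "Q ` {1..s} \<subseteq> Q' ` {1..s'}"
    if Q: "irredundant_presentation I s Q" and Q': "irredundant_presentation I s' Q'" for s s' Q Q'
  proof
    fix J assume "J \<in> Q ` {1..s}"
    then obtain k where k: "k \<in> {1..s}" "J = Q k" by blast
    obtain j where j: "j \<in> {1..s'}" "Q' j \<subseteq> Q k"
      using irredundant_contains_member[OF Q Q' k(1)] by blast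
    obtain k' where k': "k' \<in> {1..s}" "Q k' \<subseteq> Q' j"
      using irredundant_contains_member[OF Q' Q j(1)] by blast
    have "k' = k" using irredundant_minimal[OF Q k'(1) k(1)] j k' by blast
    then have "J = Q' j" using j k' k by blast
    then show "J \<in> Q' ` {1..s'}" using j by blast
  qed
  then show ?thesis using assms by blast
qed

text \<open>Size and bigsize refer to numbered families; in terms of the set of members they are visibly
  independent of the numbering.\<close>

definition spanning_subfamily :: "('n::finite, 'k::field) mpoly set set \<Rightarrow> ('n, 'k) mpoly set set \<Rightarrow> bool"
  where "spanning_subfamily \<Q> \<X> \<longleftrightarrow>
    radical \<S> (Idl\<^bsub>\<S>\<^esub> (\<Union>\<X>)) = radical \<S> (Idl\<^bsub>\<S>\<^esub> (\<Union>\<Q>))"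

lemma spans_iff: "spans s Q U \<longleftrightarrow> spanning_subfamily (Q ` {1..s}) (Q ` U)"
  by (simp add: spans_def spanning_subfamily_def ideal_sum_def)

lemma subfamily_exists_iff:
  assumes "inj_on Q {1..s}"
  shows "(\<exists>U\<subseteq>{1..s}. card U = t \<and> spans s Q U) \<longleftrightarrow>
    (\<exists>\<X>\<subseteq>Q ` {1..s}. card \<X> = t \<and> spanning_subfamily (Q ` {1..s}) \<X>)"
proof
  assume "\<exists>U\<subseteq>{1..s}. card U = t \<and> spans s Q U"
  then obtain U where U: "U \<subseteq> {1..s}" "card U = t" "spans s Q U" by blast
  then have "card (Q ` U) = t" using assms card_image inj_on_subset by blast
  then show "\<exists>\<X>\<subseteq>Q ` {1..s}. card \<X> = t \<and> spanning_subfamily (Q ` {1..s}) \<X>"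
    using U by (intro exI[of _ "Q ` U"]) (auto simp: spans_iff)
next
  assume "\<exists>\<X>\<subseteq>Q ` {1..s}. card \<X> = t \<and> spanning_subfamily (Q ` {1..s}) \<X>"
  then obtain U where U: "U \<subseteq> {1..s}" "card (Q ` U) = t" "spanning_subfamily (Q ` {1..s}) (Q ` U)"
    using subset_imageE by metis
  then have "card U = t" using assms card_image inj_on_subset by metis
  then show "\<exists>U\<subseteq>{1..s}. card U = t \<and> spans s Q U" using U by (auto simp: spans_iff)
qed

lemma subfamily_all_iff:
  assumes "inj_on Q {1..s}"
  shows "(\<forall>U\<subseteq>{1..s}. card U = t \<longrightarrow> spans s Q U) \<longleftrightarrow>
    (\<forall>\<X>\<subseteq>Q ` {1..s}. card \<X> = t \<longrightarrow> spanning_subfamily (Q ` {1..s}) \<X>)"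
proof
  assume *: "\<forall>U\<subseteq>{1..s}. card U = t \<longrightarrow> spans s Q U"
  show "\<forall>\<X>\<subseteq>Q ` {1..s}. card \<X> = t \<longrightarrow> spanning_subfamily (Q ` {1..s}) \<X>"
  proof (intro allI impI)
    fix \<X> assume "\<X> \<subseteq> Q ` {1..s}" "card \<X> = t"
    then obtain U where U: "U \<subseteq> {1..s}" "\<X> = Q ` U" "card (Q ` U) = t"
      using subset_imageE by metis
    then have "card U = t" using assms card_image inj_on_subset by metis
    then show "spanning_subfamily (Q ` {1..s}) \<X>" using * U by (simp add: spans_iff)
  qed
next
  assume *: "\<forall>\<X>\<subseteq>Q ` {1..s}. card \<X> = t \<longrightarrow> spanning_subfamily (Q ` {1..s}) \<X>"
  show "\<forall>U\<subseteq>{1..s}. card U = t \<longrightarrow> spans s Q U"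
  proof (intro allI impI)
    fix U assume U: "U \<subseteq> {1..s}" "card U = t"
    then have "card (Q ` U) = t" using assms card_image inj_on_subset by blast
    then show "spans s Q U" using * U by (simp add: spans_iff image_mono)
  qed
qed

lemma ideal_sum_cong:
  assumes "Q ` A = Q' ` A'"
  shows "ideal_sum R Q A = ideal_sum R Q' A'"
  using assms by (simp add: ideal_sum_def)

lemma ideal_size_eq:
  assumes Q: "irredundant_presentation I s Q"
  shows "ideal_size I = family_size s Q"
  unfolding ideal_size_def
proof (rule the_equality)
  show "\<exists>s' Q'. irredundant_presentation I s' Q' \<and> family_size s Q = family_size s' Q'"
    using Q by blast
next
  fix z assume "\<exists>s' Q'. irredundant_presentation I s' Q' \<and> z = family_size s' Q'"
  then obtain s' Q' where Q': "irredundant_presentation I s' Q'" "z = family_size s' Q'" by blast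
  note eq = irredundant_presentation_unique[OF Q'(1) Q]
  show "z = family_size s Q"
    unfolding Q'(2) family_size_def
    by (simp only: subfamily_exists_iff[OF irredundant_inj[OF Q]]
        subfamily_exists_iff[OF irredundant_inj[OF Q'(1)]] eq ideal_sum_cong[OF eq])
qed

lemma ideal_bigsize_eq:
  assumes Q: "irredundant_presentation I s Q"
  shows "ideal_bigsize I = family_bigsize s Q"
  unfolding ideal_bigsize_def
proof (rule the_equality)
  show "\<exists>s' Q'. irredundant_presentation I s' Q' \<and> family_bigsize s Q = family_bigsize s' Q'"
    using Q by blast
next
  fix z assume "\<exists>s' Q'. irredundant_presentation I s' Q' \<and> z = family_bigsize s' Q'"
  then obtain s' Q' where Q': "irredundant_presentation I s' Q'" "z = family_bigsize s' Q'" by blast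
  note eq = irredundant_presentation_unique[OF Q'(1) Q]
  show "z = family_bigsize s Q"
    unfolding Q'(2) family_bigsize_def
    by (simp only: subfamily_all_iff[OF irredundant_inj[OF Q]]
        subfamily_all_iff[OF irredundant_inj[OF Q'(1)]] eq ideal_sum_cong[OF eq])
qed

section \<open>The complex of a family of ideals generated by powers of variables\<close>

global_interpretation fun_mod: comm_module "\<lambda>(p :: 'a::comm_ring_1) (g :: 'u \<Rightarrow> 'a) U. p * g U"
proof unfold_locales
  fix a b :: 'a and x y :: "'u \<Rightarrow> 'a"
  show "(\<lambda>U. a * (x + y) U) = (\<lambda>U. a * x U) + (\<lambda>U. a * y U)"
    by (simp only: plus_fun_def distrib_left)
  show "(\<lambda>U. (a + b) * x U) = (\<lambda>U. a * x U) + (\<lambda>U. b * x U)"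
    by (simp only: plus_fun_def distrib_right)
  show "(\<lambda>U. a * (b * x U)) = (\<lambda>U. a * b * x U)"
    by (simp only: mult.assoc)
  show "(\<lambda>U. 1 * x U) = x" by simp
qed

definition family_ideal :: "(nat \<Rightarrow> ('n::finite \<times> nat) set) \<Rightarrow> nat set \<Rightarrow> ('n, 'k::field) mpoly set"
  where "family_ideal G U = power_ideal (\<Union>j\<in>U. G j)"

definition incidence_diff :: "nat \<Rightarrow> (nat set \<Rightarrow> 'a::comm_ring_1) \<Rightarrow> nat set \<Rightarrow> 'a"
  where "incidence_diff s = ring_mod.koszul_diff {1..s} (\<lambda>_. 1)"

text \<open>Families of polynomials representing the elements of \<open>G\<^sub>i\<close>.\<close>

definition lifted_cochains :: "nat \<Rightarrow> nat \<Rightarrow> (nat set \<Rightarrow> 'a::comm_ring_1) set"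
  where "lifted_cochains s i = {g. \<forall>U. g U \<noteq> 0 \<longrightarrow> U \<in> index_sets s i}"

text \<open>The families that represent zero in \<open>G\<^sub>i\<close>.\<close>

definition zero_cochains :: "nat \<Rightarrow> nat \<Rightarrow> (nat set \<Rightarrow> 'a set) \<Rightarrow> (nat set \<Rightarrow> 'a::comm_ring_1) set"
  where "zero_cochains s i J = {g \<in> lifted_cochains s i. \<forall>U\<in>index_sets s i. g U \<in> J U}"

text \<open>The families representing elements of the kernel of \<open>G\<^sub>i \<rightarrow> G\<^sub>i\<^sub>+\<^sub>1\<close>.\<close>

definition cocycles :: "nat \<Rightarrow> nat \<Rightarrow> (nat set \<Rightarrow> 'a set) \<Rightarrow> (nat set \<Rightarrow> 'a::comm_ring_1) set"
  where "cocycles s i J = {g \<in> lifted_cochains s i. incidence_diff s g \<in> zero_cochains s (Suc i) J}"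

lemma subspace_family_ideal: "ring_mod.subspace (family_ideal G U)"
  unfolding family_ideal_def by (rule subspace_power_ideal)

lemma family_ideal_mono: "U \<subseteq> V \<Longrightarrow> family_ideal G U \<subseteq> family_ideal G V"
  unfolding family_ideal_def by (rule power_ideal_mono) blast

lemma lifted_cochains_iff: "g \<in> lifted_cochains s i \<longleftrightarrow> g \<in> ring_mod.cochains {1..s} (int i) UNIV"
  by (simp add: lifted_cochains_def ring_mod.cochains_def index_sets_def)

lemma incidence_diff_lifted: "g \<in> lifted_cochains s i \<Longrightarrow> incidence_diff s g \<in> lifted_cochains s (Suc i)"
  unfolding lifted_cochains_iff incidence_diff_def
  using ring_mod.koszul_diff_cochains[of "{1..s}" UNIV g "int i" "\<lambda>_. 1"]
  by (simp add: add.commute)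

lemma incidence_diff_hom:
  "module_hom (\<lambda>(p :: 'a::comm_ring_1) g U. p * g U) (\<lambda>p g U. p * g U) (incidence_diff s)"
proof
  show "incidence_diff s (g + h) = incidence_diff s g + (incidence_diff s h :: nat set \<Rightarrow> 'a)" for g h
    unfolding incidence_diff_def by (rule ext) (simp add: plus_fun_def ring_mod.koszul_diff_add)
  show "incidence_diff s (\<lambda>U. p * g U) = (\<lambda>U. p * incidence_diff s g U)" for p :: 'a and g
    unfolding incidence_diff_def by (rule ext) (rule ring_mod.koszul_diff_scale)
qed

lemma incidence_diff_twice: "incidence_diff s (incidence_diff s g) = 0"
  unfolding incidence_diff_def by (rule ext) (simp add: ring_mod.koszul_diff_koszul_diff)

lemma subspace_lifted_cochains: "fun_mod.subspace (lifted_cochains s i)"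
proof (rule fun_mod.subspaceI)
  show "(0 :: nat set \<Rightarrow> 'a) \<in> lifted_cochains s i" by (simp add: lifted_cochains_def)
next
  fix g h :: "nat set \<Rightarrow> 'a" assume *: "g \<in> lifted_cochains s i" "h \<in> lifted_cochains s i"
  show "g + h \<in> lifted_cochains s i"
    unfolding lifted_cochains_def
  proof safe
    fix U assume "(g + h) U \<noteq> 0"
    then have "g U \<noteq> 0 \<or> h U \<noteq> 0" by auto
    moreover have "g U \<noteq> 0 \<Longrightarrow> U \<in> index_sets s i" "h U \<noteq> 0 \<Longrightarrow> U \<in> index_sets s i"
      using * by (simp_all add: lifted_cochains_def)
    ultimately show "U \<in> index_sets s i" by blast
  qed
next
  fix p :: 'a and g :: "nat set \<Rightarrow> 'a" assume "g \<in> lifted_cochains s i"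
  then have "g U = 0" if "U \<notin> index_sets s i" for U using that by (auto simp: lifted_cochains_def)
  then have "p * g U = 0" if "U \<notin> index_sets s i" for U using that by simp
  then show "(\<lambda>U. p * g U) \<in> lifted_cochains s i" unfolding lifted_cochains_def by blast
qed

lemma subspace_zero_cochains:
  fixes J :: "nat set \<Rightarrow> 'a::comm_ring_1 set"
  assumes J: "\<And>U. ring_mod.subspace (J U)"
  shows "fun_mod.subspace (zero_cochains s i J)"
proof (rule fun_mod.subspaceI)
  note L = subspace_lifted_cochains[of s i]
  have "(0 :: nat set \<Rightarrow> 'a) U \<in> J U" for U
    using ring_mod.subspace_0[OF J, of U] by simp
  then show "0 \<in> zero_cochains s i J"
    using fun_mod.subspace_0[OF L] unfolding zero_cochains_def by blast
next
  note L = subspace_lifted_cochains[of s i]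
  fix g h :: "nat set \<Rightarrow> 'a" assume *: "g \<in> zero_cochains s i J" "h \<in> zero_cochains s i J"
  have "(g + h) U \<in> J U" if "U \<in> index_sets s i" for U
    using * that ring_mod.subspace_add[OF J, of "g U" U "h U"] by (simp add: zero_cochains_def)
  then show "g + h \<in> zero_cochains s i J"
    using * fun_mod.subspace_add[OF L] unfolding zero_cochains_def by blast
next
  note L = subspace_lifted_cochains[of s i]
  fix p :: 'a and g :: "nat set \<Rightarrow> 'a" assume *: "g \<in> zero_cochains s i J"
  have "p * g U \<in> J U" if "U \<in> index_sets s i" for U
    using * that ring_mod.subspace_scale[OF J, of "g U" U p] by (simp add: zero_cochains_def)
  then show "(\<lambda>U. p * g U) \<in> zero_cochains s i J"
    using * fun_mod.subspace_scale[OF L] unfolding zero_cochains_def by blast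
qed

lemma subspace_cocycles:
  fixes J :: "nat set \<Rightarrow> 'a::comm_ring_1 set"
  assumes J: "\<And>U. ring_mod.subspace (J U)"
  shows "fun_mod.subspace (cocycles s i J)"
proof -
  interpret d: module_hom "\<lambda>(p :: 'a) g U. p * g U" "\<lambda>p g U. p * g U" "incidence_diff s"
    by (rule incidence_diff_hom)
  have "cocycles s i J = lifted_cochains s i \<inter> incidence_diff s -` zero_cochains s (Suc i) J"
    by (auto simp: cocycles_def)
  moreover have "fun_mod.subspace (incidence_diff s -` zero_cochains s (Suc i) J)"
    by (rule d.subspace_vimage[OF subspace_zero_cochains[OF J]])
  ultimately show ?thesis
    using fun_mod.subspace_inter[OF subspace_lifted_cochains] by metis
qed

lemma cocycles_subset: "cocycles s i J \<subseteq> lifted_cochains s i"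
  by (auto simp: cocycles_def)

lemma zero_cochains_subset_cocycles:
  "zero_cochains s i (family_ideal G) \<subseteq> cocycles s i (family_ideal G)"
proof
  fix g assume g: "g \<in> zero_cochains s i (family_ideal G)"
  then have L: "g \<in> lifted_cochains s i" by (simp add: zero_cochains_def)
  have mem: "g U \<in> family_ideal G U" for U
    using g ring_mod.subspace_0[OF subspace_family_ideal[of G U]]
    by (cases "g U = 0") (auto simp: zero_cochains_def lifted_cochains_def)
  have "incidence_diff s g V \<in> family_ideal G V" for V
  proof -
    have "g (V - {k}) \<in> family_ideal G V" for k
      using mem[of "V - {k}"] family_ideal_mono[of "V - {k}" V G] by blast
    then show ?thesis
      unfolding incidence_diff_def ring_mod.koszul_diff_def
      by (auto intro!: ring_mod.subspace_sum[OF subspace_family_ideal]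
          ring_mod.subspace_scale[OF subspace_family_ideal] ring_mod.subspace_0[OF subspace_family_ideal])
  qed
  then show "g \<in> cocycles s i (family_ideal G)"
    using L incidence_diff_lifted[OF L] by (simp add: cocycles_def zero_cochains_def)
qed

subsection \<open>Exactness\<close>

lemma lookup_incidence_diff:
  "lookup (incidence_diff s g V) e = incidence_diff s (\<lambda>U. lookup (g U) e) V"
  for g :: "nat set \<Rightarrow> ('e::comm_monoid_add \<Rightarrow>\<^sub>0 'k::comm_ring_1)"
  unfolding incidence_diff_def ring_mod.koszul_diff_def koszul_sign_def
  by (simp add: lookup_sum lookup_minus_one_power_mult)

lemma mem_family_ideal_iff:
  "p \<in> family_ideal G U \<longleftrightarrow> (\<forall>e\<in>keys p. \<exists>j\<in>U. e \<in> power_exponents (G j))"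
  unfolding family_ideal_def power_ideal_def supported_def power_exponents_def by blast

text \<open>In multidegree \<open>e\<close> only the \<open>S\<^sub>U\<close> with \<open>U\<close> inside \<open>F e\<close> are not zero, where \<open>F e\<close> consists of the \<open>j\<close>
  with \<open>x\<^sup>e \<notin> Q\<^sub>j\<close>.  If \<open>F e\<close> is not empty, contraction with one of its elements, chosen for each \<open>e\<close>
  separately, splits the complex; if it is empty, everything in degree \<open>e\<close> is zero beyond \<open>G\<^sub>0\<close>.\<close>

lemma cocycle_is_coboundary:
  fixes g :: "nat set \<Rightarrow> ('n::finite, 'k::field) mpoly"
  assumes g: "g \<in> cocycles s (Suc i) (family_ideal G)"
  shows "\<exists>h\<in>lifted_cochains s i. g - incidence_diff s h \<in> zero_cochains s (Suc i) (family_ideal G)"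
proof -
  define F where "F e = {j \<in> {1..s}. e \<notin> power_exponents (G j)}" for e
  define vertex where "vertex e = (SOME k. k \<in> F e)" for e
  have vertex: "vertex e \<in> F e" if "F e \<noteq> {}" for e
    using that unfolding vertex_def by (auto intro: someI)
  define c where "c U e = (if F e \<noteq> {} \<and> U \<subseteq> {1..s}
    then ring_mod.contraction (vertex e) (\<lambda>W. lookup (g W) e) U else 0)" for U e
  \<comment> \<open>the contractions in the single multidegrees add up to polynomials, since only finitely many
    exponents occur in \<open>g\<close>\<close>
  define h where "h U = (\<Sum>e\<in>(\<Union>W\<in>Pow {1..s}. keys (g W)). single e (c U e))" for U
  have gL: "g \<in> lifted_cochains s (Suc i)" and dg: "incidence_diff s g \<in> zero_cochains s (Suc (Suc i)) (family_ideal G)"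
    using g by (auto simp: cocycles_def)
  have lookup_h: "lookup (h U) e = c U e" for U e
  proof -
    have "c U e = 0" if "e \<notin> (\<Union>W\<in>Pow {1..s}. keys (g W))"
    proof (cases "F e \<noteq> {} \<and> U \<subseteq> {1..s}")
      case True
      then have "insert (vertex e) U \<in> Pow {1..s}" using vertex[of e] by (auto simp: F_def)
      then have "lookup (g (insert (vertex e) U)) e = 0" using that by (auto simp: in_keys_iff)
      then show ?thesis using True by (simp add: c_def ring_mod.contraction_def)
    qed (auto simp: c_def)
    moreover have "finite (\<Union>W\<in>Pow {1..s}. keys (g W))" by simp
    ultimately show ?thesis
      by (simp add: h_def lookup_sum lookup_single when_def sum.delta')
  qed
  have hL: "h \<in> lifted_cochains s i"
    unfolding lifted_cochains_def
  proof safe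
    fix U assume "h U \<noteq> 0"
    then obtain e where e: "c U e \<noteq> 0" using lookup_h poly_mapping_eqI[of "h U" 0] by auto
    then have *: "F e \<noteq> {}" "U \<subseteq> {1..s}" "vertex e \<notin> U" "lookup (g (insert (vertex e) U)) e \<noteq> 0"
      by (auto simp: c_def ring_mod.contraction_def split: if_splits)
    then have "g (insert (vertex e) U) \<noteq> 0" by auto
    then have "insert (vertex e) U \<in> index_sets s (Suc i)"
      using gL unfolding lifted_cochains_def by blast
    moreover have "finite U" using *(2) finite_subset by blast
    ultimately show "U \<in> index_sets s i" using * by (auto simp: index_sets_def)
  qed
  have "(g - incidence_diff s h) U \<in> family_ideal G U" if U: "U \<in> index_sets s (Suc i)" for U
    unfolding mem_family_ideal_iff
  proof (rule ccontr)
    have U': "U \<subseteq> {1..s}" "U \<noteq> {}" using U by (auto simp: index_sets_def)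
    assume "\<not> (\<forall>e\<in>keys ((g - incidence_diff s h) U). \<exists>j\<in>U. e \<in> power_exponents (G j))"
    then obtain e where e: "lookup ((g - incidence_diff s h) U) e \<noteq> 0" "\<And>j. j \<in> U \<Longrightarrow> e \<notin> power_exponents (G j)"
      by (auto simp: in_keys_iff)
    then have UF: "U \<subseteq> F e" using U' by (auto simp: F_def)
    then have k: "vertex e \<in> F e" using U' by (intro vertex) auto
    then have k': "vertex e \<in> {1..s}" by (simp add: F_def)
    let ?g = "\<lambda>W. lookup (g W) e"
    have "lookup (incidence_diff s h U) e = incidence_diff s (ring_mod.contraction (vertex e) ?g) U"
    proof -
      have "U - {x} \<subseteq> {1..s}" for x using U'(1) by blast
      then have "c (U - {x}) e = ring_mod.contraction (vertex e) ?g (U - {x})" for x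
        using k unfolding c_def by (metis empty_iff)
      then show ?thesis
        unfolding lookup_incidence_diff lookup_h unfolding incidence_diff_def ring_mod.koszul_diff_def
        by (simp only:)
    qed
    moreover have "ring_mod.contraction (vertex e) (incidence_diff s ?g) U = 0"
    proof (cases "vertex e \<in> U")
      case False
      have "insert (vertex e) U \<in> index_sets s (Suc (Suc i))"
        using U k' False finite_subset[OF U'(1)] by (auto simp: index_sets_def)
      then have "incidence_diff s g (insert (vertex e) U) \<in> family_ideal G (insert (vertex e) U)"
        using dg by (simp add: zero_cochains_def)
      moreover have "\<not> (\<exists>j\<in>insert (vertex e) U. e \<in> power_exponents (G j))"
        using k UF by (auto simp: F_def)
      ultimately have "e \<notin> keys (incidence_diff s g (insert (vertex e) U))"
        by (auto simp only: mem_family_ideal_iff)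
      then have "lookup (incidence_diff s g (insert (vertex e) U)) e = 0"
        by (simp only: in_keys_iff not_not)
      then show ?thesis
        unfolding lookup_incidence_diff by (simp add: ring_mod.contraction_def)
    qed (simp add: ring_mod.contraction_def)
    moreover have "incidence_diff s (ring_mod.contraction (vertex e) ?g) U +
        ring_mod.contraction (vertex e) (incidence_diff s ?g) U = ?g U"
      using ring_mod.koszul_homotopy[of "{1..s}" "vertex e" U "\<lambda>_. 1" ?g] k' U'(1)
      by (simp add: incidence_diff_def)
    ultimately show False using e(1) by (simp add: lookup_minus)
  qed
  moreover have "g - incidence_diff s h \<in> lifted_cochains s (Suc i)"
    using gL incidence_diff_lifted[OF hL] by (rule fun_mod.subspace_diff[OF subspace_lifted_cochains])
  ultimately show ?thesis using hL by (auto simp: zero_cochains_def)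
qed

text \<open>Exactness of \<open>0 \<rightarrow> Z\<^sub>i \<rightarrow> G\<^sub>i \<rightarrow> Z\<^sub>i\<^sub>+\<^sub>1 \<rightarrow> 0\<close>: the image of \<open>G\<^sub>i\<close> is the whole kernel in the next degree.\<close>

lemma incidence_diff_iso:
  "fun_mod.subquotient_iso (incidence_diff s) (lifted_cochains s i) (cocycles s i (family_ideal G))
     (cocycles s (Suc i) (family_ideal G)) (zero_cochains s (Suc i) (family_ideal G))"
  unfolding fun_mod.subquotient_iso_def
proof (intro conjI ballI)
  show "module_hom (\<lambda>p g U. p * g U) (\<lambda>p g U. p * g U) (incidence_diff s)" by (rule incidence_diff_hom)
  fix g :: "nat set \<Rightarrow> ('a, 'b) mpoly" assume g: "g \<in> lifted_cochains s i"
  show "incidence_diff s g \<in> cocycles s (Suc i) (family_ideal G)"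
    using incidence_diff_lifted[OF g] fun_mod.subspace_0[OF subspace_zero_cochains[OF subspace_family_ideal]]
    by (simp add: cocycles_def incidence_diff_twice)
  show "(incidence_diff s g \<in> zero_cochains s (Suc i) (family_ideal G)) = (g \<in> cocycles s i (family_ideal G))"
    using g by (simp add: cocycles_def)
next
  fix g assume "g \<in> cocycles s (Suc i) (family_ideal G)"
  from cocycle_is_coboundary[OF this]
  show "\<exists>h\<in>lifted_cochains s i. g - incidence_diff s h \<in> zero_cochains s (Suc i) (family_ideal G)" .
qed

subsection \<open>Regular sequences on the modules of the complex\<close>

lemma add_multiples_zero_cochains:
  fixes J :: "nat set \<Rightarrow> 'a::comm_ring_1 set"
  shows "fun_mod.add_multiples (zero_cochains s i J) f (lifted_cochains s i) =
    zero_cochains s i (\<lambda>U. ring_mod.add_multiples (J U) f UNIV)"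
proof
  show "fun_mod.add_multiples (zero_cochains s i J) f (lifted_cochains s i) \<subseteq>
    zero_cochains s i (\<lambda>U. ring_mod.add_multiples (J U) f UNIV)"
  proof
    fix g assume "g \<in> fun_mod.add_multiples (zero_cochains s i J) f (lifted_cochains s i)"
    then obtain n m where g: "g = n + (\<lambda>U. f * m U)" "n \<in> zero_cochains s i J" "m \<in> lifted_cochains s i"
      unfolding fun_mod.add_multiples_def by blast
    have "g \<in> lifted_cochains s i"
      unfolding g(1) using g(2,3)
      by (intro fun_mod.subspace_add[OF subspace_lifted_cochains] fun_mod.subspace_scale[OF subspace_lifted_cochains])
        (auto simp: zero_cochains_def)
    then show "g \<in> zero_cochains s i (\<lambda>U. ring_mod.add_multiples (J U) f UNIV)"
      using g(2) by (auto simp: zero_cochains_def g(1) intro!: ring_mod.add_multiplesI)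
  qed
  show "zero_cochains s i (\<lambda>U. ring_mod.add_multiples (J U) f UNIV) \<subseteq>
    fun_mod.add_multiples (zero_cochains s i J) f (lifted_cochains s i)"
  proof
    fix g assume g: "g \<in> zero_cochains s i (\<lambda>U. ring_mod.add_multiples (J U) f UNIV)"
    then have "\<forall>U\<in>index_sets s i. \<exists>n m. g U = n + f * m \<and> n \<in> J U"
      unfolding zero_cochains_def ring_mod.add_multiples_def by blast
    then obtain n m where nm: "\<And>U. U \<in> index_sets s i \<Longrightarrow> g U = n U + f * m U \<and> n U \<in> J U"
      by metis
    let ?n = "\<lambda>U. if U \<in> index_sets s i then n U else 0"
    let ?m = "\<lambda>U. if U \<in> index_sets s i then m U else 0"
    have "g = ?n + (\<lambda>U. f * ?m U)"
      using g nm by (auto simp: fun_eq_iff zero_cochains_def lifted_cochains_def)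
    moreover have "?n \<in> zero_cochains s i J" "?m \<in> lifted_cochains s i"
      using nm by (auto simp: zero_cochains_def lifted_cochains_def)
    ultimately show "g \<in> fun_mod.add_multiples (zero_cochains s i J) f (lifted_cochains s i)"
      using fun_mod.add_multiplesI[of ?n "zero_cochains s i J" ?m "lifted_cochains s i" f] by simp
  qed
qed

lemma weakly_regular_lifted_cochains:
  fixes J :: "nat set \<Rightarrow> 'a::comm_ring_1 set"
  assumes "\<And>U. U \<in> index_sets s i \<Longrightarrow> ring_mod.weakly_regular fs UNIV (J U)"
  shows "fun_mod.weakly_regular fs (lifted_cochains s i) (zero_cochains s i J)"
  using assms
proof (induction fs arbitrary: J)
  case Nil
  show ?case by simp
next
  case (Cons f fs)
  have head: "\<And>U x. U \<in> index_sets s i \<Longrightarrow> f * x \<in> J U \<Longrightarrow> x \<in> J U"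
    and tail: "\<And>U. U \<in> index_sets s i \<Longrightarrow> ring_mod.weakly_regular fs UNIV (ring_mod.add_multiples (J U) f UNIV)"
    using Cons.prems unfolding ring_mod.weakly_regular.simps by blast+
  have "x \<in> zero_cochains s i J" if "x \<in> lifted_cochains s i" "(\<lambda>U. f * x U) \<in> zero_cochains s i J" for x
    using that head unfolding zero_cochains_def by blast
  moreover have "fun_mod.weakly_regular fs (lifted_cochains s i)
      (zero_cochains s i (\<lambda>U. ring_mod.add_multiples (J U) f UNIV))"
    by (rule Cons.IH) (rule tail)
  ultimately show ?case
    unfolding fun_mod.weakly_regular.simps add_multiples_zero_cochains by blast
qed

section \<open>Regular sequences on an ideal\<close>

lemma (in comm_module) weakly_regular_iff:
  "weakly_regular fs M N \<longleftrightarrow> (\<forall>k<length fs. \<forall>x\<in>M.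
     fs ! k *s x \<in> foldl (\<lambda>N f. add_multiples N f M) N (take k fs) \<longrightarrow>
     x \<in> foldl (\<lambda>N f. add_multiples N f M) N (take k fs))"
proof (induction fs arbitrary: N)
  case (Cons f fs)
  show ?case
    unfolding weakly_regular.simps Cons.IH length_Cons All_less_Suc2 by simp
qed simp

lemma abelian_monoid_ideal_module:
  assumes J: "ring_mod.subspace (J :: 'a::comm_ring_1 set)"
  shows "abelian_monoid (ideal_module \<R> J)"
  by (rule abelian_monoidI)
    (auto simp: ideal_module_def add_ac ring_mod.subspace_0[OF J] intro: ring_mod.subspace_add[OF J])

lemma finsum_ideal_module:
  assumes J: "ring_mod.subspace (J :: 'a::comm_ring_1 set)" and "finite A" "f \<in> A \<rightarrow> J"
  shows "finsum (ideal_module \<R> J) f A = sum f A"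
proof -
  interpret abelian_monoid "ideal_module \<R> J"
    by (rule abelian_monoid_ideal_module[OF J])
  show ?thesis using assms(2,3)
  proof (induction A rule: finite_induct)
    case empty
    show ?case by (simp only: finsum_empty sum.empty) (simp add: ideal_module_def)
  next
    case (insert a A)
    have "f \<in> A \<rightarrow> carrier (ideal_module \<R> J)"
      "f a \<in> carrier (ideal_module \<R> J)"
      using insert.prems by (auto simp: ideal_module_def)
    then have "finsum (ideal_module \<R> J) f (insert a A) =
        f a \<oplus>\<^bsub>ideal_module \<R> J\<^esub> finsum (ideal_module \<R> J) f A"
      using insert.hyps by (intro finsum_insert)
    then show ?case using insert by (simp add: ideal_module_def)
  qed
qed

lemma seq_mult_ideal_module:
  assumes J: "ring_mod.subspace (J :: 'a::comm_ring_1 set)"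
  shows "seq_mult (ideal_module \<R> J) fs =
    {\<Sum>k<length fs. fs ! k * m k | m. \<forall>k<length fs. m k \<in> J}"
proof -
  have eq: "(\<Oplus>\<^bsub>ideal_module \<R> J\<^esub>k\<in>{..<length fs}. fs ! k \<odot>\<^bsub>ideal_module \<R> J\<^esub> m k) =
      (\<Sum>k<length fs. fs ! k * m k)" if "\<forall>k<length fs. m k \<in> J" for m
  proof -
    have "(\<lambda>k. fs ! k * m k) \<in> {..<length fs} \<rightarrow> J"
      using that by (auto intro: ring_mod.subspace_scale[OF J])
    from finsum_ideal_module[OF J finite_lessThan this] show ?thesis by (simp add: ideal_module_def)
  qed
  have carrier: "m \<in> {..<length fs} \<rightarrow> carrier (ideal_module \<R> J) \<longleftrightarrow> (\<forall>k<length fs. m k \<in> J)"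
    for m by (auto simp: ideal_module_def)
  show ?thesis
    unfolding seq_mult_def carrier setcompr_eq_image
    by (rule image_cong[OF refl]) (rule eq, simp)
qed

lemma seq_mult_eq_foldl:
  assumes J: "ring_mod.subspace (J :: 'a::comm_ring_1 set)"
  shows "seq_mult (ideal_module \<R> J) fs =
    foldl (\<lambda>N f. ring_mod.add_multiples N f J) {0} fs"
proof (induction fs rule: rev_induct)
  case Nil
  show ?case by (auto simp: seq_mult_ideal_module[OF J])
next
  case (snoc f fs)
  have "seq_mult (ideal_module \<R> J) (fs @ [f]) =
      ring_mod.add_multiples (seq_mult (ideal_module \<R> J) fs) f J"
  proof
    show "seq_mult (ideal_module \<R> J) (fs @ [f]) \<subseteq>
        ring_mod.add_multiples (seq_mult (ideal_module \<R> J) fs) f J"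
    proof
      fix x assume "x \<in> seq_mult (ideal_module \<R> J) (fs @ [f])"
      then obtain m where m: "x = (\<Sum>k<Suc (length fs). (fs @ [f]) ! k * m k)"
        "\<forall>k<Suc (length fs). m k \<in> J"
        by (auto simp: seq_mult_ideal_module[OF J])
      then have "x = (\<Sum>k<length fs. fs ! k * m k) + f * m (length fs)"
        by (simp add: nth_append)
      moreover have "(\<Sum>k<length fs. fs ! k * m k) \<in> seq_mult (ideal_module \<R> J) fs"
        unfolding seq_mult_ideal_module[OF J] using m(2) by (auto intro!: exI[of _ m])
      ultimately show "x \<in> ring_mod.add_multiples (seq_mult (ideal_module \<R> J) fs) f J"
        using m(2) by (auto intro: ring_mod.add_multiplesI)
    qed
    show "ring_mod.add_multiples (seq_mult (ideal_module \<R> J) fs) f J \<subseteq>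
        seq_mult (ideal_module \<R> J) (fs @ [f])"
    proof
      fix x assume "x \<in> ring_mod.add_multiples (seq_mult (ideal_module \<R> J) fs) f J"
      then obtain y z where x: "x = y + f * z" "y \<in> seq_mult (ideal_module \<R> J) fs" "z \<in> J"
        unfolding ring_mod.add_multiples_def by blast
      then obtain m where m: "y = (\<Sum>k<length fs. fs ! k * m k)" "\<forall>k<length fs. m k \<in> J"
        by (auto simp: seq_mult_ideal_module[OF J])
      let ?m = "m(length fs := z)"
      have "x = (\<Sum>k<length (fs @ [f]). (fs @ [f]) ! k * ?m k)"
        by (simp add: x(1) m(1) nth_append)
      moreover have "\<forall>k<length (fs @ [f]). ?m k \<in> J" using m(2) x(3) by (auto simp: less_Suc_eq)
      ultimately show "x \<in> seq_mult (ideal_module \<R> J) (fs @ [f])"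
        unfolding seq_mult_ideal_module[OF J] by blast
    qed
  qed
  then show ?case using snoc by simp
qed

lemma weakly_regular_iff_seq_mult:
  assumes J: "ring_mod.subspace (J :: 'a::comm_ring_1 set)"
  shows "ring_mod.weakly_regular fs J {0} \<longleftrightarrow>
    (\<forall>k<length fs. \<forall>x\<in>J. fs ! k * x \<in> seq_mult (ideal_module \<R> J) (take k fs) \<longrightarrow>
       x \<in> seq_mult (ideal_module \<R> J) (take k fs))"
  unfolding ring_mod.weakly_regular_iff seq_mult_eq_foldl[OF J] ..

text \<open>The inclusion of the ring as the component of the empty index set, that is, as \<open>G\<^sub>0\<close>.\<close>

definition vertex_embedding :: "'a::zero \<Rightarrow> nat set \<Rightarrow> 'a"
  where "vertex_embedding x U = (if U = {} then x else 0)"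

lemma vertex_embedding_inj: "vertex_embedding x = vertex_embedding y \<longleftrightarrow> x = y"
proof
  assume "vertex_embedding x = vertex_embedding y"
  then have "vertex_embedding x {} = vertex_embedding y {}" by (rule arg_cong)
  then show "x = y" by (simp add: vertex_embedding_def)
qed simp

lemma weakly_regular_vertex_embedding:
  "fun_mod.weakly_regular fs (vertex_embedding ` M) (vertex_embedding ` N) \<longleftrightarrow>
    ring_mod.weakly_regular fs M (N :: 'a::comm_ring_1 set)"
proof (induction fs arbitrary: N)
  case (Cons f fs)
  have scale: "(\<lambda>U. f * vertex_embedding x U) = vertex_embedding (f * x)" for x
    by (auto simp: vertex_embedding_def)
  have add: "vertex_embedding x + vertex_embedding y = vertex_embedding (x + y)" for x y :: 'a
    by (auto simp: vertex_embedding_def fun_eq_iff)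
  have mem: "vertex_embedding x \<in> vertex_embedding ` N \<longleftrightarrow> x \<in> N" for x
    by (rule inj_image_mem_iff, rule injI) (simp only: vertex_embedding_inj)
  have "fun_mod.add_multiples (vertex_embedding ` N) f (vertex_embedding ` M) =
      vertex_embedding ` ring_mod.add_multiples N f M"
  proof
    show "fun_mod.add_multiples (vertex_embedding ` N) f (vertex_embedding ` M) \<subseteq>
        vertex_embedding ` ring_mod.add_multiples N f M"
    proof
      fix g assume "g \<in> fun_mod.add_multiples (vertex_embedding ` N) f (vertex_embedding ` M)"
      then obtain n m where "n \<in> N" "m \<in> M" "g = vertex_embedding n + (\<lambda>U. f * vertex_embedding m U)"
        unfolding fun_mod.add_multiples_def by blast
      then show "g \<in> vertex_embedding ` ring_mod.add_multiples N f M"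
        unfolding scale add by (auto intro: ring_mod.add_multiplesI)
    qed
    show "vertex_embedding ` ring_mod.add_multiples N f M \<subseteq>
        fun_mod.add_multiples (vertex_embedding ` N) f (vertex_embedding ` M)"
    proof
      fix g assume "g \<in> vertex_embedding ` ring_mod.add_multiples N f M"
      then obtain n m where nm: "n \<in> N" "m \<in> M" "g = vertex_embedding (n + f * m)"
        unfolding ring_mod.add_multiples_def by blast
      have "vertex_embedding n + (\<lambda>U. f * vertex_embedding m U)
          \<in> fun_mod.add_multiples (vertex_embedding ` N) f (vertex_embedding ` M)"
        using nm by (intro fun_mod.add_multiplesI) auto
      then show "g \<in> fun_mod.add_multiples (vertex_embedding ` N) f (vertex_embedding ` M)"
        unfolding scale add nm(3) .
    qed
  qed
  then show ?case
    by (simp only: fun_mod.weakly_regular.simps ring_mod.weakly_regular.simps Cons.IH ball_simps scale mem)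
qed simp

lemma index_sets_0: "index_sets s 0 = {{}}"
  by (auto simp: index_sets_def dest: finite_subset)

lemma lifted_cochains_0:
  "lifted_cochains s 0 = (range vertex_embedding :: (nat set \<Rightarrow> 'a::comm_ring_1) set)"
proof
  show "lifted_cochains s 0 \<subseteq> (range vertex_embedding :: (nat set \<Rightarrow> 'a) set)"
  proof
    fix g :: "nat set \<Rightarrow> 'a" assume "g \<in> lifted_cochains s 0"
    then have "g U = 0" if "U \<noteq> {}" for U using that by (auto simp: lifted_cochains_def index_sets_0)
    then have "g = vertex_embedding (g {})"
      by (intro ext) (simp add: vertex_embedding_def)
    then show "g \<in> range vertex_embedding" by blast
  qed
  show "(range vertex_embedding :: (nat set \<Rightarrow> 'a) set) \<subseteq> lifted_cochains s 0"
    by (auto simp: lifted_cochains_def index_sets_0 vertex_embedding_def split: if_splits)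
qed

lemma zero_cochains_0: "zero_cochains s 0 (family_ideal G) = vertex_embedding ` {0}"
proof -
  have "family_ideal G {} = {0 :: ('a, 'b) mpoly}"
    by (auto simp: family_ideal_def power_ideal_def supported_def power_exponents_def)
  moreover have "vertex_embedding x {} = x" for x :: "('a, 'b) mpoly" by (simp add: vertex_embedding_def)
  ultimately show ?thesis
    unfolding zero_cochains_def lifted_cochains_0 index_sets_0 by auto
qed

lemma incidence_diff_vertex_embedding:
  "incidence_diff s (vertex_embedding x) V = (if \<exists>j\<in>{1..s}. V = {j} then x else 0)"
proof (cases "\<exists>j\<in>{1..s}. V = {j}")
  case True
  then obtain j where j: "j \<in> {1..s}" "V = {j}" by blast
  have "{i \<in> {j}. i < j} = {}" by auto
  then have "koszul_sign j {j} = (1 :: 'a)" by (simp only: koszul_sign_def card.empty power_0)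
  then show ?thesis using j by (simp add: incidence_diff_def ring_mod.koszul_diff_def vertex_embedding_def)
next
  case False
  have "vertex_embedding x (V - {k}) = 0" if "V \<subseteq> {1..s}" "k \<in> V" for k
  proof -
    have "V - {k} \<noteq> {}" using that False by blast
    then show ?thesis by (simp add: vertex_embedding_def)
  qed
  then show ?thesis using False by (auto simp: incidence_diff_def ring_mod.koszul_diff_def)
qed

lemma cocycles_0:
  "cocycles s 0 (family_ideal G) = vertex_embedding ` (\<Inter>j\<in>{1..s}. power_ideal (G j))"
proof -
  have single: "{j} \<in> index_sets s (Suc 0)" if "j \<in> {1..s}" for j
    using that by (auto simp: index_sets_def)
  have "incidence_diff s (vertex_embedding x) \<in> zero_cochains s (Suc 0) (family_ideal G) \<longleftrightarrow>
      (\<forall>j\<in>{1..s}. x \<in> power_ideal (G j))" for x :: "('a, 'b) mpoly"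
  proof
    assume *: "incidence_diff s (vertex_embedding x) \<in> zero_cochains s (Suc 0) (family_ideal G)"
    show "\<forall>j\<in>{1..s}. x \<in> power_ideal (G j)"
    proof
      fix j assume j: "j \<in> {1..s}"
      then have "incidence_diff s (vertex_embedding x) {j} \<in> family_ideal G {j}"
        using * single by (simp add: zero_cochains_def)
      moreover have "incidence_diff s (vertex_embedding x) {j} = x"
        using j unfolding incidence_diff_vertex_embedding by simp
      ultimately show "x \<in> power_ideal (G j)" by (simp add: family_ideal_def)
    qed
  next
    assume *: "\<forall>j\<in>{1..s}. x \<in> power_ideal (G j)"
    have L: "vertex_embedding x \<in> lifted_cochains s 0" by (simp add: lifted_cochains_0)
    have "incidence_diff s (vertex_embedding x) V \<in> family_ideal G V" for V
      using * ring_mod.subspace_0[OF subspace_family_ideal[of G V]]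
      unfolding incidence_diff_vertex_embedding by (auto simp: family_ideal_def)
    then show "incidence_diff s (vertex_embedding x) \<in> zero_cochains s (Suc 0) (family_ideal G)"
      using incidence_diff_lifted[OF L] by (simp add: zero_cochains_def)
  qed
  then show ?thesis unfolding cocycles_def lifted_cochains_0 by (auto simp: image_iff)
qed

text \<open>An element of least possible degree among all terms of elements of \<open>J\<close> cannot be in the product of
  \<open>J\<close> with the maximal ideal.\<close>

lemma seq_mult_proper:
  fixes J :: "('n::finite, 'k::field) mpoly set"
  assumes J: "ring_mod.subspace J" "p \<in> J" "p \<noteq> 0" and fs: "set fs \<subseteq> \<mm>"
  shows "seq_mult (ideal_module \<S> J) fs \<noteq> J"
proof -
  have "\<exists>d. \<exists>q\<in>J. \<exists>e\<in>keys q. total_degree e = d"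
    using J(2,3) by (metis ex_in_conv keys_eq_empty)
  then obtain d where d: "\<exists>q\<in>J. \<exists>e\<in>keys q. total_degree e = d"
    "\<And>d'. d' < d \<Longrightarrow> \<not> (\<exists>q\<in>J. \<exists>e\<in>keys q. total_degree e = d')"
    using exists_least_iff[of "\<lambda>d. \<exists>q\<in>J. \<exists>e\<in>keys q. total_degree e = d"] by blast
  have ge: "d \<le> total_degree e" if "q \<in> J" "e \<in> keys q" for q e
  proof (rule ccontr)
    assume "\<not> d \<le> total_degree e"
    then have "total_degree e < d" by simp
    with d(2) that show False by blast
  qed
  obtain q e where q: "q \<in> J" "e \<in> keys q" "total_degree e = d" using d(1) by blast
  have "q \<notin> seq_mult (ideal_module \<S> J) fs"
  proof
    assume "q \<in> seq_mult (ideal_module \<S> J) fs"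
    then obtain m where m: "q = (\<Sum>k<length fs. fs ! k * m k)" "\<forall>k<length fs. m k \<in> J"
      by (auto simp: seq_mult_ideal_module[OF J(1)])
    have "lookup (\<Sum>k<length fs. fs ! k * m k) e \<noteq> 0" using q(2) m(1) by (simp add: in_keys_iff)
    then have "(\<Sum>k<length fs. lookup (fs ! k * m k) e) \<noteq> 0" by (simp add: lookup_sum)
    then obtain k where k: "k \<in> {..<length fs}" "lookup (fs ! k * m k) e \<noteq> 0"
      by (rule sum.not_neutral_contains_not_neutral)
    then have "e \<in> keys (fs ! k * m k)" by (simp add: in_keys_iff)
    then obtain a b where ab: "e = a + b" "a \<in> keys (fs ! k)" "b \<in> keys (m k)"
      using keys_mult[of "fs ! k" "m k"] by blast
    have "fs ! k \<in> \<mm>" using fs k(1) by auto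
    then have "a \<noteq> 0" using ab(2) by (auto simp: max_ideal_eq in_keys_iff)
    then have "0 < total_degree a"
      by (auto simp: total_degree_def poly_mapping_eq_iff fun_eq_iff intro!: Nat.gr0I)
    moreover have "d \<le> total_degree b" using ge ab(3) m(2) k(1) by blast
    ultimately show False using q(3) by (simp add: ab(1) total_degree_add)
  qed
  then show ?thesis using q(1) by blast
qed

section \<open>The differential on residue classes\<close>

lemma finsum_cosets:
  assumes J: "ring_mod.subspace (J :: 'a::comm_ring_1 set)" and "finite A"
  shows "(\<Oplus>\<^bsub>\<R> Quot J\<^esub>a\<in>A. J +>\<^bsub>\<R>\<^esub> f a) =
    J +>\<^bsub>\<R>\<^esub> (\<Sum>a\<in>A. f a)"
proof -
  have iJ: "ideal J (\<R> :: 'a ring)" using J by (simp add: ideal_iff_subspace)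
  interpret h: ring_hom_ring "\<R> :: 'a ring" "\<R> Quot J" "(+>\<^bsub>\<R>\<^esub>) J"
    by (rule ideal.rcos_ring_hom_ring[OF iJ])
  show ?thesis using \<open>finite A\<close>
  proof (induction A rule: finite_induct)
    case empty
    show ?case by (simp add: quot_simps(5)[OF J])
  next
    case (insert a A)
    have "(\<Oplus>\<^bsub>\<R> Quot J\<^esub>a\<in>insert a A. J +>\<^bsub>\<R>\<^esub> f a) =
        (J +>\<^bsub>\<R>\<^esub> f a) \<oplus>\<^bsub>\<R> Quot J\<^esub>
        (\<Oplus>\<^bsub>\<R> Quot J\<^esub>a\<in>A. J +>\<^bsub>\<R>\<^esub> f a)"
      using insert.hyps by (intro h.S.finsum_insert) (auto simp: quot_simps(1)[OF J])
    then show ?case using insert by (simp add: quot_simps(3)[OF J])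
  qed
qed

lemma subspace_ideal_sum: "ring_mod.subspace (ideal_sum \<R> Q U :: 'a::comm_ring_1 set)"
  by (simp add: ideal_sum_def genideal_eq_span)

lemma ideal_sum_mono:
  "U \<subseteq> V \<Longrightarrow> ideal_sum \<R> Q U \<subseteq> (ideal_sum \<R> Q V :: 'a::comm_ring_1 set)"
  unfolding ideal_sum_def genideal_eq_span by (intro ring_mod.span_mono) blast

lemma set_add_coset:
  assumes "ring_mod.subspace (J :: 'a::comm_ring_1 set)" "ring_mod.subspace J'" "J \<subseteq> J'"
  shows "J' <+>\<^bsub>\<R>\<^esub> (J +>\<^bsub>\<R>\<^esub> a) = J' +>\<^bsub>\<R>\<^esub> a"
proof
  show "J' <+>\<^bsub>\<R>\<^esub> (J +>\<^bsub>\<R>\<^esub> a) \<subseteq> J' +>\<^bsub>\<R>\<^esub> a"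
  proof
    fix x assume "x \<in> J' <+>\<^bsub>\<R>\<^esub> (J +>\<^bsub>\<R>\<^esub> a)"
    then obtain j' j where "j' \<in> J'" "j \<in> J" "x = j' + (j + a)" by (auto simp: set_add_def' coset_eq)
    moreover from this have "j' + j \<in> J'" using assms by (intro ring_mod.subspace_add[OF assms(2)]) auto
    ultimately show "x \<in> J' +>\<^bsub>\<R>\<^esub> a" by (simp add: coset_mem add.assoc[symmetric])
  qed
  show "J' +>\<^bsub>\<R>\<^esub> a \<subseteq> J' <+>\<^bsub>\<R>\<^esub> (J +>\<^bsub>\<R>\<^esub> a)"
  proof
    fix x assume "x \<in> J' +>\<^bsub>\<R>\<^esub> a"
    then obtain j' where "j' \<in> J'" "x = j' + a" by (auto simp: coset_eq)
    moreover have "a \<in> J +>\<^bsub>\<R>\<^esub> a"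
      using ring_mod.subspace_0[OF assms(1)] by (simp add: coset_mem)
    ultimately show "x \<in> J' <+>\<^bsub>\<R>\<^esub> (J +>\<^bsub>\<R>\<^esub> a)"
      by (auto simp: set_add_def')
  qed
qed

lemma complex_component_coset:
  "complex_component Q U V (ideal_sum \<S> Q U +>\<^bsub>\<S>\<^esub> a) =
    ideal_sum \<S> Q V +>\<^bsub>\<S>\<^esub> (if U \<subseteq> V then (- 1) ^ card {j \<in> U. j < the_elem (V - U)} * a else 0)"
proof -
  let ?J = "ideal_sum \<S> Q V"
  have J: "ring_mod.subspace ?J" by (rule subspace_ideal_sum)
  have iJ: "ideal ?J \<S>" using J by (simp add: ideal_iff_subspace)
  interpret h: ring_hom_ring "\<S> :: ('a, 'b) mpoly ring" "\<S> Quot ?J" "(+>\<^bsub>\<S>\<^esub>) ?J"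
    by (rule ideal.rcos_ring_hom_ring[OF iJ])
  have "\<ominus>\<^bsub>\<S> Quot ?J\<^esub> \<one>\<^bsub>\<S> Quot ?J\<^esub> = ?J +>\<^bsub>\<S>\<^esub> (- 1)"
    using h.hom_a_inv[of 1] by (simp add: quot_simps(4)[OF J])
  then have "(\<ominus>\<^bsub>\<S> Quot ?J\<^esub> \<one>\<^bsub>\<S> Quot ?J\<^esub>) [^]\<^bsub>\<S> Quot ?J\<^esub> m = ?J +>\<^bsub>\<S>\<^esub> ((- 1) ^ m)" for m :: nat
    using h.hom_nat_pow[of "- 1" m] by simp
  then show ?thesis
    unfolding complex_component_def quot_ring_def Let_def
    using set_add_coset[OF subspace_ideal_sum[of Q U] J ideal_sum_mono]
    by (simp add: quot_simps(2,5)[OF J])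
qed

lemma complex_diff_cosets:
  fixes h :: "nat set \<Rightarrow> ('n::finite, 'k::field) mpoly"
  assumes g: "\<And>U. U \<in> index_sets s i \<Longrightarrow> g U = ideal_sum \<S> Q U +>\<^bsub>\<S>\<^esub> h U"
    and h: "h \<in> lifted_cochains s i" and V: "V \<in> index_sets s (i + 1)"
  shows "complex_diff s Q i g V = ideal_sum \<S> Q V +>\<^bsub>\<S>\<^esub> incidence_diff s h V"
proof -
  let ?a = "\<lambda>U. if U \<subseteq> V then (- 1) ^ card {j \<in> U. j < the_elem (V - U)} * h U else 0"
  have fin: "finite (index_sets s i)" unfolding index_sets_def by simp
  have V': "V \<subseteq> {1..s}" "card V = Suc i" "finite V"
    using V finite_subset[of V "{1..s}"] by (auto simp: index_sets_def)
  interpret Q: ring "\<S> Quot (ideal_sum \<S> Q V)"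
    using subspace_ideal_sum[of Q V] by (intro ideal.quotient_is_ring) (simp add: ideal_iff_subspace)
  have "complex_diff s Q i g V =
      (\<Oplus>\<^bsub>\<S> Quot (ideal_sum \<S> Q V)\<^esub>U\<in>index_sets s i. complex_component Q U V (g U))"
    using V by (simp add: complex_diff_def quot_ring_def)
  also have "\<dots> = (\<Oplus>\<^bsub>\<S> Quot (ideal_sum \<S> Q V)\<^esub>U\<in>index_sets s i. ideal_sum \<S> Q V +>\<^bsub>\<S>\<^esub> ?a U)"
    by (intro Q.finsum_cong' refl)
      (auto simp: g complex_component_coset quot_simps(1)[OF subspace_ideal_sum])
  also have "\<dots> = ideal_sum \<S> Q V +>\<^bsub>\<S>\<^esub> (\<Sum>U\<in>index_sets s i. ?a U)"
    by (rule finsum_cosets[OF subspace_ideal_sum fin])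
  also have "(\<Sum>U\<in>index_sets s i. ?a U) = (\<Sum>U\<in>(\<lambda>k. V - {k}) ` V. ?a U)"
  proof (rule sum.mono_neutral_right[OF fin])
    show "(\<lambda>k. V - {k}) ` V \<subseteq> index_sets s i"
      using V' by (auto simp: index_sets_def)
    show "\<forall>U\<in>index_sets s i - (\<lambda>k. V - {k}) ` V. ?a U = 0"
    proof
      fix U assume U: "U \<in> index_sets s i - (\<lambda>k. V - {k}) ` V"
      have "\<not> U \<subseteq> V"
      proof
        assume "U \<subseteq> V"
        then have "card (V - U) = 1" using U V' by (simp add: card_Diff_subset finite_subset index_sets_def)
        then obtain k where "V - U = {k}" by (auto simp: card_1_singleton_iff)
        then have "U = V - {k}" "k \<in> V" using \<open>U \<subseteq> V\<close> by blast+
        then show False using U by blast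
      qed
      then show "?a U = 0" by simp
    qed
  qed
  also have "\<dots> = (\<Sum>k\<in>V. ?a (V - {k}))"
    by (subst sum.reindex) (auto simp: inj_on_def)
  also have "\<dots> = incidence_diff s h V"
    unfolding incidence_diff_def ring_mod.koszul_diff_def
  proof (simp only: V' if_True, intro sum.cong refl)
    fix k assume k: "k \<in> V"
    have "V - (V - {k}) = {k}" using k by blast
    then have elem: "the_elem (V - (V - {k})) = k" by simp
    have below: "{j \<in> V - {k}. j < k} = {j \<in> V. j < k}" by auto
    show "?a (V - {k}) = koszul_sign k V * 1 * h (V - {k})"
      by (simp only: Diff_subset if_True elem below koszul_sign_def mult_1_right)
  qed
  finally show ?thesis .
qed

lemma carrier_complex_module:
  "carrier (complex_module s Q i) =
    (\<Pi>\<^sub>E U\<in>index_sets s i. range (\<lambda>a. ideal_sum \<S> Q U +>\<^bsub>\<S>\<^esub> a))"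
  by (simp add: complex_module_def direct_sum_def quot_module_def quot_simps(1)[OF subspace_ideal_sum])

lemma complex_module_zero:
  "\<zero>\<^bsub>complex_module s Q i\<^esub> = (\<lambda>U\<in>index_sets s i. ideal_sum \<S> Q U +>\<^bsub>\<S>\<^esub> 0)"
  by (simp add: complex_module_def direct_sum_def quot_module_def quot_simps(5)[OF subspace_ideal_sum])

definition residue_classes ::
    "nat \<Rightarrow> (nat \<Rightarrow> ('n::finite, 'k::field) mpoly set) \<Rightarrow> nat \<Rightarrow> (nat set \<Rightarrow> ('n, 'k) mpoly) \<Rightarrow>
      (nat set \<Rightarrow> ('n, 'k) mpoly set)"
  where "residue_classes s Q i h = (\<lambda>U\<in>index_sets s i. ideal_sum \<S> Q U +>\<^bsub>\<S>\<^esub> h U)"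

lemma complex_module_lift:
  assumes "g \<in> carrier (complex_module s Q i)"
  obtains h where "h \<in> lifted_cochains s i" "g = residue_classes s Q i h"
proof -
  have "\<forall>U\<in>index_sets s i. \<exists>a. g U = ideal_sum \<S> Q U +>\<^bsub>\<S>\<^esub> a"
    using assms unfolding carrier_complex_module by (auto simp: PiE_def Pi_def)
  then obtain a where a: "\<And>U. U \<in> index_sets s i \<Longrightarrow> g U = ideal_sum \<S> Q U +>\<^bsub>\<S>\<^esub> a U" by metis
  define h where "h U = (if U \<in> index_sets s i then a U else 0)" for U
  have "h \<in> lifted_cochains s i" by (simp add: lifted_cochains_def h_def)
  moreover have "g = residue_classes s Q i h"
    using assms a unfolding carrier_complex_module
    by (auto simp: residue_classes_def h_def PiE_def extensional_def fun_eq_iff)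
  ultimately show ?thesis using that by blast
qed

lemma residue_classes_carrier: "residue_classes s Q i h \<in> carrier (complex_module s Q i)"
  by (auto simp: residue_classes_def carrier_complex_module)

lemma complex_diff_residue_classes:
  assumes "h \<in> lifted_cochains s i"
  shows "complex_diff s Q i (residue_classes s Q i h) = residue_classes s Q (i + 1) (incidence_diff s h)"
proof
  fix V
  show "complex_diff s Q i (residue_classes s Q i h) V = residue_classes s Q (i + 1) (incidence_diff s h) V"
  proof (cases "V \<in> index_sets s (i + 1)")
    case True
    then show ?thesis
      using complex_diff_cosets[OF _ assms True, of "residue_classes s Q i h" Q] by (simp add: residue_classes_def)
  next
    case False
    then show ?thesis by (simp add: residue_classes_def complex_diff_def)
  qed
qed

lemma residue_classes_eq_zero_iff:
  "residue_classes s Q i h = \<zero>\<^bsub>complex_module s Q i\<^esub> \<longleftrightarrow>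
    (\<forall>U\<in>index_sets s i. h U \<in> ideal_sum \<S> Q U)"
proof -
  have "residue_classes s Q i h = \<zero>\<^bsub>complex_module s Q i\<^esub> \<longleftrightarrow>
    (\<forall>U\<in>index_sets s i. ideal_sum \<S> Q U +>\<^bsub>\<S>\<^esub> h U = ideal_sum \<S> Q U +>\<^bsub>\<S>\<^esub> 0)"
    unfolding residue_classes_def complex_module_zero
    by (metis (no_types, lifting) restrict_apply' restrict_ext)
  then show ?thesis by (simp add: coset_eq_iff[OF subspace_ideal_sum])
qed

lemma residue_classes_summand_iff:
  "residue_classes s Q i h \<in> complex_summand s Q i A \<longleftrightarrow>
    (\<forall>U\<in>index_sets s i - A. h U \<in> ideal_sum \<S> Q U)"
proof -
  have "residue_classes s Q i h \<in> complex_summand s Q i A \<longleftrightarrow>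
    (\<forall>U\<in>index_sets s i - A. residue_classes s Q i h U = \<zero>\<^bsub>quot_ring Q U\<^esub>)"
    by (simp add: complex_summand_def residue_classes_carrier)
  also have "\<dots> \<longleftrightarrow> (\<forall>U\<in>index_sets s i - A. h U \<in> ideal_sum \<S> Q U)"
    by (simp add: residue_classes_def quot_ring_def quot_simps(5)[OF subspace_ideal_sum]
        coset_eq_iff[OF subspace_ideal_sum])
  finally show ?thesis .
qed

text \<open>Condition (a) in terms of representatives.  The intersection always contains zero, so that it differs
  from the zero module precisely when it has a nonzero element.\<close>

lemma image_meets_summand_iff:
  fixes Q :: "nat \<Rightarrow> ('n::finite, 'k::field) mpoly set"
  shows "complex_diff s Q i ` carrier (complex_module s Q i) \<inter> complex_summand s Q (i + 1) A
      \<noteq> {\<zero>\<^bsub>complex_module s Q (i + 1)\<^esub>} \<longleftrightarrow>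
    (\<exists>h\<in>lifted_cochains s i.
       (\<forall>V\<in>index_sets s (i + 1) - A. incidence_diff s h V \<in> ideal_sum \<S> Q V) \<and>
       (\<exists>V\<in>index_sets s (i + 1). incidence_diff s h V \<notin> ideal_sum \<S> Q V))"
proof -
  let ?W = "complex_summand s Q (i + 1) A" and ?z = "\<zero>\<^bsub>complex_module s Q (i + 1)\<^esub>"
  have image: "complex_diff s Q i ` carrier (complex_module s Q i) =
      (\<lambda>h. residue_classes s Q (i + 1) (incidence_diff s h)) ` lifted_cochains s i"
  proof
    show "complex_diff s Q i ` carrier (complex_module s Q i) \<subseteq>
        (\<lambda>h. residue_classes s Q (i + 1) (incidence_diff s h)) ` lifted_cochains s i"
    proof
      fix z assume "z \<in> complex_diff s Q i ` carrier (complex_module s Q i)"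
      then obtain g where g: "g \<in> carrier (complex_module s Q i)" "z = complex_diff s Q i g" by blast
      obtain h where "h \<in> lifted_cochains s i" "g = residue_classes s Q i h"
        using complex_module_lift[OF g(1)] by blast
      then show "z \<in> (\<lambda>h. residue_classes s Q (i + 1) (incidence_diff s h)) ` lifted_cochains s i"
        using g(2) complex_diff_residue_classes by blast
    qed
    show "(\<lambda>h. residue_classes s Q (i + 1) (incidence_diff s h)) ` lifted_cochains s i \<subseteq>
        complex_diff s Q i ` carrier (complex_module s Q i)"
    proof
      fix z assume "z \<in> (\<lambda>h. residue_classes s Q (i + 1) (incidence_diff s h)) ` lifted_cochains s i"
      then obtain h where "h \<in> lifted_cochains s i" "z = residue_classes s Q (i + 1) (incidence_diff s h)" by blast
      then have "z = complex_diff s Q i (residue_classes s Q i h)" using complex_diff_residue_classes by metis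
      then show "z \<in> complex_diff s Q i ` carrier (complex_module s Q i)"
        using residue_classes_carrier by blast
    qed
  qed
  have zero: "?z \<in> complex_diff s Q i ` carrier (complex_module s Q i) \<inter> ?W"
  proof -
    have "incidence_diff s (0 :: nat set \<Rightarrow> ('n, 'k) mpoly) = 0"
      by (rule ext) (simp add: incidence_diff_def ring_mod.koszul_diff_def)
    moreover have "(0 :: nat set \<Rightarrow> ('n, 'k) mpoly) \<in> lifted_cochains s i"
      by (rule fun_mod.subspace_0[OF subspace_lifted_cochains])
    moreover have "residue_classes s Q (i + 1) 0 = ?z"
      using ring_mod.subspace_0[OF subspace_ideal_sum[of Q]] by (simp add: residue_classes_eq_zero_iff)
    moreover have "residue_classes s Q (i + 1) 0 \<in> ?W"
      using ring_mod.subspace_0[OF subspace_ideal_sum[of Q]] by (simp add: residue_classes_summand_iff)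
    ultimately show ?thesis unfolding image by (metis (no_types, lifting) IntI image_eqI)
  qed
  have "complex_diff s Q i ` carrier (complex_module s Q i) \<inter> ?W \<noteq> {?z} \<longleftrightarrow>
      (\<exists>z\<in>complex_diff s Q i ` carrier (complex_module s Q i). z \<in> ?W \<and> z \<noteq> ?z)"
    using zero by blast
  also have "\<dots> \<longleftrightarrow> (\<exists>h\<in>lifted_cochains s i.
      residue_classes s Q (i + 1) (incidence_diff s h) \<in> ?W \<and>
      residue_classes s Q (i + 1) (incidence_diff s h) \<noteq> ?z)"
    unfolding image by blast
  finally show ?thesis
    unfolding residue_classes_summand_iff residue_classes_eq_zero_iff by blast
qed

section \<open>Bounds for the depth\<close>

lemma (in comm_module) koszul_vanishes_antimono:
  "koszul_vanishes A u r' M N \<Longrightarrow> r \<le> r' \<Longrightarrow> koszul_vanishes A u r M N"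
  unfolding koszul_vanishes_def by (meson less_le_trans of_nat_le_iff)

lemma elem_sym_regular_lifted_cochains:
  fixes G :: "nat \<Rightarrow> ('n::finite \<times> nat) set"
  assumes N: "0 < N" "\<And>j i a. j \<in> {1..s} \<Longrightarrow> (i, a) \<in> G j \<Longrightarrow> a \<le> N"
    and free: "\<And>U. U \<in> index_sets s i \<Longrightarrow> d \<le> card (free_vars (\<Union>j\<in>U. G j))"
  shows "fun_mod.weakly_regular (map (elem_sym N) [1..<Suc d]) (lifted_cochains s i)
    (zero_cochains s i (family_ideal G :: _ \<Rightarrow> ('n, 'k::field) mpoly set))"
proof (rule weakly_regular_lifted_cochains)
  fix U assume U: "U \<in> index_sets s i"
  show "ring_mod.weakly_regular (map (elem_sym N) [1..<Suc d]) UNIV (family_ideal G U :: ('n, 'k) mpoly set)"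
    unfolding family_ideal_def
  proof (rule elem_sym_weakly_regular[OF N(1) _ free[OF U]])
    fix x a assume "(x, a) \<in> (\<Union>j\<in>U. G j)"
    then obtain j where "j \<in> U" "(x, a) \<in> G j" by blast
    moreover from this have "j \<in> {1..s}" using U by (auto simp: index_sets_def)
    ultimately show "a \<le> N" using N(2) by blast
  qed
qed

text \<open>Descending induction on \<open>i\<close>, starting from the empty sequence at \<open>i = r\<close>: the depth lemma for
  \<open>0 \<rightarrow> Z\<^sub>i \<rightarrow> G\<^sub>i \<rightarrow> Z\<^sub>i\<^sub>+\<^sub>1 \<rightarrow> 0\<close>.\<close>

lemma elem_sym_regular_cocycles:
  fixes G :: "nat \<Rightarrow> ('n::finite \<times> nat) set"
  assumes N: "0 < N" "\<And>j i a. j \<in> {1..s} \<Longrightarrow> (i, a) \<in> G j \<Longrightarrow> a \<le> N"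
    and free: "\<And>i U. i \<le> r \<Longrightarrow> U \<in> index_sets s i \<Longrightarrow> r - i \<le> card (free_vars (\<Union>j\<in>U. G j))"
    and "i \<le> r"
  shows "fun_mod.weakly_regular (map (elem_sym N) [1..<Suc (r - i)]) (cocycles s i (family_ideal G))
    (zero_cochains s i (family_ideal G :: _ \<Rightarrow> ('n, 'k::field) mpoly set))"
  using \<open>i \<le> r\<close>
proof (induction i rule: inc_induct)
  case base
  show ?case by simp
next
  case (step i)
  let ?fs = "\<lambda>d. map (elem_sym N) [1..<Suc d] :: ('n, 'k) mpoly list"
  let ?P = "lifted_cochains s i :: (nat set \<Rightarrow> ('n, 'k) mpoly) set"
    and ?Z = "cocycles s i (family_ideal G) :: (nat set \<Rightarrow> ('n, 'k) mpoly) set"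
    and ?N = "zero_cochains s i (family_ideal G) :: (nat set \<Rightarrow> ('n, 'k) mpoly) set"
  have "fun_mod.weakly_regular (?fs (r - i)) ?P ?N"
  proof (rule elem_sym_regular_lifted_cochains[OF N(1)])
    show "a \<le> N" if "j \<in> {1..s}" "(x, a) \<in> G j" for j x a using that by (rule N(2))
    show "r - i \<le> card (free_vars (\<Union>j\<in>U. G j))" if "U \<in> index_sets s i" for U
      using free[OF _ that] step.hyps by simp
  qed
  moreover have "fun_mod.weakly_regular (butlast (?fs (r - i))) ?P ?Z"
  proof -
    have "r - i = Suc (r - Suc i)" using step.hyps by simp
    then have "butlast (?fs (r - i)) = ?fs (r - Suc i)" by (simp add: map_butlast)
    then show ?thesis
      using step.IH fun_mod.weakly_regular_iso[OF incidence_diff_iso subspace_lifted_cochains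
          subspace_cocycles subspace_cocycles subspace_zero_cochains zero_cochains_subset_cocycles]
        subspace_family_ideal by metis
  qed
  ultimately show ?case
    by (rule fun_mod.weakly_regular_kernel)
      (intro subspace_lifted_cochains subspace_zero_cochains subspace_cocycles subspace_family_ideal
        zero_cochains_subset_cocycles cocycles_subset)+
qed

text \<open>Ascending induction shows that the Koszul cohomology of \<open>Z\<^sub>i\<close> vanishes in degrees below
  \<open>r + 1 - i\<close>: it does so for \<open>Z\<^sub>0\<close> by the long sequence, and for \<open>G\<^sub>i\<close> in degrees below \<open>r - i\<close> by the
  elementary symmetric polynomials.  At \<open>i = r\<close> the degree \<open>0\<close> remains.\<close>

lemma long_regular_sequence_excludes_socle:
  fixes G :: "nat \<Rightarrow> ('n::finite \<times> nat) set" and gs :: "('n, 'k::field) mpoly list"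
    and z :: "nat set \<Rightarrow> ('n, 'k) mpoly"
  assumes N: "0 < N" "\<And>j i a. j \<in> {1..s} \<Longrightarrow> (i, a) \<in> G j \<Longrightarrow> a \<le> N"
    and free: "\<And>i U. i \<le> r \<Longrightarrow> U \<in> index_sets s i \<Longrightarrow> r - i \<le> card (free_vars (\<Union>j\<in>U. G j))"
    and gs: "fun_mod.weakly_regular gs (cocycles s 0 (family_ideal G)) (zero_cochains s 0 (family_ideal G))"
      "set gs \<subseteq> \<mm>" "r < length gs"
    and z: "z \<in> cocycles s r (family_ideal G)"
      "\<And>x. (\<lambda>U. var x * z U) \<in> zero_cochains s r (family_ideal G)"
  shows "z \<in> zero_cochains s r (family_ideal G)"
proof -
  let ?P = "\<lambda>i. lifted_cochains s i :: (nat set \<Rightarrow> ('n, 'k) mpoly) set"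
    and ?Z = "\<lambda>i. cocycles s i (family_ideal G) :: (nat set \<Rightarrow> ('n, 'k) mpoly) set"
    and ?N = "\<lambda>i. zero_cochains s i (family_ideal G) :: (nat set \<Rightarrow> ('n, 'k) mpoly) set"
  have P: "fun_mod.subspace (?P i)" and Z: "fun_mod.subspace (?Z i)" and N0: "fun_mod.subspace (?N i)" for i
    by (intro subspace_lifted_cochains subspace_cocycles subspace_zero_cochains subspace_family_ideal)+
  have NZ: "?N i \<subseteq> ?Z i" and ZP: "?Z i \<subseteq> ?P i" for i
    by (rule zero_cochains_subset_cocycles, rule cocycles_subset)
  obtain f :: "nat \<Rightarrow> 'n" where f: "bij_betw f {0..<card (UNIV :: 'n set)} UNIV"
    using ex_bij_betw_nat_finite[of "UNIV :: 'n set"] by auto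
  define A where "A = {0..<card (UNIV :: 'n set)}"
  define u :: "nat \<Rightarrow> ('n, 'k) mpoly" where "u k = var (f k)" for k
  have fin: "finite A" by (simp add: A_def)
  have in_m: "\<exists>a. g = (\<Sum>k\<in>A. a k * u k)" if g: "g \<in> \<mm>" for g
  proof -
    obtain a where "g = (\<Sum>i\<in>UNIV. a i * var i)" using g unfolding in_max_ideal_iff by blast
    also have "\<dots> = (\<Sum>k\<in>A. a (f k) * u k)"
      unfolding A_def u_def by (rule sum.reindex_bij_betw[OF f, symmetric])
    finally show ?thesis by (rule exI[of _ "\<lambda>k. a (f k)"])
  qed
  have "fun_mod.koszul_vanishes A u (Suc r - i) (?Z i) (?N i)" if "i \<le> r" for i
    using that
  proof (induction i)
    case 0
    have "fun_mod.koszul_vanishes A u (length gs) (?Z 0) (?N 0)"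
      using gs(2) in_m by (intro fun_mod.weakly_regular_imp_koszul_vanishes[OF gs(1) _ fin Z N0 NZ]) blast
    then show ?case by (rule fun_mod.koszul_vanishes_antimono) (use gs(3) in simp)
  next
    case (Suc i)
    let ?fs = "map (elem_sym N) [1..<Suc (r - i)] :: ('n, 'k) mpoly list"
    have eq: "Suc r - i = Suc (r - i)" using Suc.prems by simp
    have reg: "fun_mod.weakly_regular ?fs (?P i) (?N i)"
    proof (rule elem_sym_regular_lifted_cochains[OF N(1)])
      show "a \<le> N" if "j \<in> {1..s}" "(x, a) \<in> G j" for j x a using that by (rule N(2))
      show "r - i \<le> card (free_vars (\<Union>j\<in>U. G j))" if "U \<in> index_sets s i" for U
        using free[OF _ that] Suc.prems by simp
    qed
    have "set ?fs \<subseteq> \<mm>" by (auto intro!: elem_sym_in_max_ideal[OF N(1)])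
    then have "fun_mod.koszul_vanishes A u (length ?fs) (?P i) (?N i)"
      using in_m order_trans[OF NZ ZP]
      by (intro fun_mod.weakly_regular_imp_koszul_vanishes[OF reg _ fin P N0]) blast+
    moreover have "length ?fs = r - i" by (simp only: length_map length_upt diff_Suc_Suc diff_zero One_nat_def)
    ultimately have "fun_mod.koszul_vanishes A u (r - i) (?P i) (?N i)" by (simp only:)
    moreover have "fun_mod.koszul_vanishes A u (Suc (r - i)) (?Z i) (?N i)"
      using Suc.IH Suc.prems eq by simp
    ultimately have "fun_mod.koszul_vanishes A u (r - i) (?P i) (?Z i)"
      using fun_mod.koszul_vanishes_quotient[OF _ _ fin P Z N0 NZ ZP] by blast
    from fun_mod.koszul_vanishes_iso[OF incidence_diff_iso fin P Z N0 this]
    show ?case by simp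
  qed
  from this[of r] have "fun_mod.koszul_vanishes A u (Suc 0) (?Z r) (?N r)" by simp
  then show ?thesis
    by (rule fun_mod.koszul_vanishes_socle[OF _ Z fin z(1)])
      (use z(2) fun_mod.subspace_0[OF N0] in \<open>auto simp: u_def\<close>)
qed

lemma free_vars_UN: "free_vars (\<Union>j\<in>U. G j) = {x. \<forall>j\<in>U. \<forall>a. (x, a) \<notin> G j}"
  by (auto simp: free_vars_def)

text \<open>Only finitely many monomials do not kill \<open>y\<close>, as high powers of each variable vanish on every
  component in which \<open>y\<close> is not zero.  A monomial of greatest degree among them takes \<open>y\<close> to the socle.\<close>

lemma socle_element:
  fixes G :: "nat \<Rightarrow> ('n::finite \<times> nat) set" and y :: "nat set \<Rightarrow> ('n, 'k::field) mpoly"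
  assumes N: "\<And>j i a. j \<in> {1..s} \<Longrightarrow> (i, a) \<in> G j \<Longrightarrow> a \<le> N"
    and y: "y \<in> cocycles s r (family_ideal G)" "y \<notin> zero_cochains s r (family_ideal G)"
    and torsion: "\<And>U. U \<in> index_sets s r \<Longrightarrow> y U \<in> family_ideal G U \<or> free_vars (\<Union>j\<in>U. G j) = {}"
  shows "\<exists>z\<in>(cocycles s r (family_ideal G) :: (nat set \<Rightarrow> ('n, 'k) mpoly) set). z \<notin> zero_cochains s r (family_ideal G) \<and>
    (\<forall>x. (\<lambda>U. var x * z U) \<in> zero_cochains s r (family_ideal G))"
proof -
  let ?N = "zero_cochains s r (family_ideal G) :: (nat set \<Rightarrow> ('n, 'k) mpoly) set"
  define S where "S = {c. (\<lambda>U. monomial c * y U) \<notin> ?N}"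
  have yL: "y \<in> lifted_cochains s r" using y(1) by (simp add: cocycles_def)
  have "S \<subseteq> exponent_box N"
  proof
    fix c assume c: "c \<in> S"
    show "c \<in> exponent_box N"
    proof (rule ccontr)
      assume "c \<notin> exponent_box N"
      then obtain x where x: "N < lookup c x" by (auto simp: exponent_box_def not_le)
      have "monomial c * y U \<in> family_ideal G U" if U: "U \<in> index_sets s r" for U
      proof (cases "y U \<in> family_ideal G U")
        case True
        then show ?thesis by (rule ring_mod.subspace_scale[OF subspace_family_ideal])
      next
        case False
        then have "free_vars (\<Union>j\<in>U. G j) = {}" using torsion[OF U] by blast
        then obtain a j where j: "j \<in> U" "(x, a) \<in> G j" unfolding free_vars_UN by blast
        moreover have "j \<in> {1..s}" using U j(1) by (auto simp: index_sets_def)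
        ultimately have "a \<le> lookup c x" using N[of j x a] x by simp
        then have "(monomial c :: ('n, 'k) mpoly) \<in> family_ideal G U"
          using j by (auto simp: family_ideal_def power_ideal_def power_exponents_def)
        then have "y U * monomial c \<in> family_ideal G U"
          by (rule ring_mod.subspace_scale[OF subspace_family_ideal])
        then show ?thesis by (simp only: mult.commute)
      qed
      moreover have "(\<lambda>U. monomial c * y U) \<in> lifted_cochains s r"
        by (rule fun_mod.subspace_scale[OF subspace_lifted_cochains yL])
      ultimately show False using c by (simp add: S_def zero_cochains_def)
    qed
  qed
  then have fin: "finite S" using finite_exponent_box finite_subset by blast
  have "0 \<in> S" using y(2) by (simp add: S_def monomial_def)
  then have "Max (total_degree ` S) \<in> total_degree ` S" using fin by (intro Max_in) auto
  then obtain c where c: "c \<in> S" "total_degree c = Max (total_degree ` S)" by auto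
  let ?z = "\<lambda>U. monomial c * y U"
  have socle: "(\<lambda>U. var x * ?z U) \<in> ?N" for x
  proof (rule ccontr)
    assume neg: "(\<lambda>U. var x * ?z U) \<notin> ?N"
    have "var x * ?z U = monomial (single x 1 + c) * y U" for U
      by (simp add: var_def monomial_def mult_single flip: mult.assoc)
    then have "single x 1 + c \<in> S" using neg by (simp add: S_def)
    then have "total_degree (single x 1 + c) \<le> Max (total_degree ` S)" using fin by (intro Max_ge) auto
    then show False using c(2) by (simp add: total_degree_add)
  qed
  have mem: "?z \<in> cocycles s r (family_ideal G)"
    by (rule fun_mod.subspace_scale[OF subspace_cocycles[OF subspace_family_ideal] y(1)])
  have "?z \<notin> ?N" using c(1) by (simp add: S_def)
  with socle show ?thesis by (intro bexI[OF _ mem] conjI allI)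
qed

lemma radical_power_ideal_eq_max_ideal_iff:
  fixes H :: "('n::finite \<times> nat) set"
  assumes pos: "\<And>i a. (i, a) \<in> H \<Longrightarrow> 0 < a"
  shows "radical \<S> (power_ideal H :: ('n, 'k::field) mpoly set) = \<mm> \<longleftrightarrow> free_vars H = {}"
proof
  assume rad: "radical \<S> (power_ideal H :: ('n, 'k) mpoly set) = \<mm>"
  have "i \<notin> free_vars H" for i
  proof -
    have "(var i :: ('n, 'k) mpoly) \<in> radical \<S> (power_ideal H)" using rad var_in_max_ideal by metis
    then obtain k where "(var i :: ('n, 'k) mpoly) ^ k \<in> power_ideal H" by (auto simp: radical_eq)
    then obtain x a where xa: "(x, a) \<in> H" "a \<le> lookup (single i k) x"
      by (auto simp: var_power power_ideal_def power_exponents_def)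
    then have "x = i" using pos[OF xa(1)] by (auto simp: lookup_single when_def split: if_splits)
    then show ?thesis using xa(1) unfolding free_vars_def by blast
  qed
  then show "free_vars H = {}" by blast
next
  assume free: "free_vars H = {}"
  let ?R = "{p :: ('n, 'k) mpoly. \<exists>k. p ^ k \<in> power_ideal H}"
  have sub: "(power_ideal H :: ('n, 'k) mpoly set) \<subseteq> \<mm>"
    by (rule power_ideal_subset_max_ideal) (rule pos)
  have "?R \<subseteq> \<mm>"
  proof
    fix p assume "p \<in> ?R"
    then obtain k where "p ^ k \<in> \<mm>" using sub by blast
    then show "p \<in> \<mm>" by (rule prime_root_mem[OF primeideal_max_ideal])
  qed
  moreover have "\<mm> \<subseteq> ?R"
    unfolding max_ideal_eq_power_ideal
  proof (rule power_ideal_subset)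
    show "ring_mod.subspace ?R" by (rule subspace_radical[OF subspace_power_ideal])
    fix i a assume "(i, a) \<in> (UNIV :: 'n set) \<times> {Suc 0}"
    moreover obtain b where "(i, b) \<in> H" using free by (auto simp: free_vars_def)
    then have "(var i :: ('n, 'k) mpoly) ^ b \<in> power_ideal H" by (rule var_power_in_power_ideal) simp
    ultimately show "(var i :: ('n, 'k) mpoly) ^ a \<in> ?R" by auto
  qed
  ultimately show "radical \<S> (power_ideal H :: ('n, 'k) mpoly set) = \<mm>" by (simp add: radical_eq)
qed

text \<open>Adding to \<open>U\<close> one member for each free variable yields a family that involves all variables.\<close>

lemma card_free_vars_lower_bound:
  fixes G :: "nat \<Rightarrow> ('n::finite \<times> nat) set"
  assumes cover: "free_vars (\<Union>j\<in>{1..s}. G j) = {}"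
    and min: "\<And>U. U \<subseteq> {1..s} \<Longrightarrow> free_vars (\<Union>j\<in>U. G j) = {} \<Longrightarrow> r \<le> card U"
    and U: "U \<in> index_sets s i"
  shows "r - i \<le> card (free_vars (\<Union>j\<in>U. G j))"
proof -
  let ?F = "free_vars (\<Union>j\<in>U. G j)"
  have "\<exists>j. j \<in> {1..s} \<and> (\<exists>a. (x, a) \<in> G j)" for x
    using cover unfolding free_vars_UN by blast
  then obtain j where j: "\<And>x. j x \<in> {1..s}" "\<And>x. \<exists>a. (x, a) \<in> G (j x)" by metis
  have "free_vars (\<Union>k\<in>U \<union> j ` ?F. G k) = {}"
    using j(2) unfolding free_vars_UN by blast
  then have "r \<le> card (U \<union> j ` ?F)"
    using U j(1) by (intro min) (auto simp: index_sets_def)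
  also have "\<dots> \<le> card U + card (j ` ?F)" by (rule card_Un_le)
  also have "\<dots> \<le> i + card ?F" using U card_image_le[of ?F j] by (simp add: index_sets_def)
  finally show ?thesis by simp
qed

lemma incidence_diff_unit_cochain:
  assumes U: "U \<in> index_sets s i" and k: "k \<in> {1..s}" "k \<notin> U"
  shows "incidence_diff s (\<lambda>W. if W = U then 1 else 0) (insert k U) = koszul_sign k (insert k U)"
proof -
  have sub: "insert k U \<subseteq> {1..s}" and fin: "finite (insert k U)"
    using U k finite_subset[of U "{1..s}"] by (auto simp: index_sets_def)
  have "incidence_diff s (\<lambda>W. if W = U then 1 else 0) (insert k U) =
      (\<Sum>x\<in>insert k U. if x = k then koszul_sign k (insert k U) else 0)"
    unfolding incidence_diff_def ring_mod.koszul_diff_def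
  proof (simp only: sub if_True, intro sum.cong refl)
    fix x assume "x \<in> insert k U"
    then have "insert k U - {x} = U \<longleftrightarrow> x = k" using k(2) by blast
    then show "koszul_sign x (insert k U) * 1 * (if insert k U - {x} = U then 1 else 0) =
        (if x = k then koszul_sign k (insert k U) else 0)" by simp
  qed
  also have "\<dots> = koszul_sign k (insert k U)" using fin by (simp add: sum.delta')
  finally show ?thesis .
qed

section \<open>Minimal depth\<close>

theorem theorem1p2:
  fixes I :: "('n::finite, 'k::field) mpoly set"
    and Q :: "nat \<Rightarrow> ('n, 'k) mpoly set"
    and s t :: nat
  assumes "monomial_ideal I"
    and "I \<noteq> carrier \<S>"
    and "ideal_size I = ereal (real t)"
    and "irredundant_presentation I s Q"
    and "P_primary \<S> \<mm> (ideal_sum \<S> Q {1..s})"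
  shows
    "let \<V> = {V \<in> index_sets s (t + 1). krull_dim (quot_ring Q V) = 0};
         W = complex_summand s Q (t + 1) \<V>;
         cond_a = (complex_diff s Q t ` carrier (complex_module s Q t) \<inter> W
                     \<noteq> {\<zero>\<^bsub>complex_module s Q (t + 1)\<^esub>});
         cond_b = (\<forall>U\<in>index_sets s t. \<exists>V\<in>\<V>. U \<subseteq> V)
     in (cond_a \<and> cond_b \<longrightarrow> depth \<S> \<mm> (ideal_module \<S> I) = ideal_size I + 1)
      \<and> (ideal_bigsize I = ideal_size I \<longrightarrow> cond_a \<and> cond_b)"
proof -
  have "\<exists>G. Q j = power_ideal G \<and> (\<forall>i a. (i, a) \<in> G \<longrightarrow> 0 < a) \<and> finite G" if "j \<in> {1..s}" for j
    using assms(4) that unfolding irredundant_presentation_def by (intro irreducible_eq_power_ideal) blast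
  then obtain G where G: "\<And>j. j \<in> {1..s} \<Longrightarrow> Q j = power_ideal (G j)"
    "\<And>j i a. j \<in> {1..s} \<Longrightarrow> (i, a) \<in> G j \<Longrightarrow> 0 < a" "\<And>j. j \<in> {1..s} \<Longrightarrow> finite (G j)"
    by metis
  have "finite (snd ` (\<Union>j\<in>{1..s}. G j))" using G(3) by auto
  then obtain N0 where N0: "\<And>b. b \<in> snd ` (\<Union>j\<in>{1..s}. G j) \<Longrightarrow> b \<le> N0"
    unfolding finite_nat_set_iff_bounded_le by blast
  \<comment> \<open>positive and at least all exponents of generators, so that \<open>N\<close>-th powers of the variables
    that are not free vanish in the quotients\<close>
  define N where "N = Suc N0"
  have N: "0 < N" "\<And>j i a. j \<in> {1..s} \<Longrightarrow> (i, a) \<in> G j \<Longrightarrow> a \<le> N"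
  proof -
    fix j i a assume "j \<in> {1..s}" "(i, a) \<in> G j"
    then have "a \<in> snd ` (\<Union>j\<in>{1..s}. G j)" by force
    then show "a \<le> N" using N0 by (simp add: N_def le_SucI)
  qed (simp add: N_def)
  have I_eq: "I = (\<Inter>j\<in>{1..s}. power_ideal (G j))"
    using assms(4) G(1) unfolding irredundant_presentation_def by simp
  have sum_eq: "ideal_sum \<S> Q U = family_ideal G U" if "U \<subseteq> {1..s}" for U
    unfolding family_ideal_def using that G(1) by (intro ideal_sum_power_ideals) blast
  have pos: "\<And>i a. (i, a) \<in> (\<Union>j\<in>U. G j) \<Longrightarrow> 0 < a" if "U \<subseteq> {1..s}" for U
    using G(2) that by blast
  have rad_all: "radical \<S> (ideal_sum \<S> Q {1..s}) = \<mm>"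
    using assms(5) by (simp add: P_primary_def)
  have spans: "spans s Q U \<longleftrightarrow> free_vars (\<Union>j\<in>U. G j) = {}" if "U \<subseteq> {1..s}" for U
    unfolding spans_def rad_all sum_eq[OF that] family_ideal_def
    by (rule radical_power_ideal_eq_max_ideal_iff) (rule pos[OF that])
  have spans_all: "spans s Q {1..s}" by (simp add: spans_def)
  then have cover: "free_vars (\<Union>j\<in>{1..s}. G j) = {}" using spans[of "{1..s}"] by simp

  \<comment> \<open>the height of the sum is the number of variables, so the size is one less than
    the least number of members whose variables cover everything\<close>
  define v where "v = (LEAST t. \<exists>U\<subseteq>{1..s}. card U = t \<and> spans s Q U)"
  have v_ex: "\<exists>U\<subseteq>{1..s}. card U = s \<and> spans s Q U" using spans_all by (intro exI[of _ "{1..s}"]) simp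
  have "\<exists>U\<subseteq>{1..s}. card U = v \<and> spans s Q U" unfolding v_def by (rule LeastI[where P = "\<lambda>t. \<exists>U\<subseteq>{1..s}. card U = t \<and> spans s Q U", OF v_ex])
  have v_le_s: "v \<le> s" unfolding v_def by (rule Least_le[where P = "\<lambda>t. \<exists>U\<subseteq>{1..s}. card U = t \<and> spans s Q U", OF v_ex])
  have size: "ideal_size I = ereal (real v - 1)"
    unfolding ideal_size_eq[OF assms(4)] family_size_def Let_def height_primary_max_ideal[OF assms(5)]
      v_def[symmetric]
    by (simp add: one_ereal_def)
  then have v: "v = t + 1" using assms(3) by simp
  have min: "t + 1 \<le> card U" if "U \<subseteq> {1..s}" "free_vars (\<Union>j\<in>U. G j) = {}" for U
    unfolding v[symmetric] v_def using that spans by (intro Least_le) blast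
  have free: "t + 1 - i \<le> card (free_vars (\<Union>j\<in>U. G j))" if "U \<in> index_sets s i" for i U
    by (rule card_free_vars_lower_bound[OF cover _ that]) (rule min)

  have dim: "krull_dim (quot_ring Q V) = 0 \<longleftrightarrow> free_vars (\<Union>j\<in>V. G j) = {}" if "V \<in> index_sets s (t + 1)" for V
  proof -
    have "V \<subseteq> {1..s}" using that by (simp add: index_sets_def)
    then show ?thesis
      unfolding quot_ring_def sum_eq[OF \<open>V \<subseteq> {1..s}\<close>] family_ideal_def
      by (intro krull_dim_quot_eq_0_iff) (rule pos)
  qed
  define \<V> where "\<V> = {V \<in> index_sets s (t + 1). krull_dim (quot_ring Q V) = 0}"
  have \<V>: "\<V> = {V \<in> index_sets s (t + 1). free_vars (\<Union>j\<in>V. G j) = {}}"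
    unfolding \<V>_def using dim by blast
  have sub_I: "ring_mod.subspace I"
    unfolding I_eq by (intro ring_mod.subspace_Int subspace_power_ideal)
  have sum_index: "ideal_sum \<S> Q V = family_ideal G V" if "V \<in> index_sets s i" for V i
    using that by (intro sum_eq) (simp add: index_sets_def)
  have regular_iff: "regular_seq \<S> (ideal_module \<S> I) fs \<longleftrightarrow>
      fun_mod.weakly_regular fs (cocycles s 0 (family_ideal G)) (zero_cochains s 0 (family_ideal G)) \<and>
      seq_mult (ideal_module \<S> I) fs \<noteq> I" for fs
    unfolding cocycles_0 zero_cochains_0 weakly_regular_vertex_embedding I_eq[symmetric]
      weakly_regular_iff_seq_mult[OF sub_I]
    by (simp add: regular_seq_def ideal_module_def)

  have depth: "depth \<S> \<mm> (ideal_module \<S> I) = ideal_size I + 1"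
    if cond_a: "complex_diff s Q t ` carrier (complex_module s Q t) \<inter> complex_summand s Q (t + 1) \<V>
      \<noteq> {\<zero>\<^bsub>complex_module s Q (t + 1)\<^esub>}"
  proof -
    from cond_a obtain h :: "nat set \<Rightarrow> ('n, 'k) mpoly" where h: "h \<in> lifted_cochains s t"
      "\<And>V. V \<in> index_sets s (t + 1) - \<V> \<Longrightarrow> incidence_diff s h V \<in> family_ideal G V"
      "\<exists>V\<in>index_sets s (t + 1). incidence_diff s h V \<notin> family_ideal G V"
      unfolding image_meets_summand_iff using sum_index by (metis DiffD1)
    let ?y = "incidence_diff s h"
    have y: "?y \<in> cocycles s (t + 1) (family_ideal G)"
      using incidence_diff_lifted[OF h(1)] fun_mod.subspace_0[OF subspace_zero_cochains[OF subspace_family_ideal]]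
      by (simp add: cocycles_def incidence_diff_twice)
    have y_nz: "?y \<notin> zero_cochains s (t + 1) (family_ideal G)"
      using h(3) by (auto simp: zero_cochains_def)
    have torsion: "?y U \<in> family_ideal G U \<or> free_vars (\<Union>j\<in>U. G j) = {}" if "U \<in> index_sets s (t + 1)" for U
      using h(2)[of U] that unfolding \<V> by blast
    have "\<exists>z\<in>(cocycles s (t + 1) (family_ideal G) :: (nat set \<Rightarrow> ('n, 'k) mpoly) set). z \<notin> zero_cochains s (t + 1) (family_ideal G) \<and>
        (\<forall>x. (\<lambda>U. var x * z U) \<in> zero_cochains s (t + 1) (family_ideal G))"
    proof (rule socle_element[OF _ y y_nz])
      show "a \<le> N" if "j \<in> {1..s}" "(x, a) \<in> G j" for j x a using that by (rule N(2))
    qed (rule torsion)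
    then obtain z :: "nat set \<Rightarrow> ('n, 'k) mpoly" where z: "z \<in> cocycles s (t + 1) (family_ideal G)"
      "z \<notin> zero_cochains s (t + 1) (family_ideal G)"
      "\<And>x. (\<lambda>U. var x * z U) \<in> zero_cochains s (t + 1) (family_ideal G)"
      by blast
    have upper: "length fs \<le> t + 1" if "regular_seq \<S> (ideal_module \<S> I) fs" "set fs \<subseteq> \<mm>" for fs
    proof (rule ccontr)
      assume "\<not> length fs \<le> t + 1"
      then have "t + 1 < length fs" by simp
      have "z \<in> zero_cochains s (t + 1) (family_ideal G)"
      proof (rule long_regular_sequence_excludes_socle[OF N(1) _ _ _ that(2) \<open>t + 1 < length fs\<close> z(1)])
        show "a \<le> N" if "j \<in> {1..s}" "(x, a) \<in> G j" for j x a using that by (rule N(2))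
        show "t + 1 - i \<le> card (free_vars (\<Union>j\<in>U. G j))" if "U \<in> index_sets s i" for i U
          using that by (rule free)
        show "fun_mod.weakly_regular fs (cocycles s 0 (family_ideal G)) (zero_cochains s 0 (family_ideal G))"
          using that(1) unfolding regular_iff by blast
      qed (rule z(3))
      with z(2) show False by blast
    qed
    let ?fs = "map (elem_sym N) [1..<Suc (t + 1)] :: ('n, 'k) mpoly list"
    have fs_m: "set ?fs \<subseteq> \<mm>" by (auto intro!: elem_sym_in_max_ideal[OF N(1)])
    have reg: "fun_mod.weakly_regular ?fs (cocycles s 0 (family_ideal G)) (zero_cochains s 0 (family_ideal G))"
    proof -
      have "fun_mod.weakly_regular (map (elem_sym N) [1..<Suc (t + 1 - 0)]) (cocycles s 0 (family_ideal G))
          (zero_cochains s 0 (family_ideal G :: _ \<Rightarrow> ('n, 'k) mpoly set))"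
      proof (rule elem_sym_regular_cocycles[OF N(1)])
        show "a \<le> N" if "j \<in> {1..s}" "(x, a) \<in> G j" for j x a using that by (rule N(2))
        show "t + 1 - i \<le> card (free_vars (\<Union>j\<in>U. G j))" if "U \<in> index_sets s i" for i U
          using that by (rule free)
      qed simp
      then show ?thesis by (simp only: diff_zero)
    qed
    have "\<exists>p\<in>I. p \<noteq> 0"
    proof -
      \<comment> \<open>if one member were the zero ideal, the others would be redundant, and the sum would be zero\<close>
      have nonempty: "G j \<noteq> {}" if j: "j \<in> {1..s}" for j
      proof
        assume empty: "G j = {}"
        have "j = k" if k: "k \<in> {1..s}" for k
          using irredundant_minimal[OF assms(4) j k] G(1)[OF j] G(1)[OF k] power_ideal_mono[of "{}" "G k"] empty
          by simp
        then have "(\<Union>k\<in>{1..s}. G k) = {}" using empty by blast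
        then show False using cover by (simp add: free_vars_def)
      qed
      have "(monomial (power_product N UNIV) :: ('n, 'k) mpoly) \<in> power_ideal (G j)" if j: "j \<in> {1..s}" for j
      proof -
        obtain x a where "(x, a) \<in> G j" using nonempty[OF j] by auto
        then show ?thesis
          using N(2)[OF j, of x a] by (auto simp: power_ideal_def power_exponents_def lookup_power_product)
      qed
      then have "(monomial (power_product N UNIV) :: ('n, 'k) mpoly) \<in> I" unfolding I_eq by blast
      moreover have "(monomial (power_product N UNIV) :: ('n, 'k) mpoly) \<noteq> 0"
        by (metis keys_single keys_zero monomial_def insert_not_empty one_neq_zero)
      ultimately show ?thesis by blast
    qed
    then obtain p where p: "p \<in> I" "p \<noteq> 0" by blast
    have "regular_seq \<S> (ideal_module \<S> I) ?fs"
      unfolding regular_iff using reg seq_mult_proper[OF sub_I p fs_m] by blast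
    then have "ereal (real (length ?fs)) \<le> depth \<S> \<mm> (ideal_module \<S> I)"
      unfolding depth_def using fs_m by (intro SUP_upper) blast
    moreover have "depth \<S> \<mm> (ideal_module \<S> I) \<le> ereal (real (t + 1))"
      unfolding depth_def
    proof (rule SUP_least)
      fix fs assume "fs \<in> {fs. regular_seq \<S> (ideal_module \<S> I) fs \<and> set fs \<subseteq> \<mm>}"
      then have "length fs \<le> t + 1" using upper by blast
      then show "ereal (real (length fs)) \<le> ereal (real (t + 1))"
        by (simp only: ereal_less_eq of_nat_le_iff)
    qed
    moreover have "length ?fs = t + 1"
      by (simp only: length_map length_upt diff_Suc_Suc diff_zero One_nat_def add_Suc_right add_0_right)
    ultimately have "depth \<S> \<mm> (ideal_module \<S> I) = ereal (real (t + 1))"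
      by (simp only: antisym)
    then show ?thesis unfolding assms(3) by (simp add: one_ereal_def)
  qed

  have conds: "complex_diff s Q t ` carrier (complex_module s Q t) \<inter> complex_summand s Q (t + 1) \<V>
        \<noteq> {\<zero>\<^bsub>complex_module s Q (t + 1)\<^esub>}"
    "\<forall>U\<in>index_sets s t. \<exists>V\<in>\<V>. U \<subseteq> V"
    if big: "ideal_bigsize I = ideal_size I"
  proof -
    define v' where "v' = (LEAST t. \<forall>U\<subseteq>{1..s}. card U = t \<longrightarrow> spans s Q U)"
    have "\<forall>U\<subseteq>{1..s}. card U = s \<longrightarrow> spans s Q U"
    proof (intro allI impI)
      fix U assume "U \<subseteq> {1..s}" "card U = s"
      then have "U = {1..s}" by (intro card_subset_eq) simp_all
      with spans_all show "spans s Q U" by simp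
    qed
    then have v'_all: "\<forall>U\<subseteq>{1..s}. card U = v' \<longrightarrow> spans s Q U" unfolding v'_def by (rule LeastI)
    have "ideal_bigsize I = ereal (real v' - 1)"
      unfolding ideal_bigsize_eq[OF assms(4)] family_bigsize_def Let_def height_primary_max_ideal[OF assms(5)]
        v'_def[symmetric]
      by (simp add: one_ereal_def)
    then have "v' = t + 1" using big assms(3) by simp
    then have \<V>_all: "\<V> = index_sets s (t + 1)"
      unfolding \<V> using v'_all spans by (auto simp: index_sets_def)
    have extend: "\<exists>k\<in>{1..s}. k \<notin> U \<and> insert k U \<in> index_sets s (t + 1)" if U: "U \<in> index_sets s t" for U
    proof -
      have U': "U \<subseteq> {1..s}" "card U = t" "finite U"
        using U finite_subset[of U "{1..s}"] by (auto simp: index_sets_def)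
      then have "U \<noteq> {1..s}" using v_le_s v by auto
      then obtain k where "k \<in> {1..s}" "k \<notin> U" using U' by blast
      then show ?thesis using U' by (auto simp: index_sets_def)
    qed
    show "\<forall>U\<in>index_sets s t. \<exists>V\<in>\<V>. U \<subseteq> V"
      unfolding \<V>_all using extend by blast
    \<comment> \<open>the differential of the element \<open>1\<close> of one component has a component \<open>\<plusminus>1\<close>\<close>
    have U0: "{1..t} \<in> index_sets s t" using v_le_s v by (auto simp: index_sets_def)
    then obtain k where k: "k \<in> {1..s}" "k \<notin> {1..t}" "insert k {1..t} \<in> index_sets s (t + 1)"
      using extend by blast
    define h :: "nat set \<Rightarrow> ('n, 'k) mpoly" where "h W = (if W = {1..t} then 1 else 0)" for W
    have "h \<in> lifted_cochains s t" using U0 by (simp add: lifted_cochains_def h_def)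
    moreover have "incidence_diff s h (insert k {1..t}) \<notin> ideal_sum \<S> Q (insert k {1..t})"
    proof
      assume "incidence_diff s h (insert k {1..t}) \<in> ideal_sum \<S> Q (insert k {1..t})"
      then have mem: "koszul_sign k (insert k {1..t}) \<in> (family_ideal G (insert k {1..t}) :: ('n, 'k) mpoly set)"
        using incidence_diff_unit_cochain[OF U0 k(1,2), where 'a = "('n, 'k) mpoly"] sum_index[OF k(3)]
        unfolding h_def by simp
      from ring_mod.subspace_scale[OF subspace_family_ideal this, of "koszul_sign k (insert k {1..t})"]
      have "(1 :: ('n, 'k) mpoly) \<in> family_ideal G (insert k {1..t})" by simp
      moreover have "insert k {1..t} \<subseteq> {1..s}" using k(3) by (simp add: index_sets_def)
      then have "(family_ideal G (insert k {1..t}) :: ('n, 'k) mpoly set) \<subseteq> \<mm>"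
        unfolding family_ideal_def by (intro power_ideal_subset_max_ideal) (rule pos)
      ultimately have "(1 :: ('n, 'k) mpoly) \<in> \<mm>" by blast
      then show False using primeideal_max_ideal[where 'n = 'n and 'k = 'k] by (simp add: primeideal_iff)
    qed
    ultimately show "complex_diff s Q t ` carrier (complex_module s Q t) \<inter> complex_summand s Q (t + 1) \<V>
        \<noteq> {\<zero>\<^bsub>complex_module s Q (t + 1)\<^esub>}"
      unfolding image_meets_summand_iff using k(3) \<V>_all by blast
  qed
  show ?thesis
    unfolding Let_def \<V>_def[symmetric] using depth conds by blast
qed

end
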